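(* Let $M\ge1$ and, for $m=1,\dots,M$, let $f_{\{0,m\}},f_{\{1,m\}}$ be probability densities on $\mathbb{R}$ with $0<\mathbf{I}(f_{\{1,m\}}\|f_{\{0,m\}})<\infty$ and $0<\mathbf{I}(f_{\{0,m\}}\|f_{\{1,m\}})<\infty$. For any $\epsilon>0$, when the multi-sensor CuSum-AC algorithm is used with $a=\ln\zeta$, with any $a_1$ such that $0<a_1<a$, and with $\epsilon_1^{\mathcal{M}}=(\epsilon_{\{1,1\}},\dots,\epsilon_{\{M,1\}})\in\mathscr{E}_*^{\mathcal{M}}(\epsilon,a_1)$, its stopping time $T_c^{\mathcal{M}}(\ln\zeta)$ and censoring policy $\Psi^{\mathcal{M}}$ satisfy the false alarm constraint and the communication rate constraint $$\mathbb{E}_\infty[T_c^{\mathcal{M}}(\ln\zeta)]\ge\zeta,\qquad r(\Psi^{\mathcal{M}})\le\epsilon .$$ Furthermore, the CuSum-AC algorithm is asymptotically optimal for the problem of minimizing $d_L(T,\Psi^{\mathcal{M}})$ over $(T,\Psi^{\mathcal{M}})$ subject to $\mathbb{E}_\infty[T]\ge\zeta$ and $r(\Psi^{\mathcal{M}})\le\epsilon$, i.e., as $\zeta\to\infty$, $$d_L(T_c^{\mathcal{M}}(\ln\zeta),\Psi^{\mathcal{M}})=\frac{\ln\zeta}{\sum_{m=1}^M\mathbf{I}(f_{\{1,m\}}\|f_{\{0,m\}})}\,(1+o(1)).$$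
   Context: Here $\zeta\ge1$ is the given lower bound on the average run length to false alarm. Observation model. There are $M$ sensors; sensor $m$ observes real random variables $X_{\{m,1\}},X_{\{m,2\}},\dots$. For $\nu\in\mathbb{N}_+=\{1,2,\dots\}$, under $\mathbb{P}_\nu$ all $X_{\{m,k\}}$ are independent (over $m$ and $k$), $X_{\{m,k\}}$ has density $f_{\{0,m\}}$ for $k<\nu$ and $f_{\{1,m\}}$ for $k\ge\nu$; under $\mathbb{P}_\infty$ every $X_{\{m,k\}}$ has density $f_{\{0,m\}}$. $\mathbb{E}_\nu,\mathbb{E}_\infty$ are the expectations; $\mathbf{I}(f\|g)=\int f\ln(f/g)\,dx$; $(x)^+=\max(0,x)$; $L_k=\sum_{m=1}^M\ln\frac{f_{\{1,m\}}(X_{\{m,k\}})}{f_{\{0,m\}}(X_{\{m,k\}})}$. Censoring strategies. A censoring strategy is a (measurable) map $\psi:\mathbb{R}\to\{0,1\}$. At time $k$ sensor $m$ uses a strategy $\psi_{\{m,k\}}$, and $\gamma_{\{m,k\}}=\psi_{\{m,k\}}(X_{\{m,k\}})$; $X_{\{m,k\}}$ is transmitted iff $\gamma_{\{m,k\}}=1$. $\mathcal{I}^m_k=\{(j,\gamma_{\{m,j\}},\gamma_{\{m,j\}}X_{\{m,j\}}):1\le j\le k\}$ and $\mathcal{I}^{\mathcal{M}}_k=\{\mathcal{I}^1_k,\dots,\mathcal{I}^M_k\}$ (empty for $k=0$); the strategies at time $k$ are determined by $\mathcal{I}^{\mathcal{M}}_{k-1}$. For sensor $m$ and strategy $\psi$,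 $$\ell^{\psi}(\gamma,x)=\gamma\ln\frac{f_{\{1,m\}}(x)}{f_{\{0,m\}}(x)}+(1-\gamma)\ln\frac{\mathbb{P}_1\{\psi(X_{\{m,1\}})=0\}}{\mathbb{P}_\infty\{\psi(X_{\{m,1\}})=0\}}.$$ For $0<e\le1$ and sensor $m$, $\psi^*(e)$ (depending on $m$) is a maximizer of $\mathbb{E}_1[\ell^\psi(\psi(X_{\{m,1\}}),X_{\{m,1\}})]$ over all $\psi$ with $\mathbb{P}_\infty\{\psi(X_{\{m,1\}})=1\}=e$; $\psi^*(1)\equiv1$ (no observation is censored). Multi-sensor CuSum-AC algorithm with parameters $a$, $a_1<a$, $\epsilon_1^{\mathcal{M}}=(\epsilon_{\{1,1\}},\dots,\epsilon_{\{M,1\}})\in(0,1]^M$. Put $s_0^{\mathcal{M}}=0$ and for $k\ge1$ and all $m$: $\psi_{\{m,k\}}=\psi^*(1)$ if $s^{\mathcal{M}}_{k-1}\ge a_1$, and $\psi_{\{m,k\}}=\psi^*(\epsilon_{\{m,1\}})$ otherwise; $\tilde s^{\mathcal{M}}_k=\max\{0,s^{\mathcal{M}}_{k-1}+\sum_{m=1}^M\ell^{\psi_{\{m,k\}}}(\gamma_{\{m,k\}},X_{\{m,k\}})\}$; $s^{\mathcal{M}}_k=a_1$ if $s^{\mathcal{M}}_{k-1}<a_1$ and $\tilde s^{\mathcal{M}}_k\ge a_1$, and $s^{\mathcal{M}}_k=\tilde s^{\mathcal{M}}_k$ otherwise. $\Psi^{\mathcal{M}}$ is the collection of all $\psi_{\{m,k\}}$,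 and $T_c^{\mathcal{M}}(a)=\inf\{k\ge1:s^{\mathcal{M}}_k\ge a\}$. Performance indices of a pair $(T,\Psi^{\mathcal{M}})$, $T$ a stopping time with respect to $\sigma(\mathcal{I}_k^{\mathcal{M}})$: the average run length to false alarm $\mathbb{E}_\infty[T]$; the average pre-change communication rate $$r(\Psi^{\mathcal{M}})=\limsup_{n\to\infty}\frac1{nM}\mathbb{E}_\infty\Big[\sum_{k=1}^n\sum_{m=1}^M\gamma_{\{m,k\}}\,\Big|\,T\ge n\Big];$$ and Lorden's detection delay $$d_L(T,\Psi^{\mathcal{M}})=\sup_{1\le\nu<\infty}\Big\{\operatorname*{ess\,sup}_{\mathcal{I}^{\mathcal{M}}_{\nu-1}}\mathbb{E}_\nu[(T-\nu+1)^+\mid\mathcal{I}^{\mathcal{M}}_{\nu-1}]\Big\}.$$ The set $\mathscr{E}_*^{\mathcal{M}}(\epsilon,a_1)$ is the set of $\epsilon_1^{\mathcal{M}}\in(0,1]^M$ satisfying both of the following. (i) For every $a\in(a_1,+\infty]$, the multi-sensor CuSum-AC algorithm with parameters $a,a_1,\epsilon_1^{\mathcal{M}}$ satisfies $r(\Psi^{\mathcal{M}})\le\epsilon$. (ii) For all $a>a_1$, $\mathbb{E}_\infty[\phi(\hat s_{\eta(0)})\mid\hat s_{\eta(0)}<a_1]\ge\mathbb{E}_\infty[T(a_1)]$, where $\eta(0)=\inf\{n\ge1:\sum_{k=1}^nL_k\notin[0,a-a_1]\}$; $\hat s_{\eta(0)}=(a_1+\sum_{k=1}^{\eta(0)}L_k)^+$;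 for $0\le z<a_1$, $\phi(z)=\inf\{k\ge1:\breve s_k(z)\ge a_1\}$ with $\breve s_0(z)=z$ and $\breve s_k(z)=\big(\breve s_{k-1}(z)+\sum_{m=1}^M\ell^{\psi^*(\epsilon_{\{m,1\}})}(\gamma_{\{m,k\}},X_{\{m,k\}})\big)^+$, $\gamma_{\{m,k\}}=\psi^*(\epsilon_{\{m,1\}})(X_{\{m,k\}})$, where in $\phi(\hat s_{\eta(0)})$ the recursion uses fresh observations, i.e. those following time $\eta(0)$; and $T(a_1)=\inf\{k\ge1:c_k>a_1\}$ with $c_0=0$, $c_k=(c_{k-1}+L_k)^+$ (the CuSum stopping time). *)

theory Defs
  imports "HOL-Probability.Probability" "HOL-Library.Landau_Symbols"
begin

definition prob_density :: "(real \<Rightarrow> real) \<Rightarrow> bool" where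
  "prob_density f \<longleftrightarrow>
     f \<in> borel_measurable borel \<and> (\<forall>x. 0 \<le> f x) \<and> (\<integral>\<^sup>+x. ennreal (f x) \<partial>lborel) = 1"

text \<open>
  The integrand \<open>f ln (f / g)\<close> carries the usual conventions \<open>0 ln (0 / q) = 0\<close> and
  \<open>p ln (p / 0) = \<infinity>\<close> for \<open>p > 0\<close>; the real-valued \<open>ln\<close> and division would give \<open>0\<close> in the
  latter case. For probability densities the negative part always has a finite integral,
  because \<open>f ln (f / g) \<ge> f - g\<close>, so the difference below is never \<open>\<infinity> - \<infinity>\<close>.
\<close>

definition kl_integrand :: "(real \<Rightarrow> real) \<Rightarrow> (real \<Rightarrow> real) \<Rightarrow> real \<Rightarrow> ereal" where
  "kl_integrand f g x =
     (if f x = 0 then 0 else if g x = 0 then \<infinity> else ereal (f x * ln (f x / g x)))"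

definition kl_info :: "(real \<Rightarrow> real) \<Rightarrow> (real \<Rightarrow> real) \<Rightarrow> ereal" where
  "kl_info f g =
     enn2ereal (\<integral>\<^sup>+x. e2ennreal (kl_integrand f g x) \<partial>lborel)
     - enn2ereal (\<integral>\<^sup>+x. e2ennreal (- kl_integrand f g x) \<partial>lborel)"

text \<open>
  Sensors are indexed by \<open>1, \<dots>, M\<close> and times by \<open>1, 2, \<dots>\<close>; the law \<open>P \<nu>\<close> is used for
  \<open>\<nu> \<ge> 1\<close> only, including \<open>\<nu> = \<infinity>\<close> (no change). All laws live on one measurable space.
\<close>

locale change_model =
  fixes M :: nat
    and f0 f1 :: "nat \<Rightarrow> real \<Rightarrow> real"
    and P :: "enat \<Rightarrow> 'a measure"
    and X :: "nat \<Rightarrow> nat \<Rightarrow> 'a \<Rightarrow> real"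
  assumes sensors: "1 \<le> M"
    and density0: "m \<in> {1..M} \<Longrightarrow> prob_density (f0 m)"
    and density1: "m \<in> {1..M} \<Longrightarrow> prob_density (f1 m)"
    and prob: "1 \<le> \<nu> \<Longrightarrow> prob_space (P \<nu>)"
    and space_law: "1 \<le> \<nu> \<Longrightarrow> space (P \<nu>) = space (P \<infinity>)"
    and sets_law: "1 \<le> \<nu> \<Longrightarrow> sets (P \<nu>) = sets (P \<infinity>)"
    and indep: "1 \<le> \<nu> \<Longrightarrow>
      prob_space.indep_vars (P \<nu>) (\<lambda>_. borel) (\<lambda>(m, k). X m k) ({1..M} \<times> {1..})"
    and law: "\<lbrakk>1 \<le> \<nu>; m \<in> {1..M}; 1 \<le> k\<rbrakk> \<Longrightarrow>
      distributed (P \<nu>) lborel (X m k)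
        (\<lambda>x. ennreal (if enat k < \<nu> then f0 m x else f1 m x))"

text \<open>A censoring strategy; the value \<open>True\<close> stands for \<open>1\<close>, i.e. the observation is transmitted.\<close>

definition censoring_strategy :: "(real \<Rightarrow> bool) \<Rightarrow> bool" where
  "censoring_strategy \<psi> \<longleftrightarrow> Measurable.pred borel \<psi>"

context
  fixes M :: nat
    and f0 f1 :: "nat \<Rightarrow> real \<Rightarrow> real"
    and P :: "enat \<Rightarrow> 'a measure"
    and X :: "nat \<Rightarrow> nat \<Rightarrow> 'a \<Rightarrow> real"
begin

definition llr_sum :: "nat \<Rightarrow> 'a \<Rightarrow> real" where
  "llr_sum k \<omega> = (\<Sum>m=1..M. ln (f1 m (X m k \<omega>) / f0 m (X m k \<omega>)))"

definition censored_llr :: "nat \<Rightarrow> (real \<Rightarrow> bool) \<Rightarrow> bool \<Rightarrow> real \<Rightarrow> real" where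
  "censored_llr m \<psi> \<gamma> x =
     of_bool \<gamma> * ln (f1 m x / f0 m x)
     + (1 - of_bool \<gamma>) *
         ln (\<P>(\<omega> in P 1. \<not> \<psi> (X m 1 \<omega>)) / \<P>(\<omega> in P \<infinity>. \<not> \<psi> (X m 1 \<omega>)))"

text \<open>
  The maximizers need not be unique; \<open>\<psi>s m e\<close> is an arbitrary choice of one for sensor \<open>m\<close>
  and rate \<open>e\<close>.
\<close>

definition optimal_censoring :: "(nat \<Rightarrow> real \<Rightarrow> real \<Rightarrow> bool) \<Rightarrow> bool" where
  "optimal_censoring \<psi>s \<longleftrightarrow>
     (\<forall>m\<in>{1..M}. \<psi>s m 1 = (\<lambda>_. True) \<and>
       (\<forall>e\<in>{0<..1}.
          is_arg_max
            (\<lambda>\<psi>. \<integral>\<omega>. censored_llr m \<psi> (\<psi> (X m 1 \<omega>)) (X m 1 \<omega>) \<partial>P 1)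
            (\<lambda>\<psi>. censoring_strategy \<psi> \<and> \<P>(\<omega> in P \<infinity>. \<psi> (X m 1 \<omega>)) = e)
            (\<psi>s m e)))"

text \<open>
  A censoring policy \<open>\<Psi>\<close> gives the strategy \<open>\<Psi> m k \<omega>\<close> that sensor \<open>m\<close> applies at time \<open>k\<close>
  on the sample point \<open>\<omega>\<close>.
\<close>

definition transmits :: "(nat \<Rightarrow> nat \<Rightarrow> 'a \<Rightarrow> real \<Rightarrow> bool) \<Rightarrow> nat \<Rightarrow> nat \<Rightarrow> 'a \<Rightarrow> bool" where
  "transmits \<Psi> m k \<omega> = \<Psi> m k \<omega> (X m k \<omega>)"

definition info :: "(nat \<Rightarrow> nat \<Rightarrow> 'a \<Rightarrow> real \<Rightarrow> bool) \<Rightarrow> nat \<Rightarrow> 'a \<Rightarrow> nat \<times> nat \<Rightarrow> bool \<times> real" where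
  "info \<Psi> k \<omega> =
     (\<lambda>(m, j) \<in> {1..M} \<times> {1..k}.
        (transmits \<Psi> m j \<omega>, of_bool (transmits \<Psi> m j \<omega>) * X m j \<omega>))"

definition info_algebra :: "(nat \<Rightarrow> nat \<Rightarrow> 'a \<Rightarrow> real \<Rightarrow> bool) \<Rightarrow> nat \<Rightarrow> 'a measure" where
  "info_algebra \<Psi> k =
     vimage_algebra (space (P \<infinity>)) (info \<Psi> k)
       (Pi\<^sub>M ({1..M} \<times> {1..k}) (\<lambda>_. count_space UNIV \<Otimes>\<^sub>M borel))"

text \<open>
  Measurability in the pair \<open>(\<omega>, x)\<close> with respect to the past information says both that every
  strategy is measurable and that the strategies at time \<open>k\<close> are determined by the information
  up to time \<open>k - 1\<close>.
\<close>

definition censoring_policy :: "(nat \<Rightarrow> nat \<Rightarrow> 'a \<Rightarrow> real \<Rightarrow> bool) \<Rightarrow> bool" where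
  "censoring_policy \<Psi> \<longleftrightarrow>
     (\<forall>m\<in>{1..M}. \<forall>k\<ge>1.
        Measurable.pred (info_algebra \<Psi> (k - 1) \<Otimes>\<^sub>M borel) (\<lambda>(\<omega>, x). \<Psi> m k \<omega> x))"

text \<open>Library stopping times take values in the time set itself, hence cannot be infinite.\<close>

definition info_stopping_time ::
    "(nat \<Rightarrow> nat \<Rightarrow> 'a \<Rightarrow> real \<Rightarrow> bool) \<Rightarrow> ('a \<Rightarrow> enat) \<Rightarrow> bool" where
  "info_stopping_time \<Psi> T \<longleftrightarrow> (\<forall>k. Measurable.pred (info_algebra \<Psi> k) (\<lambda>\<omega>. T \<omega> \<le> enat k))"

definition arl :: "('a \<Rightarrow> enat) \<Rightarrow> ennreal" where
  "arl T = (\<integral>\<^sup>+\<omega>. ennreal_of_enat (T \<omega>) \<partial>P \<infinity>)"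

text \<open>
  Conditioning on an event is integration against \<open>uniform_measure\<close>, which is the null measure
  if the event has probability \<open>0\<close>; the contribution of such an \<open>n\<close> is therefore \<open>0\<close>.
\<close>

definition comm_rate :: "('a \<Rightarrow> enat) \<Rightarrow> (nat \<Rightarrow> nat \<Rightarrow> 'a \<Rightarrow> real \<Rightarrow> bool) \<Rightarrow> ereal" where
  "comm_rate T \<Psi> =
     limsup (\<lambda>n. ereal (1 / (real n * real M) *
       (\<integral>\<omega>. (\<Sum>k=1..n. \<Sum>m=1..M. of_bool (transmits \<Psi> m k \<omega>))
          \<partial>uniform_measure (P \<infinity>) {\<omega> \<in> space (P \<infinity>). enat n \<le> T \<omega>})))"

text \<open>Subtraction on \<^typ>\<open>enat\<close> is truncated, so \<open>T + 1 - \<nu>\<close> is the positive part of \<open>T - \<nu> + 1\<close>.\<close>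

definition lorden_delay :: "('a \<Rightarrow> enat) \<Rightarrow> (nat \<Rightarrow> nat \<Rightarrow> 'a \<Rightarrow> real \<Rightarrow> bool) \<Rightarrow> ennreal" where
  "lorden_delay T \<Psi> =
     (SUP \<nu>\<in>{1..}. esssup (P (enat \<nu>))
        (nn_cond_exp (P (enat \<nu>)) (info_algebra \<Psi> (\<nu> - 1))
          (\<lambda>\<omega>. ennreal_of_enat (T \<omega> + 1 - enat \<nu>))))"

definition feasible ::
    "real \<Rightarrow> real \<Rightarrow> (('a \<Rightarrow> enat) \<times> (nat \<Rightarrow> nat \<Rightarrow> 'a \<Rightarrow> real \<Rightarrow> bool)) set" where
  "feasible \<epsilon> \<zeta> =
     {(T, \<Psi>). censoring_policy \<Psi> \<and> info_stopping_time \<Psi> T \<and>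
        ennreal \<zeta> \<le> arl T \<and> comm_rate T \<Psi> \<le> ereal \<epsilon>}"

context
  fixes \<psi>s :: "nat \<Rightarrow> real \<Rightarrow> real \<Rightarrow> bool"
    and a1 :: real
    and \<epsilon>1 :: "nat \<Rightarrow> real"
begin

primrec ac_stat :: "nat \<Rightarrow> 'a \<Rightarrow> real" where
  "ac_stat 0 \<omega> = 0"
| "ac_stat (Suc k) \<omega> =
     (let \<psi> = (\<lambda>m. if ac_stat k \<omega> \<ge> a1 then \<psi>s m 1 else \<psi>s m (\<epsilon>1 m));
          s' = max 0 (ac_stat k \<omega> +
                 (\<Sum>m=1..M. censored_llr m (\<psi> m) (\<psi> m (X m (Suc k) \<omega>)) (X m (Suc k) \<omega>)))
      in if ac_stat k \<omega> < a1 \<and> s' \<ge> a1 then a1 else s')"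

definition ac_policy :: "nat \<Rightarrow> nat \<Rightarrow> 'a \<Rightarrow> real \<Rightarrow> bool" where
  "ac_policy m k \<omega> = (if ac_stat (k - 1) \<omega> \<ge> a1 then \<psi>s m 1 else \<psi>s m (\<epsilon>1 m))"

text \<open>
  Here and below an infimum of times is taken in \<^typ>\<open>enat\<close>, where the empty set has infimum \<open>\<infinity>\<close>.
  The threshold may be \<open>\<infinity>\<close>.
\<close>

definition ac_time :: "ereal \<Rightarrow> 'a \<Rightarrow> enat" where
  "ac_time a \<omega> = (INF k\<in>{k. 1 \<le> k \<and> a \<le> ereal (ac_stat k \<omega>)}. enat k)"

text \<open>The recursion started at \<open>z\<close> that uses the observations following time \<open>n\<close>.\<close>

primrec low_stat :: "nat \<Rightarrow> real \<Rightarrow> nat \<Rightarrow> 'a \<Rightarrow> real" where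
  "low_stat n z 0 \<omega> = z"
| "low_stat n z (Suc k) \<omega> =
     max 0 (low_stat n z k \<omega> +
       (\<Sum>m=1..M. censored_llr m (\<psi>s m (\<epsilon>1 m))
          (\<psi>s m (\<epsilon>1 m) (X m (n + Suc k) \<omega>)) (X m (n + Suc k) \<omega>)))"

definition low_time :: "nat \<Rightarrow> real \<Rightarrow> 'a \<Rightarrow> enat" where
  "low_time n z \<omega> = (INF k\<in>{k. 1 \<le> k \<and> a1 \<le> low_stat n z k \<omega>}. enat k)"

end

definition exit_time :: "real \<Rightarrow> 'a \<Rightarrow> enat" where
  "exit_time b \<omega> = (INF n\<in>{n. 1 \<le> n \<and> (\<Sum>k=1..n. llr_sum k \<omega>) \<notin> {0..b}}. enat n)"

definition exit_stat :: "real \<Rightarrow> real \<Rightarrow> 'a \<Rightarrow> real" where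
  "exit_stat a1 b \<omega> = max 0 (a1 + (\<Sum>k=1..the_enat (exit_time b \<omega>). llr_sum k \<omega>))"

primrec cusum_stat :: "nat \<Rightarrow> 'a \<Rightarrow> real" where
  "cusum_stat 0 \<omega> = 0"
| "cusum_stat (Suc k) \<omega> = max 0 (cusum_stat k \<omega> + llr_sum (Suc k) \<omega>)"

definition cusum_time :: "real \<Rightarrow> 'a \<Rightarrow> enat" where
  "cusum_time c \<omega> = (INF k\<in>{k. 1 \<le> k \<and> c < cusum_stat k \<omega>}. enat k)"

text \<open>
  The exit time is finite almost surely before the change; the conditioning event says so
  explicitly because \<open>exit_stat\<close> is meaningless on the null set where it is infinite.
\<close>

definition admissible_rates ::
    "(nat \<Rightarrow> real \<Rightarrow> real \<Rightarrow> bool) \<Rightarrow> real \<Rightarrow> real \<Rightarrow> (nat \<Rightarrow> real) set" where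
  "admissible_rates \<psi>s \<epsilon> a1 =
     {\<epsilon>1. \<epsilon>1 \<in> {1..M} \<rightarrow> {0<..1} \<and>
        (\<forall>a>ereal a1. comm_rate (ac_time \<psi>s a1 \<epsilon>1 a) (ac_policy \<psi>s a1 \<epsilon>1) \<le> ereal \<epsilon>) \<and>
        (\<forall>a>a1.
           (\<integral>\<^sup>+\<omega>. ennreal_of_enat
               (low_time \<psi>s a1 \<epsilon>1 (the_enat (exit_time (a - a1) \<omega>)) (exit_stat a1 (a - a1) \<omega>) \<omega>)
             \<partial>uniform_measure (P \<infinity>)
               {\<omega> \<in> space (P \<infinity>). exit_time (a - a1) \<omega> < \<infinity> \<and> exit_stat a1 (a - a1) \<omega> < a1})
           \<ge> (\<integral>\<^sup>+\<omega>. ennreal_of_enat (cusum_time a1 \<omega>) \<partial>P \<infinity>))}"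

end

end

theory Submission
  imports Defs "HOL-Real_Asymp.Real_Asymp"
begin

text \<open>
  Let \<open>I\<close> be the sum of the divergences of the sensors.

  Each censored increment is the logarithm of a likelihood ratio, so the Shiryaev--Roberts
  recursion \<open>R (n + 1) = (1 + R n) exp l\<close> driven by the increments \<open>l\<close> makes \<open>R n - n\<close> a martingale
  before the change; since \<open>R\<close> dominates the exponential of the statistic, the mean time to false
  alarm at threshold \<open>a\<close> is at least \<open>exp a\<close>.

  For the delay of the algorithm, a potential function on the states bounds the expected time to
  reach \<open>a\<close> after the change by \<open>\<rho> a / I + C\<close>, for every \<open>\<rho> > 1\<close>, whatever the state at the
  change. This needs a positive drift below \<open>a1\<close>: the densities have no atoms, so some strategy of
  the prescribed rate transmits observations where the two densities differ, and the optimal one is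
  at least as informative.

  Conversely, if the mean time to false alarm is at least \<open>\<zeta>\<close>, then for some \<open>\<nu>\<close> an alarm
  in the window \<open>\<nu>, \<dots>, \<nu> + w - 1\<close> has conditional probability at most \<open>2 w / \<zeta>\<close> before the
  change. Comparing the two laws on this window by means of their divergence up to the stopping time
  gives delay at least \<open>(1 - o(1)) ln \<zeta> / I\<close> with \<open>w\<close> of order \<open>(ln \<zeta>)\<^sup>2\<close>.
\<close>

section \<open>Measures, densities and extended reals\<close>

text \<open>Three obstacles shape the details. First, the lower bound concerns all censoring
  policies, and the information of a policy depends on its own past decisions. All these algebras
  lie inside the one generated by the raw observations, where independence and likelihood ratios are
  explicit, so a policy enters only through its stopping events and cannot do better than full
  observation. Second, the log likelihood ratios are known to have first moments only; hence Wald's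
  identity with \<open>1 + x \<le> exp x\<close> below, and truncation above, instead of variance
  estimates. Third, the delay is a supremum of essential suprema of conditional expectations; in
  both directions it is traded for inequalities between integrals over events of the past.

  The order of \<open>w\<close> is a compromise. It must exceed \<open>ln \<zeta>\<close>, so that
  by Markov's inequality a procedure with delay of order \<open>ln \<zeta>\<close> rarely outlasts
  the window; its own logarithm must be negligible, so that \<open>ln (\<zeta> / (2 * w))\<close> is
  still asymptotic to \<open>ln \<zeta>\<close>.\<close>

lemma density_PiM:
  fixes N :: "'i \<Rightarrow> 'b measure"
  assumes I: "finite I"
    and N: "\<And>i. i \<in> I \<Longrightarrow> sigma_finite_measure (N i)"
    and D: "\<And>i. i \<in> I \<Longrightarrow> sigma_finite_measure (density (N i) (r i))"
    and r: "\<And>i. i \<in> I \<Longrightarrow> r i \<in> borel_measurable (N i)"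
  shows "density (PiM I N) (\<lambda>x. \<Prod>i\<in>I. r i (x i)) = PiM I (\<lambda>i. density (N i) (r i))"
proof -
  \<comment> \<open>The locale of product measures wants sigma-finiteness at every index, so both
    families are padded by null measures outside \<open>I\<close>.\<close>
  define N1 where "N1 i = (if i \<in> I then N i else null_measure (N i))" for i
  define N2 where "N2 i = (if i \<in> I then density (N i) (r i) else null_measure (N i))" for i
  have null: "sigma_finite_measure (null_measure K)" for K :: "'b measure"
    by (rule finite_measure.axioms(1), rule finite_measureI) simp
  interpret N1: product_sigma_finite N1
    by (rule product_sigma_finite.intro) (simp add: N1_def N null)
  interpret N2: product_sigma_finite N2
    by (rule product_sigma_finite.intro) (simp add: N2_def D null)
  have N1_I: "PiM I N = PiM I N1" and N2_I: "PiM I (\<lambda>i. density (N i) (r i)) = PiM I N2"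
    by (auto intro!: PiM_cong simp: N1_def N2_def)
  have rm: "(\<lambda>x. \<Prod>i\<in>I. r i (x i)) \<in> borel_measurable (PiM I N1)"
    by (intro borel_measurable_prod_ennreal measurable_compose[OF measurable_component_singleton])
      (auto simp: N1_def r)
  show ?thesis
    unfolding N1_I N2_I
  proof (rule N2.PiM_eqI[OF I])
    show "sets (density (PiM I N1) (\<lambda>x. \<Prod>i\<in>I. r i (x i))) = sets (PiM I N2)"
      by (auto intro!: sets_PiM_cong simp: N1_def N2_def)
  next
    fix A assume A: "\<And>i. i \<in> I \<Longrightarrow> A i \<in> sets (N2 i)"
    then have A': "A i \<in> sets (N1 i)" if "i \<in> I" for i
      using that by (auto simp: N1_def N2_def split: if_splits dest!: bspec[of I])
    have "emeasure (density (PiM I N1) (\<lambda>x. \<Prod>i\<in>I. r i (x i))) (Pi\<^sub>E I A)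
        = (\<integral>\<^sup>+x. (\<Prod>i\<in>I. r i (x i)) * indicator (Pi\<^sub>E I A) x \<partial>PiM I N1)"
      using A' I by (intro emeasure_density rm sets_PiM_I_finite) auto
    also have "\<dots> = (\<integral>\<^sup>+x. (\<Prod>i\<in>I. r i (x i) * indicator (A i) (x i)) \<partial>PiM I N1)"
    proof (rule nn_integral_cong)
      fix x assume x: "x \<in> space (PiM I N1)"
      have "indicator (Pi\<^sub>E I A) x = (\<Prod>i\<in>I. indicator (A i) (x i) :: ennreal)"
        using x I by (cases "\<forall>i\<in>I. x i \<in> A i")
          (auto simp: space_PiM PiE_iff indicator_def intro!: prod.neutral[symmetric] prod_zero)
      then show "(\<Prod>i\<in>I. r i (x i)) * indicator (Pi\<^sub>E I A) x
          = (\<Prod>i\<in>I. r i (x i) * indicator (A i) (x i))"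
        by (simp add: prod.distrib)
    qed
    also have "\<dots> = (\<Prod>i\<in>I. \<integral>\<^sup>+x. r i x * indicator (A i) x \<partial>N1 i)"
      using A' r by (intro N1.product_nn_integral_prod I) (auto simp: N1_def)
    also have "\<dots> = (\<Prod>i\<in>I. emeasure (N2 i) (A i))"
      using A r by (intro prod.cong refl) (auto simp: N1_def N2_def emeasure_density)
    finally show "emeasure (density (PiM I N1) (\<lambda>x. \<Prod>i\<in>I. r i (x i))) (Pi\<^sub>E I A)
        = (\<Prod>i\<in>I. emeasure (N2 i) (A i))" .
  qed
qed

text \<open>Layer-cake form: a delay counts the times that an alarm has not preceded. It turns
  expected stopping times into series of probabilities, the infinite value included.\<close>

lemma ennreal_of_enat_diff:
  "ennreal_of_enat (t + 1 - enat n) = (\<Sum>i. of_bool (enat (n + i) \<le> t))"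
proof (cases t)
  case (enat k)
  have "(\<Sum>i. of_bool (enat (n + i) \<le> t) :: ennreal) = (\<Sum>i<k + 1 - n. of_bool (enat (n + i) \<le> t))"
    by (rule suminf_finite) (auto simp: enat)
  also have "\<dots> = (\<Sum>i<k + 1 - n. 1)"
    by (rule sum.cong) (auto simp: enat)
  finally show ?thesis
    by (simp add: enat one_enat_def)
next
  case infinity
  have "(\<Sum>i::nat. 1 :: ennreal) = \<infinity>"
  proof -
    have "of_nat k \<le> (\<Sum>i::nat. 1 :: ennreal)" for k
      using sum_le_suminf[of "\<lambda>_. 1 :: ennreal" "{..<k}"] by simp
    then show ?thesis
      by (metis ennreal_Ex_less_of_nat infinity_ennreal_def not_less top.not_eq_extremum)
  qed
  then show ?thesis by (simp add: infinity)
qed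

lemma ennreal_of_enat_eq_suminf:
  "ennreal_of_enat t = (\<Sum>i. of_bool (enat (Suc i) \<le> t))"
proof -
  have "t + 1 - enat 1 = t" by (cases t) (auto simp: one_enat_def)
  then show ?thesis using ennreal_of_enat_diff[of t 1] by simp
qed

text \<open>Without atoms the distribution function of \<open>K\<close> restricted to
  \<open>B - A\<close> is continuous, so the intermediate value theorem finds a half-line that cuts
  exactly the missing mass out of \<open>B - A\<close>.\<close>

lemma exists_between_of_mass:
  fixes K :: "real measure"
  assumes "finite_measure K" and K: "sets K = sets borel" and atoms: "\<And>x. measure K {x} = 0"
    and A: "A \<in> sets borel" and B: "B \<in> sets borel" and "A \<subseteq> B"
    and e: "measure K A \<le> e" "e \<le> measure K B"
  obtains C where "C \<in> sets borel" "A \<subseteq> C" "C \<subseteq> B" "measure K C = e"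
proof -
  interpret finite_measure K by fact
  note K[measurable_cong]
  define D where "D = B - A"
  have D[measurable]: "D \<in> sets borel" using A B by (auto simp: D_def)
  let ?L = "density K (indicator D)"
  have emL: "emeasure ?L S = emeasure K (D \<inter> S)" if "S \<in> sets borel" for S
  proof -
    have S[measurable]: "S \<in> sets K" and D'[measurable]: "D \<in> sets K" using that D K by auto
    have "emeasure ?L S = (\<integral>\<^sup>+x. indicator D x * indicator S x \<partial>K)"
      by (rule emeasure_density) measurable
    also have "\<dots> = (\<integral>\<^sup>+x. indicator (D \<inter> S) x \<partial>K)"
      by (simp add: indicator_inter_arith)
    finally show ?thesis by simp
  qed
  have mL: "measure ?L S = measure K (D \<inter> S)" if "S \<in> sets borel" for S
    using emL[OF that] by (simp add: measure_def)
  interpret L: finite_borel_measure ?L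
    using emL[of UNIV] K sets_eq_imp_space_eq[OF K]
    by (intro finite_borel_measure.intro finite_measureI finite_borel_measure_axioms.intro) simp_all
  have "isCont (cdf ?L) x" for x
    unfolding L.isCont_cdf using mL[of "{x}"] atoms[of x] finite_measure_mono[of "D \<inter> {x}" "{x}"] K
    by (simp add: measure_le_0_iff)
  then have cont: "continuous_on {x..y} (cdf ?L)" for x y
    by (simp add: continuous_at_imp_continuous_on)
  have total: "measure ?L (space ?L) = measure K D"
    using mL[of UNIV] sets_eq_imp_space_eq[OF K] by simp
  have add: "measure K (A \<union> S) = measure K A + measure K S" if "S \<subseteq> D" "S \<in> sets borel" for S
    using that A K by (intro finite_measure_Union) (auto simp: D_def)
  have KB: "measure K B = measure K A + measure K D"
  proof -
    have "A \<union> D = B" using \<open>A \<subseteq> B\<close> by (auto simp: D_def)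
    then show ?thesis using add[OF order.refl D] by simp
  qed
  \<comment> \<open>The distribution function need not attain its limits at the two ends, so the
    extreme values of \<open>e\<close> are served by \<open>A\<close> and \<open>B\<close>
    themselves.\<close>
  consider "e = measure K A" | "e = measure K B" | "measure K A < e" "e < measure K B"
    using e by linarith
  then show thesis
  proof cases
    case 3
    then have "0 < e - measure K A" "e - measure K A < measure K D" using KB by auto
    have "\<forall>\<^sub>F x in at_bot. cdf ?L x < e - measure K A"
      using L.cdf_lim_at_bot \<open>0 < e - measure K A\<close> by (rule order_tendstoD)
    then obtain x where x: "cdf ?L x < e - measure K A"
      by (auto simp: eventually_at_bot_linorder)
    have "\<forall>\<^sub>F y in at_top. e - measure K A < cdf ?L y"
      using L.cdf_lim_at_top \<open>e - measure K A < measure K D\<close> unfolding total by (rule order_tendstoD)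
    then obtain y where y: "e - measure K A < cdf ?L y"
      by (auto simp: eventually_at_top_linorder)
    have "x \<le> y"
      using L.cdf_nondecreasing[of y x] x y by linarith
    then obtain z where "cdf ?L z = e - measure K A"
      using IVT'[of "cdf ?L" x "e - measure K A" y] cont x y by auto
    then have "measure K (D \<inter> {..z}) = e - measure K A"
      by (simp add: cdf_def mL)
    then have "measure K (A \<union> (D \<inter> {..z})) = e"
      using add[of "D \<inter> {..z}"] by simp
    moreover have "A \<union> (D \<inter> {..z}) \<in> sets borel"
      using A by measurable
    ultimately show thesis
      using \<open>A \<subseteq> B\<close> by (intro that[of "A \<union> (D \<inter> {..z})"]) (auto simp: D_def)
  qed (use A B \<open>A \<subseteq> B\<close> that in auto)
qed

text \<open>The extended integrand is \<open>\<infinity>\<close> where \<open>f > 0\<close> and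
  \<open>g = 0\<close>, so a finite divergence makes this set null. Elsewhere it equals the real
  expression, whose default values are therefore harmless.\<close>

lemma kl_info_finite:
  assumes f: "prob_density f" and g: "prob_density g" and fin: "kl_info f g < \<infinity>"
  shows "AE x in lborel. f x \<noteq> 0 \<longrightarrow> g x \<noteq> 0"
    and "integrable lborel (\<lambda>x. f x * ln (f x / g x))"
    and "kl_info f g = ereal (\<integral>x. f x * ln (f x / g x) \<partial>lborel)"
proof -
  have [measurable]: "f \<in> borel_measurable borel" "g \<in> borel_measurable borel"
    and nn: "\<And>x. 0 \<le> f x" "\<And>x. 0 \<le> g x" and g1: "(\<integral>\<^sup>+x. ennreal (g x) \<partial>lborel) = 1"
    using f g by (auto simp: prob_density_def)
  define h where "h x = f x * ln (f x / g x)" for x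
  have [measurable]: "h \<in> borel_measurable borel" unfolding h_def by simp
  have [measurable]: "(\<lambda>x. kl_integrand f g x) \<in> borel_measurable borel"
    unfolding kl_integrand_def by measurable
  let ?p = "\<integral>\<^sup>+x. e2ennreal (kl_integrand f g x) \<partial>lborel"
  let ?n = "\<integral>\<^sup>+x. e2ennreal (- kl_integrand f g x) \<partial>lborel"
  have "e2ennreal (- kl_integrand f g x) \<le> ennreal (g x)" for x
  proof -
    consider "f x = 0" | "f x > 0" "g x = 0" | "f x > 0" "g x > 0"
      using nn[of x] by fastforce
    then show ?thesis
    proof cases
      case 3
      have "ln (g x / f x) \<le> g x / f x - 1"
        using 3 by (intro ln_le_minus_one) simp
      then have "f x * - ln (f x / g x) \<le> f x * (g x / f x - 1)"
        using 3 by (intro mult_left_mono) (auto simp: ln_div)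
      also have "\<dots> = g x - f x" using 3 by (simp add: field_simps)
      also have "\<dots> \<le> g x" using 3 by simp
      finally have "- (f x * ln (f x / g x)) \<le> g x" by simp
      then show ?thesis using 3
        by (simp add: kl_integrand_def e2ennreal_ereal ennreal_leI del: uminus_ereal.simps add: uminus_ereal.simps(1))
    qed (auto simp: kl_integrand_def e2ennreal_neg)
  qed
  then have "?n \<le> 1"
    unfolding g1[symmetric] by (intro nn_integral_mono)
  then have n: "?n \<noteq> \<infinity>" by (auto simp: top_unique)
  have p: "?p \<noteq> \<infinity>"
  proof
    assume "?p = \<infinity>"
    then have "kl_info f g = \<infinity>"
      using n by (cases ?n) (auto simp: kl_info_def enn2ereal_ennreal)
    then show False using fin by simp
  qed
  have "AE x in lborel. e2ennreal (kl_integrand f g x) \<noteq> \<infinity>"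
    using p by (intro nn_integral_PInf_AE) auto
  then show ac: "AE x in lborel. f x \<noteq> 0 \<longrightarrow> g x \<noteq> 0"
    by eventually_elim (auto simp: kl_integrand_def split: if_splits)
  have eq: "AE x in lborel. kl_integrand f g x = ereal (h x)"
    using ac by eventually_elim (auto simp: kl_integrand_def h_def)
  have pp: "?p = (\<integral>\<^sup>+x. ennreal (h x) \<partial>lborel)"
    using eq by (intro nn_integral_cong_AE) (auto simp: e2ennreal_ereal)
  have nnn: "?n = (\<integral>\<^sup>+x. ennreal (- h x) \<partial>lborel)"
    using eq by (intro nn_integral_cong_AE) (auto simp: e2ennreal_ereal)
  show int: "integrable lborel (\<lambda>x. f x * ln (f x / g x))"
    unfolding h_def[symmetric] real_integrable_def
    using p[unfolded pp] n[unfolded nnn] by simp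
  obtain u v where uv: "?p = ennreal u" "?n = ennreal v" "0 \<le> u" "0 \<le> v"
    using p n by (cases ?p; cases ?n) auto
  have "(\<integral>x. h x \<partial>lborel) = u - v"
    using int uv unfolding h_def[symmetric] by (simp add: real_lebesgue_integral_def pp nnn)
  then show "kl_info f g = ereal (\<integral>x. f x * ln (f x / g x) \<partial>lborel)"
    unfolding h_def[symmetric] using uv by (simp add: kl_info_def enn2ereal_ennreal)
qed

text \<open>The hypothesis is tested on the set where \<open>g\<close> exceeds \<open>c\<close>,
  which belongs to \<open>F\<close>. The excess has integral \<open>0\<close> there, the subtraction
  being legitimate because \<open>c\<close> and the total mass are finite.\<close>

lemma AE_le_of_set_nn_integral_le:
  assumes "finite_measure Q" and sub: "subalgebra Q F" and g: "g \<in> borel_measurable F"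
    and le: "\<And>A. A \<in> sets F \<Longrightarrow> (\<integral>\<^sup>+x. indicator A x * g x \<partial>Q) \<le> ennreal c * emeasure Q A"
  shows "AE x in Q. g x \<le> ennreal c"
proof -
  interpret finite_measure Q by fact
  have gQ[measurable]: "g \<in> borel_measurable Q" using sub g by (rule measurable_from_subalg)
  define A where "A = {x \<in> space Q. ennreal c < g x}"
  have A: "A \<in> sets F"
  proof -
    have "A = {x \<in> space F. ennreal c < g x}"
      using sub by (simp add: A_def subalgebra_def)
    also have "\<dots> \<in> sets F" using g by measurable
    finally show ?thesis .
  qed
  have AQ[measurable]: "A \<in> sets Q" unfolding A_def by measurable
  have fin: "(\<integral>\<^sup>+x. ennreal c * indicator A x \<partial>Q) = ennreal c * emeasure Q A"
    by (simp add: nn_integral_cmult)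
  have "(\<integral>\<^sup>+x. indicator A x * g x - ennreal c * indicator A x \<partial>Q)
      = (\<integral>\<^sup>+x. indicator A x * g x \<partial>Q) - (\<integral>\<^sup>+x. ennreal c * indicator A x \<partial>Q)"
  proof (rule nn_integral_diff)
    show "(\<integral>\<^sup>+x. ennreal c * indicator A x \<partial>Q) \<noteq> \<infinity>"
      unfolding fin by (simp add: emeasure_eq_measure ennreal_mult_eq_top_iff)
  qed (auto simp: A_def indicator_def)
  also have "\<dots> = 0" 
  proof -
    have "ennreal c * emeasure Q A \<noteq> \<top>"
      by (simp add: emeasure_eq_measure ennreal_mult_eq_top_iff)
    then have "(\<integral>\<^sup>+x. indicator A x * g x \<partial>Q) \<noteq> \<top>"
      using le[OF A] by (auto simp: top_unique)
    then show ?thesis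
      unfolding fin using le[OF A] by (simp add: diff_eq_0_iff_ennreal top.not_eq_extremum[symmetric])
  qed
  finally have "AE x in Q. indicator A x * g x - ennreal c * indicator A x = 0"
    by (subst (asm) nn_integral_0_iff_AE) auto
  then show ?thesis
    using AE_space
  proof eventually_elim
    case (elim x)
    show ?case
    proof (rule ccontr)
      assume lt: "\<not> g x \<le> ennreal c"
      then have "x \<in> A" using elim by (simp add: A_def)
      then have "g x - ennreal c = 0" using elim by simp
      then show False using lt by (simp add: diff_eq_0_iff_ennreal)
    qed
  qed
qed

lemma nn_integral_PiM_exp_sum:
  fixes N :: "'i \<Rightarrow> 'b::{topological_space,zero} measure" and g :: "'i \<Rightarrow> 'b \<Rightarrow> real"
  assumes I: "finite I" and N: "\<And>i. i \<in> I \<Longrightarrow> prob_space (N i)"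
    and g: "\<And>i. i \<in> I \<Longrightarrow> g i \<in> borel_measurable (N i)"
  shows "(\<integral>\<^sup>+x. ennreal (exp (\<Sum>i\<in>I. g i (x i))) \<partial>PiM I N) = (\<Prod>i\<in>I. \<integral>\<^sup>+x. ennreal (exp (g i x)) \<partial>N i)"
proof -
  define N' where "N' i = (if i \<in> I then N i else return borel 0)" for i
  interpret product_sigma_finite N'
    by (rule product_sigma_finite.intro)
      (simp add: N'_def N prob_space_imp_sigma_finite prob_space_return)
  have "PiM I N = PiM I N'" by (rule PiM_cong) (auto simp: N'_def)
  moreover have "(\<integral>\<^sup>+x. (\<Prod>i\<in>I. ennreal (exp (g i (x i)))) \<partial>PiM I N') = (\<Prod>i\<in>I. \<integral>\<^sup>+x. ennreal (exp (g i x)) \<partial>N' i)"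
    using g by (intro product_nn_integral_prod I) (auto simp: N'_def)
  moreover have "(\<Prod>i\<in>I. \<integral>\<^sup>+x. ennreal (exp (g i x)) \<partial>N' i) = (\<Prod>i\<in>I. \<integral>\<^sup>+x. ennreal (exp (g i x)) \<partial>N i)"
    by (rule prod.cong) (auto simp: N'_def)
  ultimately show ?thesis
    using I by (simp add: exp_sum prod_ennreal)
qed

lemma null_density_exp_iff:
  fixes h :: "'b \<Rightarrow> real"
  assumes [measurable]: "h \<in> borel_measurable A" "S \<in> sets A"
  shows "emeasure (density A (\<lambda>x. ennreal (exp (h x)))) S = 0 \<longleftrightarrow> emeasure A S = 0"
proof -
  have "emeasure (density A (\<lambda>x. ennreal (exp (h x)))) S = 0 \<longleftrightarrow> (AE x in A. ennreal (exp (h x)) * indicator S x = 0)"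
    by (subst emeasure_density) (auto simp: nn_integral_0_iff_AE)
  also have "\<dots> \<longleftrightarrow> (AE x in A. x \<notin> S)"
    by (intro AE_cong) (auto simp: indicator_def)
  also have "\<dots> \<longleftrightarrow> emeasure A S = 0"
    using AE_iff_null_sets[OF assms(2)] by auto
  finally show ?thesis .
qed

text \<open>The integrand is the likelihood ratio of the censored observation: on \<open>S\<close>
  it is averaged to a ratio of masses. Both pieces then integrate to masses under the second law,
  which add up to \<open>1\<close>. If \<open>S\<close> is null for one law, it is null for the
  other, and the default value of the logarithm has no weight.\<close>

lemma censored_likelihood_ratio_integral:
  fixes A :: "'b measure" and h :: "'b \<Rightarrow> real"
  assumes "prob_space A" "prob_space (density A (\<lambda>x. ennreal (exp (h x))))" (is "prob_space ?B")
    and h[measurable]: "h \<in> borel_measurable A" and S[measurable]: "S \<in> sets A"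
  shows "(\<integral>\<^sup>+x. ennreal (exp (if x \<in> S then ln (measure ?B S / measure A S) else h x)) \<partial>A) = 1"
proof -
  interpret A: prob_space A by fact
  interpret B: prob_space ?B by fact
  let ?k = "ln (measure ?B S / measure A S)"
  have z: "measure ?B S = 0 \<longleftrightarrow> measure A S = 0"
    using null_density_exp_iff[OF h S] by (simp add: A.emeasure_eq_measure B.emeasure_eq_measure)
  have "(\<integral>\<^sup>+x. ennreal (exp (if x \<in> S then ?k else h x)) \<partial>A)
      = (\<integral>\<^sup>+x. ennreal (exp ?k) * indicator S x + ennreal (exp (h x)) * indicator (space A - S) x \<partial>A)"
    by (intro nn_integral_cong) (auto simp: indicator_def)
  also have "\<dots> = ennreal (exp ?k) * emeasure A S + emeasure ?B (space A - S)"
    by (subst nn_integral_add) (auto simp: nn_integral_cmult emeasure_density)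
  also have "ennreal (exp ?k) * emeasure A S = emeasure ?B S"
  proof (cases "measure A S = 0")
    case False
    then have "0 < measure A S" "0 < measure ?B S"
      using z by (auto simp: less_le simp del: zero_less_measure_iff)
    then show ?thesis
      by (simp add: A.emeasure_eq_measure B.emeasure_eq_measure ennreal_mult[symmetric] del: zero_less_measure_iff)
  qed (use z in \<open>simp add: A.emeasure_eq_measure B.emeasure_eq_measure\<close>)
  also have "emeasure ?B S + emeasure ?B (space A - S) = 1"
    using B.emeasure_space_1 S sets.sets_into_space[OF S]
    by (subst plus_emeasure) (auto simp: Un_absorb1)
  finally show ?thesis .
qed

section \<open>Asymptotic comparison of extended and real quantities\<close>

lemma tendsto_enn2real_ratio:
  fixes D :: "real \<Rightarrow> ennreal" and g :: "real \<Rightarrow> real"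
  assumes lo: "\<And>y. y < 1 \<Longrightarrow> \<forall>\<^sub>F x in F. ennreal (y * g x) \<le> D x"
    and hi: "\<And>y. 1 < y \<Longrightarrow> \<forall>\<^sub>F x in F. D x \<le> ennreal (y * g x)"
    and g: "\<forall>\<^sub>F x in F. 0 < g x"
  shows "((\<lambda>x. enn2real (D x) / g x) \<longlongrightarrow> 1) F" and "\<forall>\<^sub>F x in F. D x = ennreal (enn2real (D x))"
proof -
  show fin: "\<forall>\<^sub>F x in F. D x = ennreal (enn2real (D x))"
    \<comment> \<open>Any factor above \<open>1\<close> yields finiteness.\<close>
    using hi[of 2] by (auto elim!: eventually_mono intro!: ennreal_enn2real[symmetric] simp: top.not_eq_extremum[symmetric] top_unique)
  show "((\<lambda>x. enn2real (D x) / g x) \<longlongrightarrow> 1) F"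
  proof (rule order_tendstoI)
    fix y :: real assume "y < 1"
    then obtain z where z: "y < z" "z < 1" using dense by blast
    show "\<forall>\<^sub>F x in F. y < enn2real (D x) / g x"
      using lo[OF z(2)] fin g
    proof eventually_elim
      case (elim x)
      then have "ennreal (z * g x) \<le> ennreal (enn2real (D x))" by simp
      then have "z * g x \<le> enn2real (D x)" by (subst (asm) ennreal_le_iff) auto
      then have "z \<le> enn2real (D x) / g x" using elim by (simp add: pos_le_divide_eq)
      then show ?case using z by simp
    qed
  next
    fix y :: real assume "1 < y"
    then obtain z where z: "1 < z" "z < y" using dense by blast
    show "\<forall>\<^sub>F x in F. enn2real (D x) / g x < y"
      using hi[OF z(1)] g
    proof eventually_elim
      case (elim x)
      have "enn2real (D x) \<le> z * g x" using elim z by (intro enn2real_leI) auto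
      then have "enn2real (D x) / g x \<le> z" using elim by (simp add: pos_divide_le_eq)
      then show ?case using z by simp
    qed
  qed
qed

text \<open>The numerator is the delay bound for threshold
  \<open>c = \<zeta> / (2 * ((ln \<zeta>)\<^sup>2 + 1))\<close> and a window of length at least
  \<open>(ln \<zeta>)\<^sup>2\<close>. Passing from \<open>\<zeta>\<close> to \<open>c\<close> costs
  only a term of order \<open>ln (ln \<zeta>)\<close>, and the correction in the denominator
  vanishes.\<close>

lemma window_bound_asymptotics:
  fixes I :: real
  assumes "0 < I"
  shows "((\<lambda>\<zeta>. (ln (\<zeta> / (2 * ((ln \<zeta>)\<^sup>2 + 1))) - 1) / (I + ln (\<zeta> / (2 * ((ln \<zeta>)\<^sup>2 + 1))) / (ln \<zeta>)\<^sup>2)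
    / (ln \<zeta> / I)) \<longlongrightarrow> 1) at_top"
  using assms by real_asymp

lemma eventually_le_mult_ln:
  fixes k C :: real
  assumes "0 < k" shows "\<forall>\<^sub>F \<zeta> in at_top. C \<le> k * ln \<zeta>"
  using assms by real_asymp

section \<open>A potential for the two-regime walk\<close>

text \<open>One step of the statistic with full increment \<open>x\<close> and censored increment
  \<open>y\<close>. The cap \<open>min a1\<close> is the rule that a crossing from below is reset to
  \<open>a1\<close>.\<close>

definition regime_step :: "real \<Rightarrow> real \<Rightarrow> real \<Rightarrow> real \<Rightarrow> real" where
  "regime_step a1 s x y = (if a1 \<le> s then max 0 (s + x) else min a1 (max 0 (s + y)))"

text \<open>Dominated convergence, with dominating function \<open>\<bar>L\<bar>\<close>. Cutting
  only from above bounds the upward jumps while losing arbitrarily little drift.\<close>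

lemma exists_truncation:
  fixes L :: "'b \<Rightarrow> real"
  assumes L: "integrable K L" and c: "c < (\<integral>v. L v \<partial>K)"
  obtains b where "0 \<le> b" "integrable K (\<lambda>v. min (L v) b)" "c < (\<integral>v. min (L v) b \<partial>K)"
proof -
  have [measurable]: "L \<in> borel_measurable K" using L by auto
  have int: "integrable K (\<lambda>v. min (L v) (real n))" for n
    by (rule Bochner_Integration.integrable_bound[OF L]) auto
  have "(\<lambda>n. \<integral>v. min (L v) (real n) \<partial>K) \<longlonglongrightarrow> (\<integral>v. L v \<partial>K)"
  proof (rule integral_dominated_convergence[where w="\<lambda>v. \<bar>L v\<bar>"])
    show "AE v in K. (\<lambda>n. min (L v) (real n)) \<longlonglongrightarrow> L v"
    proof (rule AE_I2)
      fix v
      have "\<forall>\<^sub>F n in sequentially. min (L v) (real n) = L v"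
        using eventually_ge_at_top[of "nat \<lceil>L v\<rceil>"] by eventually_elim linarith
      then show "(\<lambda>n. min (L v) (real n)) \<longlonglongrightarrow> L v" by (rule tendsto_eventually)
    qed
  qed (use L in auto)
  then have "\<forall>\<^sub>F n in sequentially. c < (\<integral>v. min (L v) (real n) \<partial>K)"
    using c by (rule order_tendstoD)
  then obtain n where "c < (\<integral>v. min (L v) (real n) \<partial>K)"
    by (auto simp: eventually_sequentially)
  with int[of n] show thesis by (intro that[of "real n"]) auto
qed

text \<open>Strict Cauchy-Schwarz: expanding the square of \<open>1 - exp (- L / 2)\<close> shows
  that its mean is at most twice the gap between \<open>1\<close> and the affinity. A zero mean
  would force \<open>L = 0\<close> almost everywhere, against the nonzero mean of
  \<open>L\<close>.\<close>

lemma (in prob_space) hellinger_affinity_less_1: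
  fixes L :: "'a \<Rightarrow> real"
  assumes L: "integrable M L" "(\<integral>v. L v \<partial>M) \<noteq> 0" and exp: "(\<integral>\<^sup>+v. ennreal (exp (- L v)) \<partial>M) \<le> 1"
  shows "integrable M (\<lambda>v. exp (- L v / 2))" "(\<integral>v. exp (- L v / 2) \<partial>M) < 1"
proof -
  have [measurable]: "L \<in> borel_measurable M" using L by auto
  have i1: "integrable M (\<lambda>v. exp (- L v))"
    using exp by (intro integrableI_nonneg) (auto intro: le_less_trans)
  have e1: "(\<integral>v. exp (- L v) \<partial>M) \<le> 1"
    using exp nn_integral_eq_integral[OF i1] by simp
  have sq: "(1 - exp (- L v / 2))\<^sup>2 = 1 - 2 * exp (- L v / 2) + exp (- L v)" for v
    by (simp add: power2_diff exp_double[symmetric])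
  show i2: "integrable M (\<lambda>v. exp (- L v / 2))"
  proof (rule Bochner_Integration.integrable_bound)
    show "integrable M (\<lambda>v. 1 + exp (- L v))" using i1 by simp
    show "AE v in M. norm (exp (- L v / 2)) \<le> norm (1 + exp (- L v))"
    proof (rule AE_I2)
      fix v
      show "norm (exp (- L v / 2)) \<le> norm (1 + exp (- L v))"
        using sq[of v] zero_le_power2[of "1 - exp (- L v / 2)"] exp_gt_zero[of "- L v"] exp_gt_zero[of "- L v / 2"]
        by (simp del: exp_gt_zero zero_le_power2)
    qed
  qed simp
  have i3: "integrable M (\<lambda>v. (1 - exp (- L v / 2))\<^sup>2)"
    unfolding sq using i1 i2 by auto
  have eq: "(\<integral>v. (1 - exp (- L v / 2))\<^sup>2 \<partial>M) = 1 - 2 * (\<integral>v. exp (- L v / 2) \<partial>M) + (\<integral>v. exp (- L v) \<partial>M)"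
    unfolding sq using i1 i2 by (simp add: prob_space)
  have "(\<integral>v. (1 - exp (- L v / 2))\<^sup>2 \<partial>M) \<noteq> 0"
  proof
    assume "(\<integral>v. (1 - exp (- L v / 2))\<^sup>2 \<partial>M) = 0"
    then have "AE v in M. (1 - exp (- L v / 2))\<^sup>2 = 0"
      using i3 by (subst (asm) integral_nonneg_eq_0_iff_AE) auto
    then have "AE v in M. L v = 0" by eventually_elim simp
    then have "(\<integral>v. L v \<partial>M) = (\<integral>v. 0 \<partial>M)" by (intro integral_cong_AE) auto
    then show False using L(2) by simp
  qed
  moreover have "0 \<le> (\<integral>v. (1 - exp (- L v / 2))\<^sup>2 \<partial>M)" by simp
  ultimately show "(\<integral>v. exp (- L v / 2) \<partial>M) < 1" using eq e1 by linarith
qed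

text \<open>
  The potential dominates the expected number of steps to reach \<open>a\<close>. Its linear part is the time
  at full drift; the exponential part pays for falls below \<open>a1\<close>, since \<open>exp (- L / 2)\<close> has mean
  less than \<open>1\<close>; below \<open>a1\<close> another linear part is the time of the censored walk. Truncation of
  the increments from above controls the overshoot by first moments only.
\<close>

lemma (in prob_space) exists_hitting_potential:
  fixes L l :: "'a \<Rightarrow> real"
  assumes L: "integrable M L" "0 < (\<integral>v. L v \<partial>M)" and exp: "(\<integral>\<^sup>+v. ennreal (exp (- L v)) \<partial>M) \<le> 1"
    and l: "integrable M l" "0 < (\<integral>v. l v \<partial>M)" and a1: "0 < a1" and \<rho>: "1 < \<rho>"
  obtains C where "0 \<le> C"
    "\<And>a. a1 < a \<Longrightarrow> \<exists>u\<in>borel_measurable borel. (\<forall>s. 0 \<le> u s) \<and>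
      (\<forall>s\<ge>0. u s \<le> \<rho> * a / (\<integral>v. L v \<partial>M) + C) \<and>
      (\<forall>s. 0 \<le> s \<longrightarrow> s < a \<longrightarrow> (\<integral>\<^sup>+v. ennreal (u (regime_step a1 s (L v) (l v))) \<partial>M) + 1 \<le> ennreal (u s))"
proof -
  define I where "I = (\<integral>v. L v \<partial>M)"
  define \<phi> where "\<phi> = (\<integral>v. exp (- L v / 2) \<partial>M)"
  have \<phi>: "integrable M (\<lambda>v. exp (- L v / 2))" "\<phi> < 1" "0 \<le> \<phi>"
    using hellinger_affinity_less_1[OF L(1) _ exp] L(2) by (auto simp: \<phi>_def)
  \<comment> \<open>The slack \<open>\<rho>\<close> is spent here: the truncated drift
    \<open>I'\<close> still satisfies \<open>1 / I' \<le> \<rho> / I\<close>.\<close>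
  have "I / \<rho> < (\<integral>v. L v \<partial>M)" using L(2) \<rho> by (simp add: I_def field_simps)
  from exists_truncation[OF L(1) this] obtain b where b: "0 \<le> b" "integrable M (\<lambda>v. min (L v) b)"
    "I / \<rho> < (\<integral>v. min (L v) b \<partial>M)" by blast
  from exists_truncation[OF l] obtain b' where b': "0 \<le> b'" "integrable M (\<lambda>v. min (l v) b')"
    "0 < (\<integral>v. min (l v) b' \<partial>M)" by blast
  define I' where "I' = (\<integral>v. min (L v) b \<partial>M)"
  define J' where "J' = (\<integral>v. min (l v) b' \<partial>M)"
  \<comment> \<open>\<open>K\<close> is the largest cost of climbing back to \<open>a1\<close>,
    attained from state \<open>0\<close>. The constant \<open>c\<close> solves
    \<open>(c + K) * \<phi> = c\<close>: one step shrinks the exponential part by the factor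
    \<open>\<phi>\<close>, which exactly finances an extra \<open>K\<close> at a fall below
    \<open>a1\<close>.\<close>
  define K where "K = (a1 + b') / J'"
  define c where "c = K * \<phi> / (1 - \<phi>)"
  have I: "0 < I" using L(2) by (simp add: I_def)
  have I': "0 < I'" "I / \<rho> < I'" using b(3) I \<rho> by (auto simp: I'_def intro: less_trans[rotated])
  have J': "0 < J'" using b'(3) by (simp add: J'_def)
  have K: "0 < K" using a1 b' J' by (simp add: K_def)
  have c: "0 \<le> c" "(c + K) * \<phi> = c" using K \<phi> by (auto simp: c_def field_simps)
  show thesis
  proof (rule that)
    show "0 \<le> b / I' + c + K" using b I' c K by simp
    fix a assume a: "a1 < a"
    \<comment> \<open>The shifts by \<open>b\<close> and \<open>b'\<close> are the largest possible
      overshoots of the truncated walks; they keep both linear parts nonnegative one step beyond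
      their targets.\<close>
    define u where "u s = (if a1 \<le> s then max 0 (a + b - s) / I' + c * exp (- (s - a1) / 2)
      else (a + b - a1) / I' + c + (a1 + b' - s) / J')" for s
    show "\<exists>u\<in>borel_measurable borel. (\<forall>s. 0 \<le> u s) \<and>
      (\<forall>s\<ge>0. u s \<le> \<rho> * a / (\<integral>v. L v \<partial>M) + (b / I' + c + K)) \<and>
      (\<forall>s. 0 \<le> s \<longrightarrow> s < a \<longrightarrow> (\<integral>\<^sup>+v. ennreal (u (regime_step a1 s (L v) (l v))) \<partial>M) + 1 \<le> ennreal (u s))"
    proof (intro bexI[of _ u] conjI allI impI)
      show "u \<in> borel_measurable borel" unfolding u_def by measurable
      show u0: "0 \<le> u s" for s using I' J' c a b b' by (auto simp: u_def)
      show "u s \<le> \<rho> * a / (\<integral>v. L v \<partial>M) + (b / I' + c + K)" if s: "0 \<le> s" for s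
      proof -
        have "1 / I' \<le> \<rho> / I" using I I' \<rho> by (simp add: field_simps)
        then have "a * (1 / I') \<le> a * (\<rho> / I)" using a a1 by (intro mult_left_mono) auto
        then have aI: "(a + b) / I' \<le> \<rho> * a / I + b / I'" by (simp add: field_simps add_divide_distrib)
        show ?thesis
        proof (cases "a1 \<le> s")
          case True
          have "max 0 (a + b - s) / I' \<le> (a + b) / I'"
            using I' s a a1 b by (intro divide_right_mono) auto
          moreover have "c * exp (- (s - a1) / 2) \<le> c * 1"
            using True c by (intro mult_left_mono) auto
          ultimately show ?thesis using True aI K by (simp add: u_def I_def[symmetric])
        next
          case False
          have "(a + b - a1) / I' \<le> (a + b) / I'" "(a1 + b' - s) / J' \<le> K"
            unfolding K_def using I' J' a1 s by (auto intro!: divide_right_mono)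
          then show ?thesis using False aI by (simp add: u_def I_def[symmetric])
        qed
      qed
      fix s assume s: "0 \<le> s" "s < a"
      \<comment> \<open>It suffices to find an integrable majorant of the new potential whose mean
        is smaller than the old potential by \<open>1\<close>.\<close>
      have key: "(\<integral>\<^sup>+v. ennreal (u (regime_step a1 s (L v) (l v))) \<partial>M) + 1 \<le> ennreal (u s)"
        if h: "integrable M h" "(\<integral>v. h v \<partial>M) + 1 \<le> u s" "\<And>v. u (regime_step a1 s (L v) (l v)) \<le> h v" for h
      proof -
        have h0: "0 \<le> h v" for v using h(3)[of v] u0 by (rule order_trans[rotated])
        have "(\<integral>\<^sup>+v. ennreal (u (regime_step a1 s (L v) (l v))) \<partial>M) \<le> (\<integral>\<^sup>+v. ennreal (h v) \<partial>M)"
          by (intro nn_integral_mono ennreal_leI h)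
        also have "\<dots> = ennreal (\<integral>v. h v \<partial>M)" using h(1) h0 by (intro nn_integral_eq_integral) auto
        finally have "(\<integral>\<^sup>+v. ennreal (u (regime_step a1 s (L v) (l v))) \<partial>M) + 1 \<le> ennreal (\<integral>v. h v \<partial>M) + 1"
          by (rule add_right_mono)
        also have "\<dots> = ennreal ((\<integral>v. h v \<partial>M) + 1)" using h0 by (simp add: ennreal_plus)
        also have "\<dots> \<le> ennreal (u s)" using h(2) by (rule ennreal_leI)
        finally show ?thesis .
      qed
      show "(\<integral>\<^sup>+v. ennreal (u (regime_step a1 s (L v) (l v))) \<partial>M) + 1 \<le> ennreal (u s)"
      proof (cases "a1 \<le> s")
        case True
        define E where "E = exp (- (s - a1) / 2)"
        show ?thesis
        proof (rule key)
          let ?h = "\<lambda>v. (a + b - s - min (L v) b) / I' + (c + K) * (E * exp (- L v / 2))"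
          show "integrable M ?h" using b(2) \<phi>(1) by auto
          have "(\<integral>v. ?h v \<partial>M) = (a + b - s - I') / I' + (c + K) * (E * \<phi>)"
            using b(2) \<phi>(1) by (simp add: prob_space I'_def \<phi>_def)
          also have "(c + K) * (E * \<phi>) = c * E" using c(2) by (metis mult.assoc mult.commute)
          also have "(a + b - s - I') / I' = (a + b - s) / I' - 1" using I' by (simp add: field_simps)
          finally show "(\<integral>v. ?h v \<partial>M) + 1 \<le> u s" using True s b by (simp add: u_def E_def)
          fix v
          have Eq: "E * exp (- L v / 2) = exp (- (s + L v - a1) / 2)"
            by (simp add: E_def exp_add[symmetric] field_simps)
          show "u (regime_step a1 s (L v) (l v)) \<le> ?h v"
          proof (cases "a1 \<le> s + L v")
            case t: True
            have "max 0 (a + b - (s + L v)) / I' \<le> (a + b - s - min (L v) b) / I'"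
              using s I' by (intro divide_right_mono) auto
            moreover have "0 \<le> K * exp (- (s + L v - a1) / 2)" using K by simp
            ultimately show ?thesis
              unfolding Eq using True t a1 by (simp add: regime_step_def u_def algebra_simps)
          next
            case t: False
            \<comment> \<open>After a fall below \<open>a1\<close> the exponential factor is at
              least \<open>1\<close>, so the term with \<open>c + K\<close> covers both the constant
              \<open>c\<close> and the cost of climbing back.\<close>
            have "(a + b - a1) / I' \<le> (a + b - s - min (L v) b) / I'"
              using t I' by (intro divide_right_mono) auto
            moreover have "(a1 + b' - max 0 (s + L v)) / J' \<le> K"
              unfolding K_def using J' by (intro divide_right_mono) auto
            moreover have "(c + K) * 1 \<le> (c + K) * exp (- (s + L v - a1) / 2)"
              using c K t by (intro mult_left_mono) auto
            moreover have "\<not> a1 \<le> max 0 (s + L v)" using t a1 by simp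
            ultimately show ?thesis
              unfolding Eq using True by (simp add: regime_step_def u_def)
          qed
        qed
      next
        case False
        show ?thesis
        proof (rule key)
          let ?h = "\<lambda>v. (a + b - a1) / I' + c + (a1 + b' - s - min (l v) b') / J'"
          show "integrable M ?h" using b'(2) by auto
          have "(\<integral>v. ?h v \<partial>M) = (a + b - a1) / I' + c + (a1 + b' - s - J') / J'"
            using b'(2) by (simp add: prob_space J'_def)
          then show "(\<integral>v. ?h v \<partial>M) + 1 \<le> u s" using False J' by (simp add: u_def diff_divide_distrib)
          fix v
          show "u (regime_step a1 s (L v) (l v)) \<le> ?h v"
          proof (cases "a1 \<le> s + l v")
            case t: True
            \<comment> \<open>A crossing lands exactly on \<open>a1\<close>, where the upper branch
              of \<open>u\<close> equals \<open>(a + b - a1) / I' + c\<close>; only the lower linear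
              part is given up, and that is nonnegative.\<close>
            have "0 \<le> (a1 + b' - s - min (l v) b') / J'"
              using J' False by (intro divide_nonneg_pos) auto
            then show ?thesis
              using False t a a1 b by (simp add: regime_step_def u_def)
          next
            case t: False
            have "(a1 + b' - max 0 (s + l v)) / J' \<le> (a1 + b' - s - min (l v) b') / J'"
              using J' by (intro divide_right_mono) auto
            then show ?thesis
              using False t a1 by (simp add: regime_step_def u_def min_def)
          qed
        qed
      qed
    qed
  qed
qed

section \<open>Laws of the observations\<close>

locale ac_model = change_model M f0 f1 P X
  for M :: nat
    and f0 f1 :: "nat \<Rightarrow> real \<Rightarrow> real"
    and P :: "enat \<Rightarrow> 'a measure"
    and X :: "nat \<Rightarrow> nat \<Rightarrow> 'a \<Rightarrow> real" +
  assumes kl10: "m \<in> {1..M} \<Longrightarrow> 0 < kl_info (f1 m) (f0 m) \<and> kl_info (f1 m) (f0 m) < \<infinity>"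
    and kl01: "m \<in> {1..M} \<Longrightarrow> kl_info (f0 m) (f1 m) < \<infinity>"
begin

definition N0 :: "nat \<Rightarrow> real measure" where "N0 m = density lborel (\<lambda>x. ennreal (f0 m x))"
definition N1 :: "nat \<Rightarrow> real measure" where "N1 m = density lborel (\<lambda>x. ennreal (f1 m x))"
definition W0 :: "(nat \<Rightarrow> real) measure" where "W0 = PiM {1..M} N0"
definition W1 :: "(nat \<Rightarrow> real) measure" where "W1 = PiM {1..M} N1"
definition V :: "nat \<Rightarrow> 'a \<Rightarrow> nat \<Rightarrow> real" where "V k \<omega> = (\<lambda>m\<in>{1..M}. X m k \<omega>)"
definition obs :: "nat \<Rightarrow> 'a \<Rightarrow> nat \<times> nat \<Rightarrow> real" where
  "obs n \<omega> = (\<lambda>(m, k)\<in>{1..M} \<times> {1..n}. X m k \<omega>)"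
text \<open>The algebra of all raw observations up to time \<open>n\<close>, transmitted or not; it
  serves as a common upper bound for the information of all policies.\<close>

definition G :: "nat \<Rightarrow> 'a measure" where
  "G n = vimage_algebra (space (P \<infinity>)) (obs n) (PiM ({1..M} \<times> {1..n}) (\<lambda>_. borel))"
definition llr :: "(nat \<Rightarrow> real) \<Rightarrow> real" where "llr v = (\<Sum>m=1..M. ln (f1 m (v m) / f0 m (v m)))"

abbreviation BM :: "(nat \<Rightarrow> real) measure" where "BM \<equiv> PiM {1..M} (\<lambda>_. borel)"

lemma density_facts:
  assumes "m \<in> {1..M}"
  shows "f0 m \<in> borel_measurable borel" "f1 m \<in> borel_measurable borel" "0 \<le> f0 m x" "0 \<le> f1 m x"
    "(\<integral>\<^sup>+x. ennreal (f0 m x) \<partial>lborel) = 1" "(\<integral>\<^sup>+x. ennreal (f1 m x) \<partial>lborel) = 1"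
  using density0[OF assms] density1[OF assms] by (auto simp: prob_density_def)

lemma sets_N [simp, measurable_cong]: "sets (N0 m) = sets borel" "sets (N1 m) = sets borel"
  and space_N [simp]: "space (N0 m) = UNIV" "space (N1 m) = UNIV"
  by (auto simp: N0_def N1_def)

lemma prob_space_N:
  assumes "m \<in> {1..M}" shows "prob_space (N0 m)" "prob_space (N1 m)"
  using density_facts[OF assms] by (auto intro!: prob_spaceI simp: N0_def N1_def emeasure_density)

lemma sets_W [simp, measurable_cong]: "sets W0 = sets BM" "sets W1 = sets BM"
  by (auto simp: W0_def W1_def intro!: sets_PiM_cong)

lemma prob_space_W: "prob_space W0" "prob_space W1"
  using prob_space_N by (auto simp: W0_def W1_def intro!: prob_space_PiM)

text \<open>Finite divergence in both directions makes the densities vanish together up to null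
  sets, so the log ratio is genuine almost surely under either law.\<close>

lemma AE_N_pos:
  assumes m: "m \<in> {1..M}"
  shows "AE x in N0 m. 0 < f0 m x \<and> 0 < f1 m x" "AE x in N1 m. 0 < f0 m x \<and> 0 < f1 m x"
    and "AE x in lborel. f0 m x = 0 \<longleftrightarrow> f1 m x = 0"
proof -
  note [measurable] = density_facts(1,2)[OF m]
  have a: "AE x in lborel. f1 m x \<noteq> 0 \<longrightarrow> f0 m x \<noteq> 0"
    using kl_info_finite(1)[OF density1[OF m] density0[OF m]] kl10[OF m] by simp
  have b: "AE x in lborel. f0 m x \<noteq> 0 \<longrightarrow> f1 m x \<noteq> 0"
    using kl_info_finite(1)[OF density0[OF m] density1[OF m]] kl01[OF m] by simp
  show "AE x in lborel. f0 m x = 0 \<longleftrightarrow> f1 m x = 0"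
    using a b by eventually_elim auto
  show "AE x in N0 m. 0 < f0 m x \<and> 0 < f1 m x"
    unfolding N0_def using b density_facts(3,4)[OF m]
    by (subst AE_density) (auto elim!: eventually_mono simp: less_le)
  show "AE x in N1 m. 0 < f0 m x \<and> 0 < f1 m x"
    unfolding N1_def using a density_facts(3,4)[OF m]
    by (subst AE_density) (auto elim!: eventually_mono simp: less_le)
qed

lemma density_N1_ratio:
  assumes m: "m \<in> {1..M}"
  shows "density (N1 m) (\<lambda>x. ennreal (exp (- ln (f1 m x / f0 m x)))) = N0 m"
proof -
  note [measurable] = density_facts(1,2)[OF m]
  have "density (N1 m) (\<lambda>x. ennreal (exp (- ln (f1 m x / f0 m x))))
      = density lborel (\<lambda>x. ennreal (f1 m x) * ennreal (exp (- ln (f1 m x / f0 m x))))"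
    unfolding N1_def by (rule density_density_eq) auto
  also have "\<dots> = N0 m"
    unfolding N0_def
  proof (rule density_cong)
    show "AE x in lborel. ennreal (f1 m x) * ennreal (exp (- ln (f1 m x / f0 m x))) = ennreal (f0 m x)"
      using AE_N_pos(3)[OF m]
    proof eventually_elim
      case (elim x)
      \<comment> \<open>Where both densities vanish the quotient is a default value, but it is
        multiplied by density \<open>0\<close>.\<close>
      show ?case
      proof (cases "f0 m x = 0")
        case False
        then have "0 < f0 m x" "0 < f1 m x"
          using elim density_facts(3,4)[OF m, of x] by auto
        then show ?thesis
          by (simp add: exp_minus ennreal_mult[symmetric])
      qed (use elim in simp)
    qed
  qed auto
  finally show ?thesis .
qed

section \<open>Distribution of the observations at one time\<close>

lemma measurable_X [measurable]:
  assumes "1 \<le> \<nu>" "m \<in> {1..M}" "1 \<le> k" shows "X m k \<in> borel_measurable (P \<nu>)"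
  using law[OF assms] by (simp add: distributed_def)

lemma distr_X:
  assumes "1 \<le> \<nu>" "m \<in> {1..M}" "1 \<le> k"
  shows "distr (P \<nu>) borel (X m k) = (if enat k < \<nu> then N0 m else N1 m)"
proof -
  have "distr (P \<nu>) borel (X m k) = distr (P \<nu>) lborel (X m k)"
    by (rule distr_cong) auto
  also have "\<dots> = (if enat k < \<nu> then N0 m else N1 m)"
    using distributed_distr_eq_density[OF law[OF assms]] by (simp add: N0_def N1_def)
  finally show ?thesis .
qed

lemma space_P: "1 \<le> \<nu> \<Longrightarrow> space (P \<nu>) = space (P \<infinity>)" by (rule space_law)

lemma measurable_V:
  assumes "1 \<le> \<nu>" "1 \<le> k" shows "V k \<in> measurable (P \<nu>) BM"
  unfolding V_def using assms by (intro measurable_restrict measurable_X) auto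

lemma measurable_obs:
  assumes "1 \<le> \<nu>" shows "obs n \<in> measurable (P \<nu>) (PiM ({1..M} \<times> {1..n}) (\<lambda>_. borel))"
  unfolding obs_def using assms by (intro measurable_restrict) (auto intro!: measurable_X)

lemma distr_V:
  assumes "1 \<le> \<nu>" "1 \<le> k"
  shows "distr (P \<nu>) BM (V k) = (if enat k < \<nu> then W0 else W1)"
proof -
  interpret prob_space "P \<nu>" using assms(1) by (rule prob)
  have "indep_vars (\<lambda>m. PiM {(m, k)} (\<lambda>_. borel))
      (\<lambda>m \<omega>. restrict (\<lambda>i. (case i of (m, k) \<Rightarrow> X m k) \<omega>) {(m, k)}) {1..M}"
    by (rule indep_vars_restrict[OF indep[OF assms(1)]])
      (use assms in \<open>auto simp: disjoint_family_on_def\<close>)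
  then have "indep_vars (\<lambda>_. borel)
      (\<lambda>m \<omega>. (\<lambda>g. g (m, k)) (restrict (\<lambda>i. (case i of (m, k) \<Rightarrow> X m k) \<omega>) {(m, k)})) {1..M}"
    by (rule indep_vars_compose2) (auto intro!: measurable_component_singleton)
  then have "indep_vars (\<lambda>_. borel) (\<lambda>m. X m k) {1..M}"
    by simp
  then have "distr (P \<nu>) BM (V k) = PiM {1..M} (\<lambda>m. distr (P \<nu>) borel (X m k))"
    unfolding V_def[abs_def] using sensors assms
    by (subst indep_vars_iff_distr_eq_PiM'[symmetric]) (auto intro!: measurable_X)
  also have "\<dots> = PiM {1..M} (\<lambda>m. if enat k < \<nu> then N0 m else N1 m)"
    by (intro PiM_cong refl distr_X assms) auto
  finally show ?thesis by (simp add: W0_def W1_def)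
qed

section \<open>The filtration of raw observations, independence and change of measure\<close>

lemma space_G [simp]: "space (G n) = space (P \<infinity>)"
  by (simp add: G_def)

lemma obs_in: "obs n \<in> A \<rightarrow> space (PiM ({1..M} \<times> {1..n}) (\<lambda>_. borel))"
  by (auto simp: obs_def space_PiM PiE_def extensional_def)

lemma measurable_obs_G: "obs n \<in> measurable (G n) (PiM ({1..M} \<times> {1..n}) (\<lambda>_. borel))"
  unfolding G_def by (rule measurable_vimage_algebra1) (rule obs_in)

lemma measurable_X_G:
  assumes "m \<in> {1..M}" "1 \<le> k" "k \<le> n" shows "X m k \<in> borel_measurable (G n)"
proof -
  have "(\<lambda>\<omega>. obs n \<omega> (m, k)) \<in> borel_measurable (G n)"
    using assms by (intro measurable_compose[OF measurable_obs_G measurable_component_singleton]) auto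
  then show ?thesis using assms by (simp add: obs_def)
qed

lemma measurable_G_mono:
  assumes "n \<le> n'" "f \<in> measurable (G n) K" shows "f \<in> measurable (G n') K"
proof -
  have "(\<lambda>x. x) \<in> measurable (G n') (G n)"
    unfolding G_def[of n]
  proof (rule measurable_vimage_algebra2)
    show "(\<lambda>x. obs n x) \<in> measurable (G n') (PiM ({1..M} \<times> {1..n}) (\<lambda>_. borel))"
      unfolding obs_def using assms by (intro measurable_restrict) (auto intro!: measurable_X_G)
  qed simp
  then show ?thesis using assms(2) by (rule measurable_compose)
qed

lemma sets_G_mono:
  assumes "n \<le> n'" "A \<in> sets (G n)" shows "A \<in> sets (G n')"
proof -
  have "(\<lambda>x. x) \<in> measurable (G n') (G n)"
    by (rule measurable_G_mono[OF assms(1)]) (rule measurable_ident_sets[OF refl])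
  from measurable_sets[OF this assms(2)] show ?thesis
    using sets.sets_into_space[OF assms(2)] by (simp add: Int_absorb2)
qed

lemma sets_G_subset:
  assumes "1 \<le> \<nu>" shows "sets (G n) \<subseteq> sets (P \<nu>)"
  unfolding G_def sets_vimage_algebra2[OF obs_in]
  using measurable_sets[OF measurable_obs[OF assms, of n]] by (auto simp: space_P[OF assms])

lemma subalgebra_G: "1 \<le> \<nu> \<Longrightarrow> subalgebra (P \<nu>) (G n)"
  using sets_G_subset space_P[of \<nu>] by (simp add: subalgebra_def)

lemma measurable_from_G: "1 \<le> \<nu> \<Longrightarrow> f \<in> measurable (G n) K \<Longrightarrow> f \<in> measurable (P \<nu>) K"
  using subalgebra_G by (rule measurable_from_subalg)

lemma measurable_V_G:
  assumes "1 \<le> k" "k \<le> n" shows "V k \<in> measurable (G n) BM"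
  unfolding V_def using assms by (intro measurable_restrict measurable_X_G) auto

lemma llr_sum_eq: "llr_sum M f0 f1 X k \<omega> = llr (V k \<omega>)"
  unfolding llr_sum_def llr_def V_def by (rule sum.cong) auto

lemma measurable_llr [measurable]: "llr \<in> borel_measurable BM"
  unfolding llr_def
  by (intro borel_measurable_sum borel_measurable_ln borel_measurable_divide
      measurable_compose[OF measurable_component_singleton] density_facts)

text \<open>Fubini for a functional of the past and one later observation vector. It takes the place
  of conditional expectations in every one-step argument below.\<close>

lemma nn_integral_indep:
  assumes "1 \<le> \<nu>" "n < k" and F: "F \<in> borel_measurable (G n \<Otimes>\<^sub>M BM)"
  shows "(\<integral>\<^sup>+\<omega>. F (\<omega>, V k \<omega>) \<partial>P \<nu>)
    = (\<integral>\<^sup>+\<omega>. (\<integral>\<^sup>+v. F (\<omega>, v) \<partial>(if enat k < \<nu> then W0 else W1)) \<partial>P \<nu>)"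
proof -
  interpret prob_space "P \<nu>" using assms(1) by (rule prob)
  have k1: "1 \<le> k" using assms(2) by simp
  have "indep_var (PiM ({1..M} \<times> {1..n}) (\<lambda>_. borel))
      (\<lambda>\<omega>. restrict (\<lambda>i. (case i of (m, k) \<Rightarrow> X m k) \<omega>) ({1..M} \<times> {1..n}))
      (PiM ({1..M} \<times> {k}) (\<lambda>_. borel))
      (\<lambda>\<omega>. restrict (\<lambda>i. (case i of (m, k) \<Rightarrow> X m k) \<omega>) ({1..M} \<times> {k}))"
    by (rule indep_var_restrict[OF indep[OF assms(1)]]) (use assms in auto)
  moreover have "(\<lambda>\<omega>. restrict (\<lambda>i. (case i of (m, k) \<Rightarrow> X m k) \<omega>) ({1..M} \<times> {1..n})) = obs n"
    by (auto simp: obs_def fun_eq_iff)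
  ultimately have ind: "indep_var (PiM ({1..M} \<times> {1..n}) (\<lambda>_. borel)) (obs n)
      (PiM ({1..M} \<times> {k}) (\<lambda>_. borel))
      (\<lambda>\<omega>. restrict (\<lambda>i. (case i of (m, k) \<Rightarrow> X m k) \<omega>) ({1..M} \<times> {k}))" (is "indep_var _ _ ?K ?U")
    by simp
  define p :: "(nat \<times> nat \<Rightarrow> real) \<Rightarrow> nat \<Rightarrow> real" where "p g = (\<lambda>m\<in>{1..M}. g (m, k))" for g
  have p: "p \<in> measurable ?K BM"
    unfolding p_def by (intro measurable_restrict measurable_component_singleton) auto
  have pU: "V k \<omega> = p (?U \<omega>)" for \<omega>
    by (auto simp: V_def p_def fun_eq_iff)
  have id: "(\<lambda>\<omega>. \<omega>) \<in> measurable (P \<nu>) (G n)"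
    using subalgebra_G[OF assms(1)] measurable_ident_sets[OF refl] by (rule measurable_from_subalg)
  have Vm: "V k \<in> measurable (P \<nu>) BM"
    using assms by (intro measurable_V) auto
  interpret I: prob_space "distr (P \<nu>) (G n) (\<lambda>\<omega>. \<omega>)" by (rule prob_space_distr[OF id])
  interpret D: prob_space "distr (P \<nu>) BM (V k)" by (rule prob_space_distr[OF Vm])
  have eq: "distr (P \<nu>) (G n) (\<lambda>\<omega>. \<omega>) \<Otimes>\<^sub>M distr (P \<nu>) BM (V k)
      = distr (P \<nu>) (G n \<Otimes>\<^sub>M BM) (\<lambda>\<omega>. (\<omega>, V k \<omega>))"
  proof (rule pair_measure_eqI)
    \<comment> \<open>Rectangles suffice. An event of \<open>G n\<close> is a preimage under
      \<open>obs n\<close>, so the claim becomes independence of two disjoint blocks of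
      observations.\<close>
    fix A B assume "A \<in> sets (distr (P \<nu>) (G n) (\<lambda>\<omega>. \<omega>))" and "B \<in> sets (distr (P \<nu>) BM (V k))"
    then have A: "A \<in> sets (G n)" and B: "B \<in> sets BM" by auto
    obtain S where S: "S \<in> sets (PiM ({1..M} \<times> {1..n}) (\<lambda>_. borel))" and AS: "A = obs n -` S \<inter> space (P \<nu>)"
      using A unfolding G_def sets_vimage_algebra2[OF obs_in] space_P[OF assms(1)] by auto
    have pB: "p -` B \<inter> space ?K \<in> sets ?K" using p B by (rule measurable_sets)
    have Usp: "?U \<omega> \<in> space ?K" for \<omega> by (auto simp: space_PiM)
    have "prob ((\<lambda>x. (obs n x, ?U x)) -` (S \<times> (p -` B \<inter> space ?K)) \<inter> space (P \<nu>))
        = prob (obs n -` S \<inter> space (P \<nu>)) * prob (?U -` (p -` B \<inter> space ?K) \<inter> space (P \<nu>))"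
      using ind S pB by (rule indep_varD)
    also have "(\<lambda>x. (obs n x, ?U x)) -` (S \<times> (p -` B \<inter> space ?K)) \<inter> space (P \<nu>)
        = (\<lambda>\<omega>. (\<omega>, V k \<omega>)) -` (A \<times> B) \<inter> space (P \<nu>)"
      using Usp by (auto simp: AS pU)
    also have "?U -` (p -` B \<inter> space ?K) \<inter> space (P \<nu>) = V k -` B \<inter> space (P \<nu>)"
      using Usp by (auto simp: pU)
    finally have "prob ((\<lambda>\<omega>. (\<omega>, V k \<omega>)) -` (A \<times> B) \<inter> space (P \<nu>)) = prob A * prob (V k -` B \<inter> space (P \<nu>))"
      by (simp add: AS)
    moreover have "(\<lambda>\<omega>. \<omega>) -` A \<inter> space (P \<nu>) = A" by (auto simp: AS)
    ultimately show "emeasure (distr (P \<nu>) (G n) (\<lambda>\<omega>. \<omega>)) A * emeasure (distr (P \<nu>) BM (V k)) B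
        = emeasure (distr (P \<nu>) (G n \<Otimes>\<^sub>M BM) (\<lambda>\<omega>. (\<omega>, V k \<omega>))) (A \<times> B)"
      using A B id Vm by (simp add: emeasure_distr emeasure_eq_measure ennreal_mult)
  qed (rule I.sigma_finite_measure_axioms D.sigma_finite_measure_axioms | simp)+
  have "(\<integral>\<^sup>+\<omega>. F (\<omega>, V k \<omega>) \<partial>P \<nu>) = (\<integral>\<^sup>+p. F p \<partial>distr (P \<nu>) (G n \<Otimes>\<^sub>M BM) (\<lambda>\<omega>. (\<omega>, V k \<omega>)))"
    using id Vm F by (subst nn_integral_distr) auto
  also have "\<dots> = (\<integral>\<^sup>+\<omega>. (\<integral>\<^sup>+v. F (\<omega>, v) \<partial>distr (P \<nu>) BM (V k)) \<partial>distr (P \<nu>) (G n) (\<lambda>\<omega>. \<omega>))"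
    unfolding eq[symmetric] using F by (subst D.nn_integral_fst) (auto cong: measurable_cong_sets)
  also have "\<dots> = (\<integral>\<^sup>+\<omega>. (\<integral>\<^sup>+v. F (\<omega>, v) \<partial>distr (P \<nu>) BM (V k)) \<partial>P \<nu>)"
    using id F by (intro nn_integral_distr D.borel_measurable_nn_integral_fst) (auto cong: measurable_cong_sets)
  finally show ?thesis
    unfolding distr_V[OF assms(1) k1] .
qed

text \<open>Both joint laws are products that agree in the factors before \<open>\<nu>\<close>. Each
  later factor contributes the density \<open>exp (- ln (f1 / f0))\<close> of the pre-change law
  with respect to the post-change law.\<close>

lemma change_of_measure:
  assumes "1 \<le> \<nu>" and A: "A \<in> sets (G n)"
  shows "emeasure (P \<infinity>) A = (\<integral>\<^sup>+\<omega>. indicator A \<omega> * ennreal (exp (- (\<Sum>k=\<nu>..n. llr (V k \<omega>)))) \<partial>P (enat \<nu>))"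
proof (cases "n = 0")
  \<comment> \<open>Without observations the algebra is trivial; the characterization of joint laws
    used in the other case needs a nonempty index set.\<close>
  case True
  have \<nu>: "1 \<le> enat \<nu>" using assms by (simp add: one_enat_def)
  obtain S where "A = obs n -` S \<inter> space (P \<infinity>)"
    using A unfolding G_def sets_vimage_algebra2[OF obs_in] by auto
  moreover have "obs n \<omega> = (\<lambda>_. undefined)" for \<omega>
    using True by (auto simp: obs_def)
  ultimately have "A = {} \<or> A = space (P \<infinity>)" by auto
  then show ?thesis
    using prob_space.emeasure_space_1[OF prob, of \<infinity>] prob_space.emeasure_space_1[OF prob[OF \<nu>]] True assms(1)
    by (auto simp: space_P[OF \<nu>, symmetric] simp del: space_G)
next
  case False
  let ?I = "{1..M} \<times> {1..n}"
  let ?B = "PiM ?I (\<lambda>_. borel :: real measure)"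
  have \<nu>: "1 \<le> enat \<nu>" using assms by (simp add: one_enat_def)
  have ne: "?I \<noteq> {}" using False sensors by auto
  have joint: "distr (P \<mu>) ?B (obs n) = PiM ?I (\<lambda>(m, k). if enat k < \<mu> then N0 m else N1 m)" if \<mu>: "1 \<le> \<mu>" for \<mu>
  proof -
    interpret prob_space "P \<mu>" using \<mu> by (rule prob)
    have "indep_vars (\<lambda>_. borel) (\<lambda>(m, k). X m k) ?I"
      by (rule indep_vars_subset[OF indep[OF \<mu>]]) auto
    then have "distr (P \<mu>) ?B (\<lambda>\<omega>. \<lambda>i\<in>?I. (case i of (m, k) \<Rightarrow> X m k) \<omega>)
        = PiM ?I (\<lambda>i. distr (P \<mu>) borel (case i of (m, k) \<Rightarrow> X m k))"
      using ne \<mu> by (subst indep_vars_iff_distr_eq_PiM'[symmetric]) (auto intro!: measurable_X)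
    also have "(\<lambda>\<omega>. \<lambda>i\<in>?I. (case i of (m, k) \<Rightarrow> X m k) \<omega>) = obs n"
      by (auto simp: obs_def fun_eq_iff)
    also have "PiM ?I (\<lambda>i. distr (P \<mu>) borel (case i of (m, k) \<Rightarrow> X m k))
        = PiM ?I (\<lambda>(m, k). if enat k < \<mu> then N0 m else N1 m)"
      using distr_X[OF \<mu>] by (intro PiM_cong) auto
    finally show ?thesis .
  qed
  define r where "r = (\<lambda>(m, k) x. ennreal (if k < \<nu> then 1 else exp (- ln (f1 m x / f0 m x))))"
  have rm: "r i \<in> borel_measurable borel" if "i \<in> ?I" for i
    using that density_facts(1,2)[of "fst i"] by (cases i) (auto simp: r_def)
  have N_r: "density (case i of (m, k) \<Rightarrow> if enat k < enat \<nu> then N0 m else N1 m) (r i)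
      = (case i of (m, k) \<Rightarrow> if enat k < \<infinity> then N0 m else N1 m)" if "i \<in> ?I" for i
    using that density_N1_ratio[of "fst i"] by (cases i) (auto simp: r_def density_1)
  have "distr (P \<infinity>) ?B (obs n) = PiM ?I (\<lambda>(m, k). if enat k < \<infinity> then N0 m else N1 m)"
    by (rule joint) simp
  also have "\<dots> = PiM ?I (\<lambda>i. density (case i of (m, k) \<Rightarrow> if enat k < enat \<nu> then N0 m else N1 m) (r i))"
    by (rule PiM_cong[OF refl]) (rule N_r[symmetric])
  also have "\<dots> = density (PiM ?I (\<lambda>(m, k). if enat k < enat \<nu> then N0 m else N1 m)) (\<lambda>x. \<Prod>i\<in>?I. r i (x i))"
  proof (rule density_PiM[symmetric])
    fix i assume i: "i \<in> ?I"
    obtain m k where mk: "i = (m, k)" by (cases i)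
    show "sigma_finite_measure (case i of (m, k) \<Rightarrow> if enat k < enat \<nu> then N0 m else N1 m)"
      using i prob_space_N[of m] by (auto simp: mk intro!: prob_space_imp_sigma_finite)
    show "sigma_finite_measure (density (case i of (m, k) \<Rightarrow> if enat k < enat \<nu> then N0 m else N1 m) (r i))"
      unfolding N_r[OF i] using i prob_space_N[of m] by (auto simp: mk intro!: prob_space_imp_sigma_finite)
    show "r i \<in> borel_measurable (case i of (m, k) \<Rightarrow> if enat k < enat \<nu> then N0 m else N1 m)"
      using rm[OF i] by (auto simp: mk cong: measurable_cong_sets)
  qed simp
  finally have dens: "distr (P \<infinity>) ?B (obs n) = density (distr (P (enat \<nu>)) ?B (obs n)) (\<lambda>x. \<Prod>i\<in>?I. r i (x i))"
    unfolding joint[OF \<nu>] .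
  have prm: "(\<lambda>x. \<Prod>i\<in>?I. r i (x i)) \<in> borel_measurable ?B"
    using rm by (intro borel_measurable_prod_ennreal measurable_compose[OF measurable_component_singleton]) auto
  obtain S where S: "S \<in> sets ?B" and AS: "A = obs n -` S \<inter> space (P \<infinity>)"
    using A unfolding G_def sets_vimage_algebra2[OF obs_in] by blast
  have "emeasure (P \<infinity>) A = emeasure (distr (P \<infinity>) ?B (obs n)) S"
    unfolding AS by (rule emeasure_distr[symmetric, OF measurable_obs S]) simp
  also have "\<dots> = (\<integral>\<^sup>+x. (\<Prod>i\<in>?I. r i (x i)) * indicator S x \<partial>distr (P (enat \<nu>)) ?B (obs n))"
    unfolding dens using S prm by (intro emeasure_density) auto
  also have "\<dots> = (\<integral>\<^sup>+\<omega>. (\<Prod>i\<in>?I. r i (obs n \<omega> i)) * indicator S (obs n \<omega>) \<partial>P (enat \<nu>))"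
    using S prm by (intro nn_integral_distr measurable_obs \<nu>) auto
  also have "\<dots> = (\<integral>\<^sup>+\<omega>. indicator A \<omega> * ennreal (exp (- (\<Sum>k=\<nu>..n. llr (V k \<omega>)))) \<partial>P (enat \<nu>))"
  proof (rule nn_integral_cong)
    fix \<omega> assume "\<omega> \<in> space (P (enat \<nu>))"
    then have "indicator S (obs n \<omega>) = (indicator A \<omega> :: ennreal)"
      by (auto simp: AS space_P[OF \<nu>] indicator_def)
    moreover have "(\<Prod>i\<in>?I. r i (obs n \<omega> i)) = ennreal (exp (- (\<Sum>k=\<nu>..n. llr (V k \<omega>))))"
    proof -
      have "(\<Prod>i\<in>?I. r i (obs n \<omega> i)) = (\<Prod>k=1..n. \<Prod>m=1..M. r (m, k) (X m k \<omega>))"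
        by (subst prod.swap, subst prod.cartesian_product) (auto intro!: prod.cong simp: obs_def)
      also have "\<dots> = (\<Prod>k=1..n. ennreal (if k < \<nu> then 1 else exp (- llr (V k \<omega>))))"
        by (intro prod.cong refl)
          (auto simp: r_def prod_ennreal llr_sum_eq[symmetric] llr_sum_def exp_sum sum_negf[symmetric])
      also have "\<dots> = ennreal (\<Prod>k=1..n. if k < \<nu> then 1 else exp (- llr (V k \<omega>)))"
        by (intro prod_ennreal) auto
      also have "(\<Prod>k=1..n. if k < \<nu> then 1 else exp (- llr (V k \<omega>))) = (\<Prod>k=\<nu>..n. exp (- llr (V k \<omega>)))"
        using assms(1) by (intro prod.mono_neutral_cong_right) auto
      also have "\<dots> = exp (- (\<Sum>k=\<nu>..n. llr (V k \<omega>)))"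
        by (simp add: exp_sum sum_negf[symmetric])
      finally show ?thesis .
    qed
    ultimately show "(\<Prod>i\<in>?I. r i (obs n \<omega> i)) * indicator S (obs n \<omega>)
        = indicator A \<omega> * ennreal (exp (- (\<Sum>k=\<nu>..n. llr (V k \<omega>))))"
      by (simp add: mult.commute)
  qed
  finally show ?thesis .
qed

section \<open>Censored likelihood ratios\<close>

definition sensor_llr :: "nat \<Rightarrow> (real \<Rightarrow> bool) \<Rightarrow> real \<Rightarrow> real" where
  "sensor_llr m \<psi> x = censored_llr f0 f1 P X m \<psi> (\<psi> x) x"

definition clr :: "(nat \<Rightarrow> real \<Rightarrow> bool) \<Rightarrow> (nat \<Rightarrow> real) \<Rightarrow> real" where
  "clr \<psi> v = (\<Sum>m=1..M. sensor_llr m (\<psi> m) (v m))"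

definition Isum :: real where "Isum = (\<Sum>m=1..M. real_of_ereal (kl_info (f1 m) (f0 m)))"

lemma measurable_sensor_ratio [measurable]:
  "m \<in> {1..M} \<Longrightarrow> (\<lambda>x. ln (f1 m x / f0 m x)) \<in> borel_measurable borel"
  using density_facts(1,2)[of m] by simp

lemma density_N0_ratio:
  assumes m: "m \<in> {1..M}"
  shows "density (N0 m) (\<lambda>x. ennreal (exp (ln (f1 m x / f0 m x)))) = N1 m"
proof -
  note [measurable] = measurable_sensor_ratio[OF m]
  have "density (N0 m) (\<lambda>x. ennreal (exp (ln (f1 m x / f0 m x))))
      = density (N1 m) (\<lambda>x. ennreal (exp (- ln (f1 m x / f0 m x))) * ennreal (exp (ln (f1 m x / f0 m x))))"
    unfolding density_N1_ratio[OF m, symmetric] by (rule density_density_eq) auto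
  also have "(\<lambda>x. ennreal (exp (- ln (f1 m x / f0 m x))) * ennreal (exp (ln (f1 m x / f0 m x)))) = (\<lambda>_. 1)"
    by (simp add: ennreal_mult[symmetric] exp_add[symmetric] del: exp_ln_iff)
  finally show ?thesis by (simp add: density_1)
qed

lemma prob_X_eq:
  assumes "1 \<le> \<nu>" "m \<in> {1..M}" "censoring_strategy \<psi>"
  shows "\<P>(\<omega> in P \<nu>. \<psi> (X m 1 \<omega>)) = measure (if 1 < \<nu> then N0 m else N1 m) {x. \<psi> x}"
proof -
  have [measurable]: "Measurable.pred borel \<psi>" using assms(3) by (simp add: censoring_strategy_def)
  have "measure (distr (P \<nu>) borel (X m 1)) {x. \<psi> x} = \<P>(\<omega> in P \<nu>. \<psi> (X m 1 \<omega>))"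
    using assms by (subst measure_distr) (auto intro!: measurable_X arg_cong[where f="measure (P \<nu>)"])
  then show ?thesis using assms by (simp add: distr_X one_enat_def)
qed

lemma sensor_llr_eq:
  assumes m: "m \<in> {1..M}" and \<psi>: "censoring_strategy \<psi>"
  shows "sensor_llr m \<psi> x = (if x \<in> {x. \<not> \<psi> x} then ln (measure (N1 m) {x. \<not> \<psi> x} / measure (N0 m) {x. \<not> \<psi> x})
    else ln (f1 m x / f0 m x))"
proof -
  have "censoring_strategy (\<lambda>x. \<not> \<psi> x)" using \<psi> by (simp add: censoring_strategy_def)
  from prob_X_eq[OF _ m this] show ?thesis
    by (auto simp: sensor_llr_def censored_llr_def)
qed

lemma measurable_sensor_llr [measurable]:
  assumes m: "m \<in> {1..M}" and \<psi>: "censoring_strategy \<psi>"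
  shows "sensor_llr m \<psi> \<in> borel_measurable borel"
proof -
  have [measurable]: "Measurable.pred borel \<psi>" using \<psi> by (simp add: censoring_strategy_def)
  note [measurable] = measurable_sensor_ratio[OF m]
  show ?thesis unfolding sensor_llr_eq[OF assms] by measurable
qed

lemma integral_exp_sensor_llr:
  assumes m: "m \<in> {1..M}" and \<psi>: "censoring_strategy \<psi>"
  shows "(\<integral>\<^sup>+x. ennreal (exp (sensor_llr m \<psi> x)) \<partial>N0 m) = 1"
    and "(\<integral>\<^sup>+x. ennreal (exp (- sensor_llr m \<psi> x)) \<partial>N1 m) = 1"
proof -
  have [measurable]: "Measurable.pred borel \<psi>" using \<psi> by (simp add: censoring_strategy_def)
  have S: "{x. \<not> \<psi> x} \<in> sets borel" by measurable
  note r = measurable_sensor_ratio[OF m]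
  show "(\<integral>\<^sup>+x. ennreal (exp (sensor_llr m \<psi> x)) \<partial>N0 m) = 1"
    using censored_likelihood_ratio_integral[of "N0 m" "\<lambda>x. ln (f1 m x / f0 m x)" "{x. \<not> \<psi> x}"]
      prob_space_N[OF m] S r
    unfolding sensor_llr_eq[OF assms] density_N0_ratio[OF m] by (simp cong: measurable_cong_sets)
  \<comment> \<open>This holds for zero arguments too, where both sides are \<open>0\<close> by
    convention, so the negated ratio has the same form with the two laws exchanged.\<close>
  have neg: "ln (a / b) = - ln (b / a)" if "0 \<le> a" "0 \<le> b" for a b :: real
    using that by (cases "a = 0"; cases "b = 0") (auto simp: ln_div)
  have "- sensor_llr m \<psi> x = (if x \<in> {x. \<not> \<psi> x} then ln (measure (N0 m) {x. \<not> \<psi> x} / measure (N1 m) {x. \<not> \<psi> x})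
    else - ln (f1 m x / f0 m x))" for x
    unfolding sensor_llr_eq[OF assms]
    using neg[of "measure (N0 m) {x. \<not> \<psi> x}" "measure (N1 m) {x. \<not> \<psi> x}"] by simp
  then show "(\<integral>\<^sup>+x. ennreal (exp (- sensor_llr m \<psi> x)) \<partial>N1 m) = 1"
    using censored_likelihood_ratio_integral[of "N1 m" "\<lambda>x. - ln (f1 m x / f0 m x)" "{x. \<not> \<psi> x}"]
      prob_space_N[OF m] S r
    unfolding density_N1_ratio[OF m] by (simp cong: measurable_cong_sets)
qed

lemma kl_info_integral:
  assumes m: "m \<in> {1..M}"
  shows "integrable (N1 m) (\<lambda>x. ln (f1 m x / f0 m x))"
    and "(\<integral>x. ln (f1 m x / f0 m x) \<partial>N1 m) = real_of_ereal (kl_info (f1 m) (f0 m))"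
    and "0 < real_of_ereal (kl_info (f1 m) (f0 m))"
proof -
  note d = density_facts[OF m] and r = measurable_sensor_ratio[OF m]
  note kl = kl_info_finite[OF density1[OF m] density0[OF m]] kl10[OF m]
  show "integrable (N1 m) (\<lambda>x. ln (f1 m x / f0 m x))"
    unfolding N1_def using kl d r by (subst integrable_density) auto
  show "(\<integral>x. ln (f1 m x / f0 m x) \<partial>N1 m) = real_of_ereal (kl_info (f1 m) (f0 m))"
    unfolding N1_def using kl d r by (subst integral_density) auto
  show "0 < real_of_ereal (kl_info (f1 m) (f0 m))"
    using kl by auto
qed

lemma integrable_sensor_llr:
  assumes m: "m \<in> {1..M}" and \<psi>: "censoring_strategy \<psi>"
  shows "integrable (N1 m) (sensor_llr m \<psi>)"
proof -
  interpret prob_space "N1 m" using m by (rule prob_space_N)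
  let ?k = "ln (measure (N1 m) {x. \<not> \<psi> x} / measure (N0 m) {x. \<not> \<psi> x})"
  show ?thesis
  proof (rule Bochner_Integration.integrable_bound)
    show "integrable (N1 m) (\<lambda>x. \<bar>ln (f1 m x / f0 m x)\<bar> + \<bar>?k\<bar>)"
      using kl_info_integral[OF m] by auto
    show "sensor_llr m \<psi> \<in> borel_measurable (N1 m)"
      using measurable_sensor_llr[OF assms] by (simp cong: measurable_cong_sets)
  qed (auto simp: sensor_llr_eq[OF assms])
qed

text \<open>Gibbs' inequality: writing \<open>l\<close> for the censored ratio,
  \<open>exp (- l)\<close> has mean \<open>1\<close>, so the mean of \<open>l\<close> is that of
  \<open>exp (- l) - 1 + l\<close>. This function is nonnegative and vanishes only where
  \<open>l = 0\<close>.\<close>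

lemma sensor_llr_mean:
  assumes m: "m \<in> {1..M}" and \<psi>: "censoring_strategy \<psi>"
  shows "0 \<le> (\<integral>x. sensor_llr m \<psi> x \<partial>N1 m)"
    and "(\<integral>x. sensor_llr m \<psi> x \<partial>N1 m) \<le> 0 \<Longrightarrow> AE x in N1 m. sensor_llr m \<psi> x = 0"
proof -
  interpret prob_space "N1 m" using m by (rule prob_space_N)
  note int = integrable_sensor_llr[OF assms]
  have [measurable]: "sensor_llr m \<psi> \<in> borel_measurable (N1 m)" using int by auto
  let ?g = "\<lambda>x. exp (- sensor_llr m \<psi> x) - 1 + sensor_llr m \<psi> x"
  have ie: "integrable (N1 m) (\<lambda>x. exp (- sensor_llr m \<psi> x))"
    using integral_exp_sensor_llr(2)[OF assms] by (intro integrableI_nonneg) auto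
  have "(\<integral>x. exp (- sensor_llr m \<psi> x) \<partial>N1 m) = 1"
    using integral_exp_sensor_llr(2)[OF assms] nn_integral_eq_integral[OF ie] by simp
  then have eq: "(\<integral>x. ?g x \<partial>N1 m) = (\<integral>x. sensor_llr m \<psi> x \<partial>N1 m)"
    using ie int prob_space by simp
  have g0: "0 \<le> ?g x" for x using exp_ge_add_one_self[of "- sensor_llr m \<psi> x"] by linarith
  then show nn: "0 \<le> (\<integral>x. sensor_llr m \<psi> x \<partial>N1 m)"
    unfolding eq[symmetric] by (intro Bochner_Integration.integral_nonneg)
  assume "(\<integral>x. sensor_llr m \<psi> x \<partial>N1 m) \<le> 0"
  then have "(\<integral>x. ?g x \<partial>N1 m) = 0" using nn eq by simp
  then have "AE x in N1 m. ?g x = 0"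
    using g0 ie int by (subst (asm) integral_nonneg_eq_0_iff_AE) auto
  then show "AE x in N1 m. sensor_llr m \<psi> x = 0"
  proof eventually_elim
    case (elim x)
    then have "ln (exp (- sensor_llr m \<psi> x)) = exp (- sensor_llr m \<psi> x) - 1" by simp
    then show ?case using ln_eq_minus_one[of "exp (- sensor_llr m \<psi> x)"] by simp
  qed
qed

text \<open>The strategy transmits on a set \<open>C\<close> of mass \<open>e\<close> that meets the
  set \<open>S\<close> of differing densities in positive mass. An uninformative ratio would vanish
  almost everywhere, forcing the densities to agree on almost all of \<open>C\<close>.\<close>

lemma exists_informative_strategy:
  assumes m: "m \<in> {1..M}" and e: "0 < e" "e \<le> 1"
  obtains \<psi> where "censoring_strategy \<psi>" "\<P>(\<omega> in P \<infinity>. \<psi> (X m 1 \<omega>)) = e"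
    "0 < (\<integral>x. sensor_llr m \<psi> x \<partial>N1 m)"
proof -
  interpret N0: prob_space "N0 m" using m by (rule prob_space_N)
  note d = density_facts[OF m]
  note [measurable] = d(1,2) measurable_sensor_ratio[OF m]
  define S where "S = {x. f0 m x \<noteq> f1 m x}"
  have S[measurable]: "S \<in> sets borel" unfolding S_def by measurable
  have ac: "emeasure (N0 m) B = 0 \<longleftrightarrow> emeasure (N1 m) B = 0" if "B \<in> sets borel" for B
    using null_density_exp_iff[of "\<lambda>x. ln (f1 m x / f0 m x)" "N0 m" B] that
    unfolding density_N0_ratio[OF m] by (simp cong: measurable_cong_sets)
  have S0: "0 < measure (N0 m) S"
  proof (rule ccontr)
    assume "\<not> 0 < measure (N0 m) S"
    then have "measure (N0 m) S = 0" using measure_nonneg[of "N0 m" S] by linarith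
    then have "emeasure (N0 m) S = 0" by (simp add: N0.emeasure_eq_measure)
    then have "S \<in> null_sets (N1 m)" using ac[OF S] by auto
    then have "AE x in N1 m. x \<notin> S" by (rule AE_not_in)
    then have "AE x in N1 m. ln (f1 m x / f0 m x) = 0"
      using AE_N_pos(2)[OF m] by eventually_elim (auto simp: S_def)
    then have "(\<integral>x. ln (f1 m x / f0 m x) \<partial>N1 m) = (\<integral>x. 0 \<partial>N1 m)"
      by (intro integral_cong_AE) auto
    then show False using kl_info_integral[OF m] by simp
  qed
  have atoms: "measure (N0 m) {x} = 0" for x
  proof -
    have "{x} \<in> null_sets lborel" by (rule null_setsI) auto
    then have "{x} \<in> null_sets (N0 m)"
      unfolding N0_def by (intro absolutely_continuousI_density[unfolded absolutely_continuous_def, THEN subsetD]) auto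
    then show ?thesis by (simp add: measure_eq_0_null_sets)
  qed
  \<comment> \<open>Depending on whether \<open>e\<close> is below or above the mass of
    \<open>S\<close>, the set is chosen inside \<open>S\<close> or around it.\<close>
  obtain C where C: "C \<in> sets borel" "measure (N0 m) C = e" "0 < measure (N0 m) (C \<inter> S)"
  proof (cases "e \<le> measure (N0 m) S")
    case True
    obtain C where "C \<in> sets borel" "C \<subseteq> S" "measure (N0 m) C = e"
      using exists_between_of_mass[OF N0.finite_measure_axioms _ atoms _ S, of "{}" e] True e by auto
    then show thesis using e by (intro that[of C]) (auto simp: Int_absorb2)
  next
    case False
    obtain C where "C \<in> sets borel" "S \<subseteq> C" "measure (N0 m) C = e"
      using exists_between_of_mass[OF N0.finite_measure_axioms _ atoms S, of UNIV e] False e N0.prob_space by auto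
    then show thesis using S0 by (intro that[of C]) (auto simp: Int_absorb1)
  qed
  have \<psi>: "censoring_strategy (\<lambda>x. x \<in> C)" using C by (simp add: censoring_strategy_def pred_def)
  show thesis
  proof (rule that[OF \<psi>])
    show "\<P>(\<omega> in P \<infinity>. X m 1 \<omega> \<in> C) = e"
      using prob_X_eq[OF _ m \<psi>, of \<infinity>] C by simp
    show "0 < (\<integral>x. sensor_llr m (\<lambda>x. x \<in> C) x \<partial>N1 m)"
    proof (rule ccontr)
      assume "\<not> ?thesis"
      then have "AE x in N1 m. sensor_llr m (\<lambda>x. x \<in> C) x = 0"
        by (intro sensor_llr_mean(2)[OF m \<psi>]) simp
      then have "AE x in N1 m. x \<notin> C \<inter> S"
        using AE_N_pos(2)[OF m]
        by eventually_elim (auto simp: sensor_llr_eq[OF m \<psi>] S_def split: if_splits)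
      then have "C \<inter> S \<in> null_sets (N1 m)"
        using C by (subst (asm) AE_iff_null_sets[symmetric]) auto
      then have "emeasure (N0 m) (C \<inter> S) = 0" using ac[of "C \<inter> S"] C by auto
      then show False using C(3) by (simp add: N0.emeasure_eq_measure)
    qed
  qed
qed

text \<open>Nothing about the shape of a maximizer is needed: positivity is inherited by comparison
  with an informative strategy of the same rate.\<close>

lemma optimal_strategy:
  assumes opt: "optimal_censoring M f0 f1 P X \<psi>s" and m: "m \<in> {1..M}" and e: "0 < e" "e \<le> 1"
  shows "censoring_strategy (\<psi>s m e)" and "0 < (\<integral>x. sensor_llr m (\<psi>s m e) x \<partial>N1 m)"
proof -
  have arg: "is_arg_max (\<lambda>\<psi>. \<integral>\<omega>. censored_llr f0 f1 P X m \<psi> (\<psi> (X m 1 \<omega>)) (X m 1 \<omega>) \<partial>P 1)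
    (\<lambda>\<psi>. censoring_strategy \<psi> \<and> \<P>(\<omega> in P \<infinity>. \<psi> (X m 1 \<omega>)) = e) (\<psi>s m e)"
    using opt m e unfolding optimal_censoring_def by auto
  then show cs: "censoring_strategy (\<psi>s m e)" by (auto simp: is_arg_max_def)
  have eq: "(\<integral>\<omega>. censored_llr f0 f1 P X m \<psi> (\<psi> (X m 1 \<omega>)) (X m 1 \<omega>) \<partial>P 1) = (\<integral>x. sensor_llr m \<psi> x \<partial>N1 m)"
    if "censoring_strategy \<psi>" for \<psi>
  proof -
    have "N1 m = distr (P 1) borel (X m 1)" using distr_X[of 1 m 1] m by (simp add: one_enat_def)
    then show ?thesis
      using that m by (simp add: integral_distr measurable_X measurable_sensor_llr sensor_llr_def[symmetric])
  qed
  obtain \<psi> where \<psi>: "censoring_strategy \<psi>" "\<P>(\<omega> in P \<infinity>. \<psi> (X m 1 \<omega>)) = e"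
    "0 < (\<integral>x. sensor_llr m \<psi> x \<partial>N1 m)"
    using exists_informative_strategy[OF m e] by blast
  have "\<not> (\<integral>x. sensor_llr m (\<psi>s m e) x \<partial>N1 m) < (\<integral>x. sensor_llr m \<psi> x \<partial>N1 m)"
    using arg \<psi>(1,2) unfolding is_arg_max_def eq[OF cs] using eq[OF \<psi>(1)] by auto
  then show "0 < (\<integral>x. sensor_llr m (\<psi>s m e) x \<partial>N1 m)" using \<psi>(3) by simp
qed

lemma integral_W1_sum:
  fixes g :: "nat \<Rightarrow> real \<Rightarrow> real"
  assumes "\<And>m. m \<in> {1..M} \<Longrightarrow> integrable (N1 m) (g m)"
  shows "integrable W1 (\<lambda>v. \<Sum>m=1..M. g m (v m))"
    and "(\<integral>v. (\<Sum>m=1..M. g m (v m)) \<partial>W1) = (\<Sum>m=1..M. \<integral>x. g m x \<partial>N1 m)"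
proof -
  have N1: "N1 m = distr W1 (N1 m) (\<lambda>v. v m)" if "m \<in> {1..M}" for m
    unfolding W1_def by (rule distr_PiM_component[symmetric]) (use that prob_space_N in auto)
  have comp: "(\<lambda>v. v m) \<in> measurable W1 (N1 m)" if "m \<in> {1..M}" for m
    unfolding W1_def using that by (rule measurable_component_singleton)
  have int: "integrable W1 (\<lambda>v. g m (v m))" if m: "m \<in> {1..M}" for m
  proof -
    have "integrable (distr W1 (N1 m) (\<lambda>v. v m)) (g m)" using assms[OF m] N1[OF m] by simp
    then show ?thesis by (rule integrable_distr[OF comp[OF m]])
  qed
  then show "integrable W1 (\<lambda>v. \<Sum>m=1..M. g m (v m))" by (rule Bochner_Integration.integrable_sum)
  have val: "(\<integral>v. g m (v m) \<partial>W1) = (\<integral>x. g m x \<partial>N1 m)" if m: "m \<in> {1..M}" for m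
  proof -
    have "(\<integral>x. g m x \<partial>N1 m) = (\<integral>x. g m x \<partial>distr W1 (N1 m) (\<lambda>v. v m))" using N1[OF m] by simp
    also have "\<dots> = (\<integral>v. g m (v m) \<partial>W1)"
      using assms[OF m] by (intro integral_distr comp m) auto
    finally show ?thesis by simp
  qed
  show "(\<integral>v. (\<Sum>m=1..M. g m (v m)) \<partial>W1) = (\<Sum>m=1..M. \<integral>x. g m x \<partial>N1 m)"
    using int val by (simp add: Bochner_Integration.integral_sum)
qed

lemma llr_mean:
  shows "integrable W1 llr" "(\<integral>v. llr v \<partial>W1) = Isum" "0 < Isum"
proof -
  show "integrable W1 llr" unfolding llr_def by (rule integral_W1_sum) (rule kl_info_integral)
  have "(\<integral>v. llr v \<partial>W1) = (\<Sum>m=1..M. \<integral>x. ln (f1 m x / f0 m x) \<partial>N1 m)"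
    unfolding llr_def by (rule integral_W1_sum) (rule kl_info_integral)
  then show "(\<integral>v. llr v \<partial>W1) = Isum"
    by (simp add: Isum_def kl_info_integral)
  show "0 < Isum" unfolding Isum_def using sensors kl_info_integral(3) by (intro sum_pos) auto
qed

lemma clr_full: "clr (\<lambda>_ _. True) v = llr v"
  unfolding clr_def llr_def by (simp add: sensor_llr_def censored_llr_def)

lemma measurable_clr:
  assumes "\<And>m. m \<in> {1..M} \<Longrightarrow> censoring_strategy (\<psi> m)" shows "clr \<psi> \<in> borel_measurable BM"
  unfolding clr_def
proof (rule borel_measurable_sum)
  fix m assume m: "m \<in> {1..M}"
  then have "(\<lambda>v. v m) \<in> borel_measurable BM" by (rule measurable_component_singleton)
  then show "(\<lambda>v. sensor_llr m (\<psi> m) (v m)) \<in> borel_measurable BM"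
    using measurable_sensor_llr[OF m assms[OF m]] by (rule measurable_compose)
qed

lemma clr_mean_pos:
  assumes "\<And>m. m \<in> {1..M} \<Longrightarrow> censoring_strategy (\<psi> m)"
    and "\<And>m. m \<in> {1..M} \<Longrightarrow> 0 < (\<integral>x. sensor_llr m (\<psi> m) x \<partial>N1 m)"
  shows "integrable W1 (clr \<psi>)" "0 < (\<integral>v. clr \<psi> v \<partial>W1)"
proof -
  show "integrable W1 (clr \<psi>)" unfolding clr_def by (intro integral_W1_sum integrable_sensor_llr assms)
  have "(\<integral>v. clr \<psi> v \<partial>W1) = (\<Sum>m=1..M. \<integral>x. sensor_llr m (\<psi> m) x \<partial>N1 m)"
    unfolding clr_def by (intro integral_W1_sum integrable_sensor_llr assms)
  also have "\<dots> > 0" using sensors assms(2) by (intro sum_pos) auto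
  finally show "0 < (\<integral>v. clr \<psi> v \<partial>W1)" .
qed

lemma integral_exp_clr:
  assumes "\<And>m. m \<in> {1..M} \<Longrightarrow> censoring_strategy (\<psi> m)"
  shows "(\<integral>\<^sup>+v. ennreal (exp (clr \<psi> v)) \<partial>W0) = 1" "(\<integral>\<^sup>+v. ennreal (exp (- clr \<psi> v)) \<partial>W1) = 1"
proof -
  have m: "sensor_llr m (\<psi> m) \<in> borel_measurable borel" if "m \<in> {1..M}" for m
    using that assms by (intro measurable_sensor_llr)
  have "(\<integral>\<^sup>+v. ennreal (exp (clr \<psi> v)) \<partial>W0) = (\<Prod>m=1..M. \<integral>\<^sup>+x. ennreal (exp (sensor_llr m (\<psi> m) x)) \<partial>N0 m)"
    unfolding clr_def W0_def using m prob_space_N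
    by (intro nn_integral_PiM_exp_sum) (auto cong: measurable_cong_sets)
  then show "(\<integral>\<^sup>+v. ennreal (exp (clr \<psi> v)) \<partial>W0) = 1"
    using assms by (simp add: integral_exp_sensor_llr)
  have "(\<integral>\<^sup>+v. ennreal (exp (- clr \<psi> v)) \<partial>W1) = (\<Prod>m=1..M. \<integral>\<^sup>+x. ennreal (exp (- sensor_llr m (\<psi> m) x)) \<partial>N1 m)"
    unfolding clr_def W1_def sum_negf[symmetric] using m prob_space_N
    by (intro nn_integral_PiM_exp_sum) (auto cong: measurable_cong_sets)
  then show "(\<integral>\<^sup>+v. ennreal (exp (- clr \<psi> v)) \<partial>W1) = 1"
    using assms by (simp add: integral_exp_sensor_llr)
qed

section \<open>Policies and stopping times\<close>

abbreviation IA :: "(nat \<Rightarrow> nat \<Rightarrow> 'a \<Rightarrow> real \<Rightarrow> bool) \<Rightarrow> nat \<Rightarrow> 'a measure" where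
  "IA \<equiv> info_algebra M P X"

abbreviation info_space :: "nat \<Rightarrow> (nat \<times> nat \<Rightarrow> bool \<times> real) measure" where
  "info_space k \<equiv> PiM ({1..M} \<times> {1..k}) (\<lambda>_. count_space UNIV \<Otimes>\<^sub>M borel)"

lemma space_IA [simp]: "space (IA \<Psi> k) = space (P \<infinity>)"
  by (simp add: info_algebra_def)

lemma measurable_info: "info M X \<Psi> k \<in> measurable (IA \<Psi> k) (info_space k)"
  unfolding info_algebra_def
  by (rule measurable_vimage_algebra1) (auto simp: info_def space_PiM space_pair_measure PiE_def extensional_def)

lemma measurable_transmits_IA:
  assumes "m \<in> {1..M}" "1 \<le> j" "j \<le> k"
  shows "Measurable.pred (IA \<Psi> k) (transmits X \<Psi> m j)"
    and "(\<lambda>\<omega>. of_bool (transmits X \<Psi> m j \<omega>) * X m j \<omega>) \<in> borel_measurable (IA \<Psi> k)"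
proof -
  have c: "(\<lambda>\<omega>. info M X \<Psi> k \<omega> (m, j)) \<in> measurable (IA \<Psi> k) (count_space UNIV \<Otimes>\<^sub>M borel)"
    using assms by (intro measurable_compose[OF measurable_info measurable_component_singleton]) auto
  have eq: "info M X \<Psi> k \<omega> (m, j) = (transmits X \<Psi> m j \<omega>, of_bool (transmits X \<Psi> m j \<omega>) * X m j \<omega>)" for \<omega>
    using assms by (simp add: info_def)
  show "Measurable.pred (IA \<Psi> k) (transmits X \<Psi> m j)"
    using measurable_compose[OF c measurable_fst] unfolding eq by simp
  show "(\<lambda>\<omega>. of_bool (transmits X \<Psi> m j \<omega>) * X m j \<omega>) \<in> borel_measurable (IA \<Psi> k)"
    using measurable_compose[OF c measurable_snd] unfolding eq by simp
qed

text \<open>Universal property of the information algebra: only the transmission bits and the masked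
  observations have to be checked.\<close>

lemma measurable_into_IA:
  assumes sp: "space N = space (P \<infinity>)"
    and t: "\<And>m j. m \<in> {1..M} \<Longrightarrow> 1 \<le> j \<Longrightarrow> j \<le> k \<Longrightarrow> Measurable.pred N (transmits X \<Psi> m j)"
    and x: "\<And>m j. m \<in> {1..M} \<Longrightarrow> 1 \<le> j \<Longrightarrow> j \<le> k \<Longrightarrow>
      (\<lambda>\<omega>. of_bool (transmits X \<Psi> m j \<omega>) * X m j \<omega>) \<in> borel_measurable N"
  shows "(\<lambda>\<omega>. \<omega>) \<in> measurable N (IA \<Psi> k)"
  unfolding info_algebra_def
proof (rule measurable_vimage_algebra2)
  have "(\<lambda>\<omega>. (case i of (m, j) \<Rightarrow> (transmits X \<Psi> m j \<omega>, of_bool (transmits X \<Psi> m j \<omega>) * X m j \<omega>)))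
      \<in> measurable N (count_space UNIV \<Otimes>\<^sub>M borel)" if "i \<in> {1..M} \<times> {1..k}" for i
  proof (cases i)
    case (Pair m j)
    then have "m \<in> {1..M}" "1 \<le> j" "j \<le> k" using that by auto
    from measurable_Pair[OF t[OF this] x[OF this]] show ?thesis by (simp add: Pair)
  qed
  then show "(\<lambda>\<omega>. info M X \<Psi> k \<omega>) \<in> measurable N (info_space k)"
    unfolding info_def by (intro measurable_restrict)
qed (use sp in auto)

lemma measurable_IA_mono:
  assumes "j \<le> k" "f \<in> measurable (IA \<Psi> j) N" shows "f \<in> measurable (IA \<Psi> k) N"
proof -
  have "(\<lambda>\<omega>. \<omega>) \<in> measurable (IA \<Psi> k) (IA \<Psi> j)"
    by (rule measurable_into_IA) (use assms measurable_transmits_IA in auto)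
  then show ?thesis using assms(2) by (rule measurable_compose)
qed

text \<open>Strong induction on time: the strategy at time \<open>j\<close> depends on the
  information up to \<open>j - 1\<close>, already a function of the raw data, and is applied to a
  raw observation.\<close>

lemma measurable_G_IA:
  assumes pol: "censoring_policy M P X \<Psi>" shows "(\<lambda>\<omega>. \<omega>) \<in> measurable (G k) (IA \<Psi> k)"
proof (induction k rule: less_induct)
  case (less k)
  have t: "Measurable.pred (G k) (transmits X \<Psi> m j)" and x: "X m j \<in> borel_measurable (G k)"
    if mj: "m \<in> {1..M}" "1 \<le> j" "j \<le> k" for m j
  proof -
    show x: "X m j \<in> borel_measurable (G k)" using mj by (rule measurable_X_G)
    have "(\<lambda>\<omega>. \<omega>) \<in> measurable (G k) (IA \<Psi> (j - 1))"
      by (rule measurable_G_mono[OF _ less]) (use mj in auto)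
    from measurable_Pair[OF this x]
    have "(\<lambda>\<omega>. (\<omega>, X m j \<omega>)) \<in> measurable (G k) (IA \<Psi> (j - 1) \<Otimes>\<^sub>M borel)" .
    moreover have "Measurable.pred (IA \<Psi> (j - 1) \<Otimes>\<^sub>M borel) (\<lambda>(\<omega>, x). \<Psi> m j \<omega> x)"
      using pol mj unfolding censoring_policy_def by blast
    ultimately have "Measurable.pred (G k) (\<lambda>\<omega>. (\<lambda>(\<omega>, x). \<Psi> m j \<omega> x) (\<omega>, X m j \<omega>))"
      by (rule measurable_compose)
    then show "Measurable.pred (G k) (transmits X \<Psi> m j)"
      by (simp add: transmits_def[abs_def])
  qed
  show ?case
  proof (rule measurable_into_IA)
    fix m j assume mj: "m \<in> {1..M}" "1 \<le> j" "j \<le> k"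
    note [measurable] = t[OF mj] x[OF mj]
    show "Measurable.pred (G k) (transmits X \<Psi> m j)" by measurable
    show "(\<lambda>\<omega>. of_bool (transmits X \<Psi> m j \<omega>) * X m j \<omega>) \<in> borel_measurable (G k)" by measurable
  qed simp
qed

lemma sets_IA_G:
  assumes "censoring_policy M P X \<Psi>" "A \<in> sets (IA \<Psi> k)" shows "A \<in> sets (G k)"
  using measurable_sets[OF measurable_G_IA[OF assms(1)] assms(2)] sets.sets_into_space[OF assms(2)]
  by (simp add: Int_absorb2)

lemma subalgebra_IA:
  assumes "censoring_policy M P X \<Psi>" "1 \<le> \<nu>" shows "subalgebra (P \<nu>) (IA \<Psi> k)"
proof -
  have "sets (IA \<Psi> k) \<subseteq> sets (P \<nu>)"
    using sets_IA_G[OF assms(1)] sets_G_subset[OF assms(2)] by blast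
  then show ?thesis using space_P[OF assms(2)] by (simp add: subalgebra_def)
qed

section \<open>Stopping events, delay and mean time to alarm\<close>

definition running :: "('a \<Rightarrow> enat) \<Rightarrow> nat \<Rightarrow> 'a set" where
  "running T n = {\<omega> \<in> space (P \<infinity>). enat n \<le> T \<omega>}"

lemma running_mono: "n \<le> n' \<Longrightarrow> running T n' \<subseteq> running T n"
  by (auto simp: running_def intro: order_trans[rotated])

text \<open>Whether an alarm precedes time \<open>n\<close> is settled at time \<open>n - 1\<close>.
  This event is therefore independent of the observations at time \<open>n\<close>, which is what
  Wald's identity rests on.\<close>

lemma running_IA:
  assumes "info_stopping_time M P X \<Psi> T" "1 \<le> n" shows "running T n \<in> sets (IA \<Psi> (n - 1))"
proof -
  have [measurable]: "Measurable.pred (IA \<Psi> (n - 1)) (\<lambda>\<omega>. T \<omega> \<le> enat (n - 1))"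
    using assms(1) by (auto simp: info_stopping_time_def)
  have "{\<omega> \<in> space (IA \<Psi> (n - 1)). \<not> T \<omega> \<le> enat (n - 1)} \<in> sets (IA \<Psi> (n - 1))"
    by measurable
  moreover have "\<not> T \<omega> \<le> enat (n - 1) \<longleftrightarrow> enat n \<le> T \<omega>" for \<omega>
    using assms(2) by (cases "T \<omega>") auto
  ultimately show ?thesis by (simp add: running_def)
qed

lemma delay_eq_suminf:
  assumes "\<omega> \<in> space (P \<infinity>)"
  shows "ennreal_of_enat (T \<omega> + 1 - enat n) = (\<Sum>i. indicator (running T (n + i)) \<omega>)"
  unfolding ennreal_of_enat_diff using assms by (simp add: running_def indicator_def of_bool_def)

lemma measurable_delay:
  assumes pol: "censoring_policy M P X \<Psi>" and st: "info_stopping_time M P X \<Psi> T" and \<nu>: "1 \<le> \<nu>"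
  shows "(\<lambda>\<omega>. ennreal_of_enat (T \<omega> + 1 - enat \<nu>)) \<in> borel_measurable (P (enat \<nu>))"
proof -
  have \<nu>': "1 \<le> enat \<nu>" using \<nu> by (simp add: one_enat_def)
  have [measurable]: "running T (\<nu> + i) \<in> sets (P (enat \<nu>))" for i
    using running_IA[OF st, of "\<nu> + i"] subalgebra_IA[OF pol \<nu>', of "\<nu> + i - 1"] \<nu> by (auto simp: subalgebra_def)
  have "(\<lambda>\<omega>. \<Sum>i. indicator (running T (\<nu> + i)) \<omega> :: ennreal) \<in> borel_measurable (P (enat \<nu>))"
    by measurable
  then show ?thesis
    by (subst measurable_cong[where g="\<lambda>\<omega>. \<Sum>i. indicator (running T (\<nu> + i)) \<omega>"])
      (use space_P[OF \<nu>'] delay_eq_suminf in auto)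
qed

text \<open>The essential supremum dominates the conditional delay almost surely; integrating over a
  past event removes the conditioning.\<close>

lemma lorden_delay_ge:
  assumes pol: "censoring_policy M P X \<Psi>" and st: "info_stopping_time M P X \<Psi> T"
    and d: "lorden_delay M P X T \<Psi> \<le> ennreal d" and \<nu>: "1 \<le> \<nu>" and A: "A \<in> sets (IA \<Psi> (\<nu> - 1))"
  shows "(\<integral>\<^sup>+\<omega>. indicator A \<omega> * ennreal_of_enat (T \<omega> + 1 - enat \<nu>) \<partial>P (enat \<nu>)) \<le> ennreal d * emeasure (P (enat \<nu>)) A"
proof -
  let ?Q = "P (enat \<nu>)" and ?F = "IA \<Psi> (\<nu> - 1)"
  have \<nu>': "1 \<le> enat \<nu>" using \<nu> by (simp add: one_enat_def)
  interpret prob_space ?Q using \<nu>' by (rule prob)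
  interpret finite_measure_subalgebra ?Q ?F
    by (intro finite_measure_subalgebra.intro finite_measure_axioms finite_measure_subalgebra_axioms.intro subalgebra_IA pol \<nu>')
  let ?f = "\<lambda>\<omega>. ennreal_of_enat (T \<omega> + 1 - enat \<nu>)"
  have AQ[measurable]: "A \<in> sets ?Q" using A subalg by (auto simp: subalgebra_def)
  note f = measurable_delay[OF pol st \<nu>]
  have "AE \<omega> in ?Q. nn_cond_exp ?Q ?F ?f \<omega> \<le> esssup ?Q (nn_cond_exp ?Q ?F ?f)"
    by (rule esssup_AE)
  moreover have "esssup ?Q (nn_cond_exp ?Q ?F ?f) \<le> ennreal d"
    using d \<nu> unfolding lorden_delay_def SUP_le_iff by auto
  ultimately have "AE \<omega> in ?Q. nn_cond_exp ?Q ?F ?f \<omega> \<le> ennreal d"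
    by (auto elim: eventually_mono order_trans)
  have "(\<integral>\<^sup>+\<omega>. indicator A \<omega> * ?f \<omega> \<partial>?Q) = (\<integral>\<^sup>+\<omega>. indicator A \<omega> * nn_cond_exp ?Q ?F ?f \<omega> \<partial>?Q)"
    using A f by (intro nn_cond_exp_intg[symmetric]) auto
  also have "\<dots> \<le> (\<integral>\<^sup>+\<omega>. ennreal d * indicator A \<omega> \<partial>?Q)"
    using \<open>AE \<omega> in ?Q. nn_cond_exp ?Q ?F ?f \<omega> \<le> ennreal d\<close>
    by (intro nn_integral_mono_AE) (auto elim!: eventually_mono simp: indicator_def)
  also have "\<dots> = ennreal d * emeasure ?Q A" by (simp add: nn_integral_cmult)
  finally show ?thesis .
qed

text \<open>Conversely, bounds on all past events bound the conditional delay almost everywhere, as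
  the exceptional set is itself a past event.\<close>

lemma lorden_delay_leI:
  assumes pol: "censoring_policy M P X \<Psi>" and st: "info_stopping_time M P X \<Psi> T"
    and d: "\<And>\<nu> A. 1 \<le> \<nu> \<Longrightarrow> A \<in> sets (IA \<Psi> (\<nu> - 1)) \<Longrightarrow>
      (\<integral>\<^sup>+\<omega>. indicator A \<omega> * ennreal_of_enat (T \<omega> + 1 - enat \<nu>) \<partial>P (enat \<nu>)) \<le> ennreal d * emeasure (P (enat \<nu>)) A"
  shows "lorden_delay M P X T \<Psi> \<le> ennreal d"
  unfolding lorden_delay_def
proof (rule SUP_least)
  fix \<nu> :: nat assume "\<nu> \<in> {1..}"
  then have \<nu>: "1 \<le> \<nu>" by simp
  let ?Q = "P (enat \<nu>)" and ?F = "IA \<Psi> (\<nu> - 1)"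
  have \<nu>': "1 \<le> enat \<nu>" using \<nu> by (simp add: one_enat_def)
  interpret prob_space ?Q using \<nu>' by (rule prob)
  interpret finite_measure_subalgebra ?Q ?F
    by (intro finite_measure_subalgebra.intro finite_measure_axioms finite_measure_subalgebra_axioms.intro subalgebra_IA pol \<nu>')
  let ?f = "\<lambda>\<omega>. ennreal_of_enat (T \<omega> + 1 - enat \<nu>)"
  note f = measurable_delay[OF pol st \<nu>]
  have "AE \<omega> in ?Q. nn_cond_exp ?Q ?F ?f \<omega> \<le> ennreal d"
  proof (rule AE_le_of_set_nn_integral_le)
    fix A assume A: "A \<in> sets ?F"
    have "(\<integral>\<^sup>+\<omega>. indicator A \<omega> * nn_cond_exp ?Q ?F ?f \<omega> \<partial>?Q) = (\<integral>\<^sup>+\<omega>. indicator A \<omega> * ?f \<omega> \<partial>?Q)"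
      using A f by (intro nn_cond_exp_intg) auto
    then show "(\<integral>\<^sup>+\<omega>. indicator A \<omega> * nn_cond_exp ?Q ?F ?f \<omega> \<partial>?Q) \<le> ennreal d * emeasure ?Q A"
      using d[OF \<nu> A] by simp
  qed (use finite_measure_axioms subalg in auto)
  then show "esssup ?Q (nn_cond_exp ?Q ?F ?f) \<le> ennreal d"
    by (intro esssup_I borel_measurable_nn_cond_exp2)
qed

text \<open>The nonnegative factorization is applied to the positive and negative parts of
  \<open>h\<close>, both of finite integral.\<close>

lemma integral_indep:
  assumes \<nu>: "1 \<le> \<nu>" and n: "\<nu> \<le> Suc n" and A: "A \<in> sets (G n)" and h: "integrable W1 h"
  shows "integrable (P (enat \<nu>)) (\<lambda>\<omega>. indicator A \<omega> * h (V (Suc n) \<omega>))"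
    and "(\<integral>\<omega>. indicator A \<omega> * h (V (Suc n) \<omega>) \<partial>P (enat \<nu>)) = measure (P (enat \<nu>)) A * (\<integral>v. h v \<partial>W1)"
proof -
  let ?Q = "P (enat \<nu>)"
  have \<nu>': "1 \<le> enat \<nu>" using \<nu> by (simp add: one_enat_def)
  interpret prob_space ?Q using \<nu>' by (rule prob)
  have AQ[measurable]: "A \<in> sets ?Q" using A sets_G_subset[OF \<nu>'] by blast
  have hm[measurable]: "h \<in> borel_measurable BM" 
    using borel_measurable_integrable[OF h] unfolding measurable_cong_sets[OF sets_W(2) refl] .
  have Vm: "V (Suc n) \<in> measurable ?Q BM" using \<nu>' by (intro measurable_V) auto
  have hV[measurable]: "(\<lambda>\<omega>. h (V (Suc n) \<omega>)) \<in> borel_measurable ?Q"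
    using Vm hm by (rule measurable_compose)
  have nlt: "\<not> Suc n < \<nu>" using n by simp
  have nn: "(\<integral>\<^sup>+\<omega>. ennreal (indicator A \<omega> * g (V (Suc n) \<omega>)) \<partial>?Q) = emeasure ?Q A * (\<integral>\<^sup>+v. ennreal (g v) \<partial>W1)"
    if g[measurable]: "g \<in> borel_measurable BM" for g :: "(nat \<Rightarrow> real) \<Rightarrow> real"
  proof -
    define F where "F = (\<lambda>(\<omega>, v). indicator A \<omega> * ennreal (g v) :: ennreal)"
    note [measurable] = A
    have F: "F \<in> borel_measurable (G n \<Otimes>\<^sub>M BM)" unfolding F_def by measurable
    have gW: "(\<lambda>v. ennreal (g v)) \<in> borel_measurable W1"
      unfolding measurable_cong_sets[OF sets_W(2) refl] by measurable
    have "(\<integral>\<^sup>+\<omega>. ennreal (indicator A \<omega> * g (V (Suc n) \<omega>)) \<partial>?Q) = (\<integral>\<^sup>+\<omega>. F (\<omega>, V (Suc n) \<omega>) \<partial>?Q)"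
      by (intro nn_integral_cong) (auto simp: F_def indicator_def)
    also have "\<dots> = (\<integral>\<^sup>+\<omega>. (\<integral>\<^sup>+v. F (\<omega>, v) \<partial>W1) \<partial>?Q)"
      using nn_integral_indep[OF \<nu>' _ F, of "Suc n"] nlt by simp
    also have "\<dots> = (\<integral>\<^sup>+\<omega>. indicator A \<omega> * (\<integral>\<^sup>+v. ennreal (g v) \<partial>W1) \<partial>?Q)"
      unfolding F_def using gW by (simp add: nn_integral_cmult)
    also have "\<dots> = emeasure ?Q A * (\<integral>\<^sup>+v. ennreal (g v) \<partial>W1)"
      by (simp add: nn_integral_multc)
    finally show ?thesis .
  qed
  have fin: "(\<integral>\<^sup>+v. ennreal (h v) \<partial>W1) \<noteq> \<infinity>" "(\<integral>\<^sup>+v. ennreal (- h v) \<partial>W1) \<noteq> \<infinity>"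
    using h unfolding real_integrable_def by auto
  have p: "(\<integral>\<^sup>+\<omega>. ennreal (indicator A \<omega> * h (V (Suc n) \<omega>)) \<partial>?Q) = emeasure ?Q A * (\<integral>\<^sup>+v. ennreal (h v) \<partial>W1)"
    by (rule nn) measurable
  have q: "(\<integral>\<^sup>+\<omega>. ennreal (- (indicator A \<omega> * h (V (Suc n) \<omega>))) \<partial>?Q) = emeasure ?Q A * (\<integral>\<^sup>+v. ennreal (- h v) \<partial>W1)"
    using nn[OF borel_measurable_uminus[OF hm]] by simp
  show int: "integrable ?Q (\<lambda>\<omega>. indicator A \<omega> * h (V (Suc n) \<omega>))"
    unfolding real_integrable_def p q using fin
    by (auto simp: ennreal_mult_eq_top_iff emeasure_eq_measure)
  show "(\<integral>\<omega>. indicator A \<omega> * h (V (Suc n) \<omega>) \<partial>?Q) = measure ?Q A * (\<integral>v. h v \<partial>W1)"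
    unfolding real_lebesgue_integral_def[OF int] real_lebesgue_integral_def[OF h] p q
    by (simp add: enn2real_mult right_diff_distrib emeasure_eq_measure)
qed

lemma arl_eq_suminf:
  assumes pol: "censoring_policy M P X \<Psi>" and st: "info_stopping_time M P X \<Psi> T"
  shows "arl P T = (\<Sum>i. emeasure (P \<infinity>) (running T (Suc i)))"
proof -
  have [measurable]: "running T (Suc i) \<in> sets (P \<infinity>)" for i
    using running_IA[OF st, of "Suc i"] subalgebra_IA[OF pol, of \<infinity> i] by (auto simp: subalgebra_def)
  have "arl P T = (\<integral>\<^sup>+\<omega>. (\<Sum>i. indicator (running T (Suc i)) \<omega>) \<partial>P \<infinity>)"
    unfolding arl_def
    by (intro nn_integral_cong) (simp add: ennreal_of_enat_eq_suminf running_def indicator_def of_bool_def)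
  also have "\<dots> = (\<Sum>i. emeasure (P \<infinity>) (running T (Suc i)))"
    by (subst nn_integral_suminf) auto
  finally show ?thesis .
qed

section \<open>Lower bound on the delay\<close>

text \<open>If every window failed, summing
  \<open>2 * w * p i \<le> \<zeta> * (p i - p (i + w))\<close> over \<open>i\<close> would bound the
  mean time to alarm by \<open>\<zeta> / 2\<close>; the factor \<open>2\<close> makes this a
  contradiction.\<close>

lemma exists_window:
  fixes \<zeta> :: real and w :: nat
  assumes pol: "censoring_policy M P X \<Psi>" and st: "info_stopping_time M P X \<Psi> T"
    and \<zeta>: "0 < \<zeta>" "ennreal \<zeta> \<le> arl P T"
  obtains \<nu> where "1 \<le> \<nu>" "0 < measure (P \<infinity>) (running T \<nu>)"
    "\<zeta> * (measure (P \<infinity>) (running T \<nu>) - measure (P \<infinity>) (running T (\<nu> + w)))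
      \<le> 2 * real w * measure (P \<infinity>) (running T \<nu>)"
proof (rule ccontr)
  assume no: "\<not> thesis"
  interpret prob_space "P \<infinity>" by (rule prob) simp
  define p where "p i = measure (P \<infinity>) (running T (Suc i))" for i
  have p: "0 \<le> p i" "p i \<le> 1" for i by (auto simp: p_def)
  have *: "2 * real w * p i \<le> \<zeta> * (p i - p (i + w))" for i
  proof (cases "p i = 0")
    case True
    have "p (i + w) \<le> p i"
      unfolding p_def using running_IA[OF st, of "Suc i"] subalgebra_IA[OF pol, of \<infinity> i]
      by (intro finite_measure_mono running_mono) (auto simp: subalgebra_def)
    then have "p (i + w) = 0" using p(1)[of "i + w"] True by linarith
    with True show ?thesis by simp
  next
    case False
    then have "0 < p i" using p(1)[of i] by linarith
    show ?thesis
    proof (rule ccontr)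
      assume "\<not> ?thesis"
      then have thesis using that[of "Suc i"] \<open>0 < p i\<close> by (simp add: p_def)
      with no show False ..
    qed
  qed
  \<comment> \<open>The shifted sum cancels all but at most the first \<open>w\<close> terms, each
    at most \<open>1\<close>.\<close>
  have tele: "(\<Sum>i<n. p i - p (i + w)) \<le> real w" for n
  proof -
    have "(\<Sum>i<n. p (i + w)) = (\<Sum>i\<in>{w..<n + w}. p i)"
      by (simp add: atLeast0LessThan[symmetric] sum.shift_bounds_nat_ivl[symmetric])
    moreover have "(\<Sum>i<n. p i) \<le> (\<Sum>i<n + w. p i)"
      using p by (intro sum_mono2) auto
    moreover have "(\<Sum>i<n + w. p i) = (\<Sum>i<w. p i) + (\<Sum>i\<in>{w..<n + w}. p i)"
      using sum.atLeastLessThan_concat[of 0 w "n + w" p] by (simp add: atLeast0LessThan)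
    moreover have "(\<Sum>i<w. p i) \<le> (\<Sum>i<w. 1)" using p by (intro sum_mono) auto
    ultimately show ?thesis by (simp add: sum_subtractf)
  qed
  show False
  proof (cases "w = 0")
    case True
    \<comment> \<open>For an empty window the inequality is trivial and only a time of positive
      survival probability is needed; it exists since the mean time is not \<open>0\<close>.\<close>
    obtain i where "0 < p i"
    proof (rule ccontr)
      assume "\<not> thesis"
      then have "p i = 0" for i using p(1)[of i] that[of i] by linarith
      then have "arl P T = 0"
        unfolding arl_eq_suminf[OF pol st] by (simp add: emeasure_eq_measure p_def)
      then show False using \<zeta> by simp
    qed
    then show False using no that[of "Suc i"] True by (simp add: p_def)
  next
    case False
    have "2 * real w * (\<Sum>i<n. p i) \<le> \<zeta> * real w" for n
    proof -
      have "2 * real w * (\<Sum>i<n. p i) = (\<Sum>i<n. 2 * real w * p i)" by (simp add: sum_distrib_left)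
      also have "\<dots> \<le> (\<Sum>i<n. \<zeta> * (p i - p (i + w)))" by (intro sum_mono *)
      also have "\<dots> = \<zeta> * (\<Sum>i<n. p i - p (i + w))" by (simp add: sum_distrib_left)
      also have "\<dots> \<le> \<zeta> * real w" using \<zeta> tele by (intro mult_left_mono) auto
      finally show ?thesis .
    qed
    then have half: "(\<Sum>i<n. p i) \<le> \<zeta> / 2" for n
      using False by (simp add: field_simps)
    have "arl P T \<le> ennreal (\<zeta> / 2)"
      unfolding arl_eq_suminf[OF pol st] suminf_eq_SUP
    proof (rule SUP_least)
      fix n
      have "(\<Sum>i<n. emeasure (P \<infinity>) (running T (Suc i))) = ennreal (\<Sum>i<n. p i)"
        by (simp add: emeasure_eq_measure sum_ennreal p_def)
      also have "\<dots> \<le> ennreal (\<zeta> / 2)" by (intro ennreal_leI half)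
      finally show "(\<Sum>i<n. emeasure (P \<infinity>) (running T (Suc i))) \<le> ennreal (\<zeta> / 2)" .
    qed
    with \<zeta>(2) have "ennreal \<zeta> \<le> ennreal (\<zeta> / 2)" by (rule order_trans)
    then show False using \<zeta>(1) by simp
  qed
qed

text \<open>
  With \<open>Z\<close> the likelihood ratio of the window \<open>\<nu>, \<dots>, \<nu> + w - 1\<close> up to the stopping time, the
  bound comes from integrating \<open>- ln Z \<le> c / Z - 1 - ln c\<close> on the event that the procedure stops
  in the window, and \<open>- ln Z \<le> 1 / Z - 1\<close> on the event that it does not; Wald's identity
  evaluates the mean of \<open>ln Z\<close>, and a change of measure that of \<open>1 / Z\<close>.
\<close>

lemma window_information:
  assumes pol: "censoring_policy M P X \<Psi>" and st: "info_stopping_time M P X \<Psi> T"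
    and \<nu>: "1 \<le> \<nu>" and c: "1 \<le> c"
  defines "p \<equiv> \<lambda>n. measure (P \<infinity>) (running T n)" and "q \<equiv> \<lambda>n. measure (P (enat \<nu>)) (running T n)"
  shows "p \<nu> = q \<nu>"
    and "ln c * (q \<nu> - q (\<nu> + w)) + q \<nu> - c * (p \<nu> - p (\<nu> + w)) - p (\<nu> + w) \<le> Isum * (\<Sum>k\<in>{\<nu>..<\<nu> + w}. q k)"
proof -
  let ?Q = "P (enat \<nu>)"
  have \<nu>': "1 \<le> enat \<nu>" using \<nu> by (simp add: one_enat_def)
  interpret Q: prob_space ?Q using \<nu>' by (rule prob)
  interpret P: prob_space "P \<infinity>" by (rule prob) simp
  have runG: "running T (Suc n) \<in> sets (G n)" for n
    using sets_IA_G[OF pol running_IA[OF st, of "Suc n"]] by simp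
  have subG: "A \<in> sets ?Q" "A \<in> sets (P \<infinity>)" if "A \<in> sets (G n)" for A n
    using that sets_G_subset[OF \<nu>', of n] sets_G_subset[of \<infinity> n] by auto
  have run[measurable]: "running T n \<in> sets ?Q" "running T n \<in> sets (P \<infinity>)" if "1 \<le> n" for n
    using subG[OF runG[of "n - 1"]] that by auto
  \<comment> \<open>This is the density on \<open>G n\<close> of the law without change with respect
    to the law with change at \<open>\<nu>\<close>, that is, the reciprocal of the likelihood ratio
    described above.\<close>
  define Z where "Z n \<omega> = exp (- (\<Sum>k=\<nu>..n. llr (V k \<omega>)))" for n \<omega>
  have Vm[measurable]: "(\<lambda>\<omega>. llr (V k \<omega>)) \<in> borel_measurable ?Q" if "1 \<le> k" for k
    using measurable_compose[OF measurable_V[OF \<nu>' that] measurable_llr] .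
  have Zm[measurable]: "Z n \<in> borel_measurable ?Q" for n
  proof -
    have [measurable]: "(\<lambda>\<omega>. \<Sum>k=\<nu>..n. llr (V k \<omega>)) \<in> borel_measurable ?Q"
      using \<nu> by (intro borel_measurable_sum Vm) auto
    show ?thesis unfolding Z_def by measurable
  qed
  have Z0 [simp]: "0 \<le> Z n \<omega>" for n \<omega> by (simp add: Z_def)
  have com: "integrable ?Q (\<lambda>\<omega>. indicator A \<omega> * Z n \<omega>)" "(\<integral>\<omega>. indicator A \<omega> * Z n \<omega> \<partial>?Q) = measure (P \<infinity>) A"
    if A: "A \<in> sets (G n)" for A n
  proof -
    have [measurable]: "A \<in> sets ?Q" using subG[OF A] by simp
    have eq: "(\<integral>\<^sup>+\<omega>. ennreal (indicator A \<omega> * Z n \<omega>) \<partial>?Q) = ennreal (measure (P \<infinity>) A)"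
      unfolding P.emeasure_eq_measure[symmetric] change_of_measure[OF \<nu> A] Z_def
      by (intro nn_integral_cong) (auto simp: indicator_def)
    then show i: "integrable ?Q (\<lambda>\<omega>. indicator A \<omega> * Z n \<omega>)"
      by (intro integrableI_nonneg) auto
    show "(\<integral>\<omega>. indicator A \<omega> * Z n \<omega> \<partial>?Q) = measure (P \<infinity>) A"
      using eq nn_integral_eq_integral[OF i] by simp
  qed
  \<comment> \<open>Up to time \<open>\<nu> - 1\<close> the product of ratios is empty, so the two
    laws agree on past events.\<close>
  have "(\<integral>\<omega>. indicator (running T \<nu>) \<omega> * Z (\<nu> - 1) \<omega> \<partial>?Q) = q \<nu>"
    using run[of \<nu>] \<nu> by (simp add: Z_def q_def)
  then show pq: "p \<nu> = q \<nu>"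
    using com(2)[of "running T \<nu>" "\<nu> - 1"] runG[of "\<nu> - 1"] \<nu> by (simp add: p_def)
  define stop where "stop j = running T j - running T (Suc j)" for j
  have stopG: "stop j \<in> sets (G j)" if "\<nu> \<le> j" for j
  proof -
    have "running T (Suc (j - 1)) \<in> sets (G j)"
      by (rule sets_G_mono[OF _ runG]) simp
    then show ?thesis using runG[of j] that \<nu> by (auto simp: stop_def)
  qed
  have stop_mass: "measure (P \<infinity>) (stop j) = p j - p (Suc j)" if "\<nu> \<le> j" for j
    unfolding stop_def p_def using that \<nu> by (intro P.finite_measure_Diff run running_mono) auto
  define t where "t j \<omega> = indicator (stop j) \<omega> * Z j \<omega>" for j \<omega>
  define r where "r \<omega> = indicator (running T (\<nu> + w)) \<omega> * Z (\<nu> + w - 1) \<omega>" for \<omega>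
  \<comment> \<open>\<open>H\<close> collects the right-hand sides of the pointwise bounds: the
    density at the alarm, weighted by \<open>c\<close>, for alarms in the window, and the density at
    its end otherwise.\<close>
  define H where "H \<omega> = c * (\<Sum>j\<in>{\<nu>..<\<nu> + w}. t j \<omega>) + r \<omega>" for \<omega>
  have t: "integrable ?Q (t j)" "(\<integral>\<omega>. t j \<omega> \<partial>?Q) = p j - p (Suc j)" if "\<nu> \<le> j" for j
    unfolding t_def using com[OF stopG[OF that]] stop_mass[OF that] by auto
  have runw: "running T (\<nu> + w) \<in> sets (G (\<nu> + w - 1))" using runG[of "\<nu> + w - 1"] \<nu> by simp
  have r: "integrable ?Q r" "(\<integral>\<omega>. r \<omega> \<partial>?Q) = p (\<nu> + w)"
    unfolding r_def p_def using com[OF runw] by auto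
  have Hint: "integrable ?Q H"
    unfolding H_def
    by (intro Bochner_Integration.integrable_add integrable_mult_right Bochner_Integration.integrable_sum t(1) r(1)) auto
  have "(\<integral>\<omega>. H \<omega> \<partial>?Q) = c * (\<Sum>j\<in>{\<nu>..<\<nu> + w}. p j - p (Suc j)) + p (\<nu> + w)"
  proof -
    have "integrable ?Q (\<lambda>\<omega>. c * (\<Sum>j\<in>{\<nu>..<\<nu> + w}. t j \<omega>))"
      by (intro integrable_mult_right Bochner_Integration.integrable_sum t(1)) auto
    then have "(\<integral>\<omega>. H \<omega> \<partial>?Q) = (\<integral>\<omega>. c * (\<Sum>j\<in>{\<nu>..<\<nu> + w}. t j \<omega>) \<partial>?Q) + (\<integral>\<omega>. r \<omega> \<partial>?Q)"
      unfolding H_def using r(1) by (rule Bochner_Integration.integral_add)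
    also have "(\<integral>\<omega>. c * (\<Sum>j\<in>{\<nu>..<\<nu> + w}. t j \<omega>) \<partial>?Q) = c * (\<Sum>j\<in>{\<nu>..<\<nu> + w}. \<integral>\<omega>. t j \<omega> \<partial>?Q)"
      using t(1) by (subst integral_mult_right_zero, subst Bochner_Integration.integral_sum) auto
    also have "(\<Sum>j\<in>{\<nu>..<\<nu> + w}. \<integral>\<omega>. t j \<omega> \<partial>?Q) = (\<Sum>j\<in>{\<nu>..<\<nu> + w}. p j - p (Suc j))"
      by (intro sum.cong refl t(2)) auto
    finally show ?thesis unfolding r(2) .
  qed
  also have "(\<Sum>j\<in>{\<nu>..<\<nu> + w}. p j - p (Suc j)) = p \<nu> - p (\<nu> + w)"
    by (induction w) auto
  finally have HI: "(\<integral>\<omega>. H \<omega> \<partial>?Q) = c * (p \<nu> - p (\<nu> + w)) + p (\<nu> + w)" .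
  define l where "l k \<omega> = indicator (running T k) \<omega> * llr (V k \<omega>)" for k \<omega>
  \<comment> \<open>The log likelihood ratio stopped at the alarm or at the end of the window. Its
    terms carry predictable indicators, so each mean factorizes.\<close>
  define W where "W \<omega> = (\<Sum>k\<in>{\<nu>..<\<nu> + w}. l k \<omega>)" for \<omega>
  have l: "integrable ?Q (l k)" "(\<integral>\<omega>. l k \<omega> \<partial>?Q) = q k * Isum" if "\<nu> \<le> k" for k
    unfolding l_def using integral_indep[OF \<nu> _ runG[of "k - 1"] llr_mean(1)] that \<nu> by (auto simp: q_def llr_mean(2))
  have Wint: "integrable ?Q W" unfolding W_def by (intro Bochner_Integration.integrable_sum l(1)) auto
  have WI: "(\<integral>\<omega>. W \<omega> \<partial>?Q) = Isum * (\<Sum>k\<in>{\<nu>..<\<nu> + w}. q k)"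
  proof -
    have "(\<integral>\<omega>. W \<omega> \<partial>?Q) = (\<Sum>k\<in>{\<nu>..<\<nu> + w}. \<integral>\<omega>. l k \<omega> \<partial>?Q)"
      unfolding W_def using l(1) by (subst Bochner_Integration.integral_sum) auto
    also have "\<dots> = (\<Sum>k\<in>{\<nu>..<\<nu> + w}. q k * Isum)"
      by (intro sum.cong refl l(2)) auto
    finally show ?thesis by (simp add: sum_distrib_left mult.commute)
  qed
  have pt: "- W \<omega> \<le> H \<omega> - indicator (running T \<nu>) \<omega> - ln c * indicator (running T \<nu> - running T (\<nu> + w)) \<omega>" for \<omega>
  proof -
    have mono: "\<omega> \<in> running T k" if "\<omega> \<in> running T k'" "k \<le> k'" for k k'
      using running_mono[OF that(2)] that(1) by blast
    have nn: "0 \<le> H \<omega>" using c by (auto simp: H_def t_def r_def intro!: add_nonneg_nonneg mult_nonneg_nonneg sum_nonneg)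
    consider "\<omega> \<notin> running T \<nu>" | "\<omega> \<in> running T (\<nu> + w)" | "\<omega> \<in> running T \<nu>" "\<omega> \<notin> running T (\<nu> + w)" by blast
    then show ?thesis
    proof cases
      case 1
      then have "W \<omega> = 0"
        unfolding W_def using mono by (intro sum.neutral) (auto simp: l_def indicator_def)
      then show ?thesis using 1 nn by (simp add: indicator_def)
    next
      case 2
      then have run_k: "\<omega> \<in> running T k" if "k \<le> \<nu> + w" for k using mono that by blast
      have "W \<omega> = (\<Sum>k\<in>{\<nu>..<\<nu> + w}. llr (V k \<omega>))"
        unfolding W_def using run_k by (intro sum.cong) (auto simp: l_def indicator_def)
      also have "{\<nu>..<\<nu> + w} = {\<nu>..\<nu> + w - 1}" using \<nu> by auto
      finally have Z: "Z (\<nu> + w - 1) \<omega> = exp (- W \<omega>)" by (simp add: Z_def)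
      have "\<omega> \<notin> stop j" if "j < \<nu> + w" for j using run_k[of "Suc j"] that by (simp add: stop_def)
      then have "(\<Sum>j\<in>{\<nu>..<\<nu> + w}. t j \<omega>) = 0"
        by (intro sum.neutral) (auto simp: t_def indicator_def)
      then have "H \<omega> = exp (- W \<omega>)" using 2 by (simp add: H_def r_def Z[unfolded One_nat_def])
      then show ?thesis using 2 run_k[of \<nu>] exp_ge_add_one_self[of "- W \<omega>"] by simp
    next
      case 3
      have fin: "\<exists>j\<in>{\<nu>..<\<nu> + w}. \<omega> \<in> stop j"
        using 3
      proof (induction w)
        case (Suc w)
        show ?case
        proof (cases "\<omega> \<in> running T (\<nu> + w)")
          case True
          then show ?thesis using Suc.prems by (intro bexI[of _ "\<nu> + w"]) (auto simp: stop_def)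
        next
          case False
          then obtain j where "j \<in> {\<nu>..<\<nu> + w}" "\<omega> \<in> stop j" using Suc by blast
          then show ?thesis by (intro bexI[of _ j]) auto
        qed
      qed simp
      then obtain j where j: "\<nu> \<le> j" "j < \<nu> + w" "\<omega> \<in> stop j" by auto
      have uniq: "\<omega> \<notin> stop i" if "i \<noteq> j" for i
        using that j(3) mono[of j "Suc i"] mono[of i "Suc j"] by (auto simp: stop_def linorder_neq_iff Suc_le_eq dest: mono[of "Suc i" j] mono[of "Suc j" i])
      have "(\<Sum>i\<in>{\<nu>..<\<nu> + w}. t i \<omega>) = (\<Sum>i\<in>{j}. t i \<omega>)"
        using j uniq by (intro sum.mono_neutral_right) (auto simp: t_def indicator_def)
      then have H: "H \<omega> = c * Z j \<omega>" using 3 j by (simp add: H_def t_def r_def)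
      have after: "\<omega> \<notin> running T i" if "j < i" for i
        using j(3) mono[of i "Suc j"] that by (auto simp: stop_def)
      have "W \<omega> = (\<Sum>k\<in>{\<nu>..j}. llr (V k \<omega>))"
        unfolding W_def
      proof (rule sum.mono_neutral_cong_right)
        show "\<forall>i\<in>{\<nu>..<\<nu> + w} - {\<nu>..j}. l i \<omega> = 0"
          using after by (auto simp: l_def)
        show "l k \<omega> = llr (V k \<omega>)" if "k \<in> {\<nu>..j}" for k
          using j(3) mono[of j k] that by (auto simp: l_def stop_def)
      qed (use j in auto)
      then have Z: "Z j \<omega> = exp (- W \<omega>)" by (simp add: Z_def)
      \<comment> \<open>The tangent bound for the exponential is taken at
        \<open>ln c - W \<omega>\<close>; paths that outlast the window use
        \<open>- W \<omega>\<close> instead.\<close>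
      have "1 + (ln c - W \<omega>) \<le> exp (ln c - W \<omega>)" by (rule exp_ge_add_one_self)
      also have "\<dots> = c * exp (- W \<omega>)" using c by (simp add: exp_diff exp_minus field_simps)
      finally show ?thesis using 3 by (simp add: H Z)
    qed
  qed
  have [measurable]: "running T \<nu> \<in> sets ?Q" "running T (\<nu> + w) \<in> sets ?Q" using run \<nu> by auto
  have "(\<integral>\<omega>. - W \<omega> \<partial>?Q)
      \<le> (\<integral>\<omega>. H \<omega> - indicator (running T \<nu>) \<omega> - ln c * indicator (running T \<nu> - running T (\<nu> + w)) \<omega> \<partial>?Q)"
    using Wint Hint pt by (intro integral_mono) (auto simp: Q.emeasure_eq_measure)
  also have "\<dots> = (\<integral>\<omega>. H \<omega> \<partial>?Q) - q \<nu> - ln c * measure ?Q (running T \<nu> - running T (\<nu> + w))"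
    using Hint by (simp add: Q.emeasure_eq_measure q_def)
  also have "measure ?Q (running T \<nu> - running T (\<nu> + w)) = q \<nu> - q (\<nu> + w)"
    unfolding q_def by (intro Q.finite_measure_Diff running_mono) auto
  finally show "ln c * (q \<nu> - q (\<nu> + w)) + q \<nu> - c * (p \<nu> - p (\<nu> + w)) - p (\<nu> + w) \<le> Isum * (\<Sum>k\<in>{\<nu>..<\<nu> + w}. q k)"
    using Wint by (simp add: HI WI)
qed

text \<open>The delay bound \<open>d\<close> enters twice: it bounds the divergence accumulated in
  the window and, by Markov's inequality, the mass that outlasts it. The choice of window and
  \<open>2 * w * c \<le> \<zeta>\<close> keep the false alarm term below \<open>p \<nu>\<close>,
  which is where the loss of \<open>1\<close> comes from. Division by the common mass
  \<open>q \<nu>\<close> concludes.\<close>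

lemma lorden_lower_bound:
  fixes w :: nat
  assumes pol: "censoring_policy M P X \<Psi>" and st: "info_stopping_time M P X \<Psi> T"
    and \<zeta>: "0 < \<zeta>" "ennreal \<zeta> \<le> arl P T" and w: "1 \<le> w" and c: "1 \<le> c" "2 * real w * c \<le> \<zeta>"
    and d: "0 \<le> d" "lorden_delay M P X T \<Psi> \<le> ennreal d"
  shows "ln c - 1 \<le> d * (Isum + ln c / real w)"
proof -
  obtain \<nu> where \<nu>: "1 \<le> \<nu>" and pos: "0 < measure (P \<infinity>) (running T \<nu>)"
    and win: "\<zeta> * (measure (P \<infinity>) (running T \<nu>) - measure (P \<infinity>) (running T (\<nu> + w)))
      \<le> 2 * real w * measure (P \<infinity>) (running T \<nu>)"
    using exists_window[OF pol st \<zeta>] by metis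
  let ?Q = "P (enat \<nu>)"
  have \<nu>': "1 \<le> enat \<nu>" using \<nu> by (simp add: one_enat_def)
  interpret Q: prob_space ?Q using \<nu>' by (rule prob)
  interpret P: prob_space "P \<infinity>" by (rule prob) simp
  define p where "p n = measure (P \<infinity>) (running T n)" for n
  define q where "q n = measure ?Q (running T n)" for n
  have run[measurable]: "running T n \<in> sets ?Q" "running T n \<in> sets (P \<infinity>)" if "1 \<le> n" for n
    using running_IA[OF st that] subalgebra_IA[OF pol \<nu>', of "n - 1"] subalgebra_IA[OF pol, of \<infinity> "n - 1"]
    by (auto simp: subalgebra_def)
  have pq: "p \<nu> = q \<nu>"
    and inf: "ln c * (q \<nu> - q (\<nu> + w)) + q \<nu> - c * (p \<nu> - p (\<nu> + w)) - p (\<nu> + w) \<le> Isum * (\<Sum>k\<in>{\<nu>..<\<nu> + w}. q k)"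
    unfolding p_def q_def using window_information[OF pol st \<nu> c(1)] by auto
  have pm: "p (\<nu> + w) \<le> p \<nu>" unfolding p_def using \<nu> by (intro P.finite_measure_mono running_mono run) auto
  have "2 * real w * (c * (p \<nu> - p (\<nu> + w))) \<le> \<zeta> * (p \<nu> - p (\<nu> + w))"
    using mult_right_mono[OF c(2), of "p \<nu> - p (\<nu> + w)"] pm by (simp add: mult.assoc)
  also have "\<dots> \<le> 2 * real w * p \<nu>" using win by (simp add: p_def)
  finally have cp: "c * (p \<nu> - p (\<nu> + w)) \<le> p \<nu>" using w by simp
  have "(\<Sum>k\<in>{\<nu>..<\<nu> + w}. q k) \<le> d * q \<nu>"
  proof -
    have sub: "running T k \<subseteq> running T \<nu>" if "\<nu> \<le> k" for k using that by (rule running_mono)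
    have "ennreal (\<Sum>k\<in>{\<nu>..<\<nu> + w}. q k) = (\<Sum>k\<in>{\<nu>..<\<nu> + w}. emeasure ?Q (running T k))"
      by (simp add: q_def Q.emeasure_eq_measure sum_ennreal)
    also have "\<dots> = (\<Sum>i<w. emeasure ?Q (running T (\<nu> + i)))"
      by (rule sum.reindex_bij_witness[of _ "\<lambda>i. \<nu> + i" "\<lambda>k. k - \<nu>"]) auto
    also have "\<dots> = (\<integral>\<^sup>+\<omega>. (\<Sum>i<w. indicator (running T (\<nu> + i)) \<omega>) \<partial>?Q)"
      using \<nu> by (subst nn_integral_sum) auto
    also have "\<dots> \<le> (\<integral>\<^sup>+\<omega>. indicator (running T \<nu>) \<omega> * ennreal_of_enat (T \<omega> + 1 - enat \<nu>) \<partial>?Q)"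
    proof (rule nn_integral_mono)
      fix \<omega> assume "\<omega> \<in> space ?Q"
      then have sp: "\<omega> \<in> space (P \<infinity>)" using space_P[OF \<nu>'] by simp
      show "(\<Sum>i<w. indicator (running T (\<nu> + i)) \<omega>) \<le> indicator (running T \<nu>) \<omega> * ennreal_of_enat (T \<omega> + 1 - enat \<nu>)"
      proof (cases "\<omega> \<in> running T \<nu>")
        case True
        then show ?thesis
          unfolding delay_eq_suminf[OF sp] by (simp add: sum_le_suminf)
      next
        case False
        then have "\<omega> \<notin> running T (\<nu> + i)" for i using sub[of "\<nu> + i"] by auto
        then have "(\<Sum>i<w. indicator (running T (\<nu> + i)) \<omega> :: ennreal) = 0"
          by (intro sum.neutral) (auto simp: indicator_def)
        then show ?thesis by simp
      qed
    qed
    also have "\<dots> \<le> ennreal d * emeasure ?Q (running T \<nu>)"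
      by (rule lorden_delay_ge[OF pol st d(2) \<nu> running_IA[OF st \<nu>]])
    also have "\<dots> = ennreal (d * q \<nu>)" using d(1) by (simp add: q_def Q.emeasure_eq_measure ennreal_mult)
    finally show ?thesis using d(1) by (simp add: q_def)
  qed
  note dq = this
  have "real w * q (\<nu> + w) \<le> (\<Sum>k\<in>{\<nu>..<\<nu> + w}. q k)"
  proof -
    have "(\<Sum>k\<in>{\<nu>..<\<nu> + w}. q (\<nu> + w)) \<le> (\<Sum>k\<in>{\<nu>..<\<nu> + w}. q k)"
      unfolding q_def using \<nu> by (intro sum_mono Q.finite_measure_mono running_mono run) auto
    then show ?thesis by simp
  qed
  then have qw: "q (\<nu> + w) \<le> d * q \<nu> / real w" using dq w by (simp add: field_simps)
  have I: "0 < Isum" by (rule llr_mean(3))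
  have "ln c * (q \<nu> - d * q \<nu> / real w) - q \<nu> \<le> ln c * (q \<nu> - q (\<nu> + w)) - q \<nu>"
    using qw c(1) by (intro diff_right_mono mult_left_mono) auto
  also have "\<dots> \<le> Isum * (\<Sum>k\<in>{\<nu>..<\<nu> + w}. q k)" using inf cp pm pq by linarith
  also have "\<dots> \<le> Isum * (d * q \<nu>)" using dq I by (intro mult_left_mono) auto
  finally have "q \<nu> * (ln c - 1) \<le> q \<nu> * (d * (Isum + ln c / real w))" by (simp add: field_simps)
  moreover have "0 < q \<nu>" using pos pq by (simp add: p_def)
  ultimately show ?thesis by simp
qed

text \<open>The point from which the bound holds is the same for all feasible pairs, so the bound
  passes to their infimum.\<close>

lemma feasible_delay_ge:
  assumes "y < 1"
  shows "\<forall>\<^sub>F \<zeta> in at_top. \<forall>(T, \<Psi>)\<in>feasible M P X \<epsilon> \<zeta>. ennreal (y * (ln \<zeta> / Isum)) \<le> lorden_delay M P X T \<Psi>"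
proof -
  define c where "c \<zeta> = \<zeta> / (2 * ((ln \<zeta>)\<^sup>2 + 1))" for \<zeta> :: real
  define l where "l \<zeta> = (ln (c \<zeta>) - 1) / (Isum + ln (c \<zeta>) / (ln \<zeta>)\<^sup>2)" for \<zeta>
  have I: "0 < Isum" by (rule llr_mean(3))
  have "((\<lambda>\<zeta>. l \<zeta> / (ln \<zeta> / Isum)) \<longlongrightarrow> 1) at_top"
    unfolding l_def c_def by (rule window_bound_asymptotics[OF I])
  then have ev: "\<forall>\<^sub>F \<zeta> in at_top. y < l \<zeta> / (ln \<zeta> / Isum)"
    using assms by (rule order_tendstoD)
  have "\<forall>\<^sub>F \<zeta> in at_top. 1 \<le> c \<zeta>" unfolding c_def by real_asymp
  moreover have "\<forall>\<^sub>F \<zeta> :: real in at_top. 1 \<le> ln \<zeta>" by real_asymp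
  ultimately show ?thesis
    using ev eventually_gt_at_top[of 0]
  proof eventually_elim
    case (elim \<zeta>)
    have "ennreal (y * (ln \<zeta> / Isum)) \<le> lorden_delay M P X T \<Psi>" if f: "(T, \<Psi>) \<in> feasible M P X \<epsilon> \<zeta>" for T \<Psi>
    proof (cases "lorden_delay M P X T \<Psi>")
      case (real d)
      \<comment> \<open>The summand \<open>1\<close> in the definition of \<open>c\<close> absorbs
        the rounding up of the window length.\<close>
      define w where "w = nat \<lceil>(ln \<zeta>)\<^sup>2\<rceil>"
      have ln1: "1 \<le> (ln \<zeta>)\<^sup>2" using elim by simp
      have w: "(ln \<zeta>)\<^sup>2 \<le> real w" "real w \<le> (ln \<zeta>)\<^sup>2 + 1"
        using ln1 unfolding w_def by linarith+
      have "2 * real w * c \<zeta> \<le> 2 * ((ln \<zeta>)\<^sup>2 + 1) * c \<zeta>"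
        using w elim by (intro mult_right_mono) auto
      also have "\<dots> = \<zeta>" using ln1 by (simp add: c_def)
      finally have wc: "2 * real w * c \<zeta> \<le> \<zeta>" .
      have w1: "1 \<le> w" using w ln1 by linarith
      have "ln (c \<zeta>) - 1 \<le> d * (Isum + ln (c \<zeta>) / real w)"
        using f real by (intro lorden_lower_bound[of \<Psi> T \<zeta> w "c \<zeta>" d] w1 wc) (auto simp: feasible_def elim)
      also have "\<dots> \<le> d * (Isum + ln (c \<zeta>) / (ln \<zeta>)\<^sup>2)"
        using w w1 elim real
        by (intro mult_left_mono add_left_mono divide_left_mono) (auto intro!: mult_pos_pos)
      finally have "l \<zeta> \<le> d"
        unfolding l_def using I ln1 elim
        by (subst pos_divide_le_eq) (auto intro!: add_pos_nonneg divide_nonneg_nonneg)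
      moreover have "y * (ln \<zeta> / Isum) \<le> l \<zeta>"
      proof -
        have "0 < ln \<zeta>" using elim by linarith
        then have "0 < ln \<zeta> / Isum" using I by (rule divide_pos_pos)
        from pos_less_divide_eq[OF this, of y "l \<zeta>"] elim show ?thesis by linarith
      qed
      ultimately show ?thesis using real by (simp add: ennreal_leI)
    qed simp
    then show ?case by auto
  qed
qed

end

section \<open>The CuSum-AC algorithm\<close>

locale ac_algorithm = ac_model M f0 f1 P X
  for M :: nat
    and f0 f1 :: "nat \<Rightarrow> real \<Rightarrow> real"
    and P :: "enat \<Rightarrow> 'a measure"
    and X :: "nat \<Rightarrow> nat \<Rightarrow> 'a \<Rightarrow> real" +
  fixes \<psi>s :: "nat \<Rightarrow> real \<Rightarrow> real \<Rightarrow> bool" and a1 :: real and \<epsilon>1 :: "nat \<Rightarrow> real"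
  assumes optimal: "optimal_censoring M f0 f1 P X \<psi>s"
    and a1_pos: "0 < a1"
    and rates: "\<epsilon>1 \<in> {1..M} \<rightarrow> {0<..1}"
begin

definition low_llr :: "(nat \<Rightarrow> real) \<Rightarrow> real" where "low_llr = clr (\<lambda>m. \<psi>s m (\<epsilon>1 m))"

abbreviation S :: "nat \<Rightarrow> 'a \<Rightarrow> real" where "S \<equiv> ac_stat M f0 f1 P X \<psi>s a1 \<epsilon>1"
abbreviation T :: "real \<Rightarrow> 'a \<Rightarrow> enat" where "T a \<equiv> ac_time M f0 f1 P X \<psi>s a1 \<epsilon>1 (ereal a)"

lemma rate_pos: "m \<in> {1..M} \<Longrightarrow> 0 < \<epsilon>1 m" "m \<in> {1..M} \<Longrightarrow> \<epsilon>1 m \<le> 1"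
  using rates by auto

lemma low_strategy:
  assumes "m \<in> {1..M}"
  shows "censoring_strategy (\<psi>s m (\<epsilon>1 m))" "0 < (\<integral>x. sensor_llr m (\<psi>s m (\<epsilon>1 m)) x \<partial>N1 m)"
  using optimal_strategy[OF optimal assms rate_pos[OF assms]] by auto

lemma full_strategy: "m \<in> {1..M} \<Longrightarrow> \<psi>s m 1 = (\<lambda>_. True)"
  using optimal unfolding optimal_censoring_def by blast

lemma low_llr_facts:
  "low_llr \<in> borel_measurable BM" "integrable W1 low_llr" "0 < (\<integral>v. low_llr v \<partial>W1)"
  "(\<integral>\<^sup>+v. ennreal (exp (low_llr v)) \<partial>W0) = 1"
  unfolding low_llr_def using low_strategy
  by (intro measurable_clr clr_mean_pos integral_exp_clr; simp)+

lemma llr_exp_integral: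
  "(\<integral>\<^sup>+v. ennreal (exp (llr v)) \<partial>W0) = 1" "(\<integral>\<^sup>+v. ennreal (exp (- llr v)) \<partial>W1) = 1"
  using integral_exp_clr[of "\<lambda>_ _. True"] by (simp_all add: clr_full censoring_strategy_def)

text \<open>The statistic becomes a Markov chain driven by independent vectors, the form that both
  the potential and the martingale argument require.\<close>

lemma ac_stat_Suc: "S (Suc k) \<omega> = regime_step a1 (S k \<omega>) (llr (V (Suc k) \<omega>)) (low_llr (V (Suc k) \<omega>))"
proof -
  have full: "(\<Sum>m=1..M. censored_llr f0 f1 P X m (\<psi>s m 1) (\<psi>s m 1 (X m (Suc k) \<omega>)) (X m (Suc k) \<omega>)) = llr (V (Suc k) \<omega>)"
    unfolding llr_def by (intro sum.cong refl) (simp add: full_strategy[unfolded One_nat_def] V_def censored_llr_def)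
  have low: "(\<Sum>m=1..M. censored_llr f0 f1 P X m (\<psi>s m (\<epsilon>1 m)) (\<psi>s m (\<epsilon>1 m) (X m (Suc k) \<omega>)) (X m (Suc k) \<omega>))
      = low_llr (V (Suc k) \<omega>)"
    unfolding low_llr_def clr_def by (intro sum.cong refl) (simp add: V_def sensor_llr_def)
  show ?thesis
    using full low by (cases "a1 \<le> S k \<omega>") (auto simp: Let_def regime_step_def min_def)
qed

declare ac_stat.simps(2) [simp del]

lemma ac_stat_nonneg: "0 \<le> S k \<omega>"
  using a1_pos by (cases k) (auto simp: ac_stat_Suc regime_step_def)

lemma measurable_regime_step [measurable]:
  assumes [measurable]: "f \<in> borel_measurable N" "g \<in> borel_measurable N" "h \<in> borel_measurable N"
  shows "(\<lambda>x. regime_step a1 (f x) (g x) (h x)) \<in> borel_measurable N"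
  unfolding regime_step_def by measurable

lemma measurable_S: "S k \<in> borel_measurable (G k)"
proof (induction k)
  case (Suc k)
  have [measurable]: "S k \<in> borel_measurable (G (Suc k))"
    by (rule measurable_G_mono[OF _ Suc]) simp
  have V: "V (Suc k) \<in> measurable (G (Suc k)) BM" by (rule measurable_V_G) auto
  have [measurable]: "(\<lambda>\<omega>. llr (V (Suc k) \<omega>)) \<in> borel_measurable (G (Suc k))"
    "(\<lambda>\<omega>. low_llr (V (Suc k) \<omega>)) \<in> borel_measurable (G (Suc k))"
    using measurable_compose[OF V measurable_llr] measurable_compose[OF V low_llr_facts(1)] by simp_all
  show ?case unfolding ac_stat_Suc[abs_def] by measurable
qed simp

text \<open>Alarms count from time \<open>1\<close> on, but \<open>k = 0\<close> may be included
  because the statistic starts at \<open>0 < a\<close>.\<close>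

lemma ac_time_gt_iff:
  assumes "0 < a" shows "enat (Suc n) \<le> T a \<omega> \<longleftrightarrow> (\<forall>k\<le>n. S k \<omega> < a)"
proof -
  have "enat (Suc n) \<le> T a \<omega> \<longleftrightarrow> (\<forall>k. 1 \<le> k \<and> a \<le> S k \<omega> \<longrightarrow> Suc n \<le> k)"
    unfolding ac_time_def by (auto simp: le_INF_iff)
  also have "\<dots> \<longleftrightarrow> (\<forall>k\<le>n. S k \<omega> < a)"
  proof safe
    fix k assume *: "\<forall>k. 1 \<le> k \<and> a \<le> S k \<omega> \<longrightarrow> Suc n \<le> k" "k \<le> n"
    show "S k \<omega> < a"
    proof (rule ccontr)
      assume "\<not> S k \<omega> < a"
      then have "a \<le> S k \<omega>" by simp
      moreover from this have "1 \<le> k" using assms by (cases k) auto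
      ultimately show False using *(1)[rule_format, of k] *(2) by simp
    qed
  next
    fix k assume "\<forall>k\<le>n. S k \<omega> < a" "1 \<le> k" "a \<le> S k \<omega>"
    then show "Suc n \<le> k" by (meson leI not_less_eq_eq order_less_irrefl order.strict_trans1)
  qed
  finally show ?thesis .
qed

text \<open>For \<open>a > 0\<close> this is \<open>running (T a) (Suc n)\<close>, phrased through
  the statistic so that it lies in \<open>G n\<close> without reference to the policy.\<close>

definition alive :: "real \<Rightarrow> nat \<Rightarrow> 'a set" where
  "alive a n = {\<omega> \<in> space (P \<infinity>). \<forall>k\<le>n. S k \<omega> < a}"

lemma alive_G: "alive a n \<in> sets (G n)"
proof -
  have m: "{\<omega> \<in> space (G n). S k \<omega> < a} \<in> sets (G n)" if "k \<in> {..n}" for k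
    using that
    by (intro borel_measurable_less measurable_G_mono[OF _ measurable_S] borel_measurable_const) simp
  have "{\<omega> \<in> space (G n). \<forall>k\<in>{..n}. S k \<omega> < a} \<in> sets (G n)"
    by (rule sets.sets_Collect_finite_All[OF m finite_atMost])
  moreover have "{\<omega> \<in> space (G n). \<forall>k\<in>{..n}. S k \<omega> < a} = alive a n"
    by (auto simp: alive_def)
  ultimately show ?thesis by simp
qed

lemma alive_sets: "1 \<le> \<nu> \<Longrightarrow> alive a n \<in> sets (P \<nu>)"
  using subsetD[OF sets_G_subset alive_G] .

lemma alive_Suc: "alive a (Suc n) = {\<omega> \<in> alive a n. S (Suc n) \<omega> < a}"
  by (auto simp: alive_def le_Suc_eq)

text \<open>A Foster-Lyapunov argument: each step after the change lowers the mean potential on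
  surviving paths by at least the survival probability. The sum of these probabilities is the delay,
  so it is at most the initial potential.\<close>

lemma delay_bound:
  assumes a: "a1 < a" and \<nu>: "1 \<le> \<nu>" and A: "A \<in> sets (G (\<nu> - 1))"
    and um[measurable]: "u \<in> borel_measurable borel"
    and uC: "\<And>s. 0 \<le> s \<Longrightarrow> u s \<le> C"
    and drift: "\<And>s. 0 \<le> s \<Longrightarrow> s < a \<Longrightarrow>
      (\<integral>\<^sup>+v. ennreal (u (regime_step a1 s (llr v) (low_llr v))) \<partial>W1) + 1 \<le> ennreal (u s)"
  shows "(\<integral>\<^sup>+\<omega>. indicator A \<omega> * ennreal_of_enat (T a \<omega> + 1 - enat \<nu>) \<partial>P (enat \<nu>))
    \<le> ennreal C * emeasure (P (enat \<nu>)) A"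
proof -
  let ?Q = "P (enat \<nu>)"
  have \<nu>': "1 \<le> enat \<nu>" using \<nu> by (simp add: one_enat_def)
  \<comment> \<open>The state at time \<open>\<nu> - 1\<close> is the last one formed before the
    change; every step from it onwards uses post-change observations.\<close>
  define n0 where "n0 = \<nu> - 1"
  have AG: "A \<in> sets (G n)" if "n0 \<le> n" for n using sets_G_mono A that unfolding n0_def by blast
  have AQ[measurable]: "A \<in> sets ?Q" using A sets_G_subset[OF \<nu>'] by blast
  have [measurable]: "alive a n \<in> sets ?Q" for n using alive_sets[OF \<nu>'] .
  have SQ[measurable]: "S n \<in> borel_measurable ?Q" for n
    using measurable_from_G[OF \<nu>' measurable_S] .
  define e where "e n = (\<integral>\<^sup>+\<omega>. indicator (A \<inter> alive a n) \<omega> * ennreal (u (S n \<omega>)) \<partial>?Q)" for n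
  have step: "emeasure ?Q (A \<inter> alive a n) + e (Suc n) \<le> e n" if n: "n0 \<le> n" for n
  proof -
    have E: "A \<inter> alive a n \<in> sets (G n)" using AG[OF n] alive_G by blast
    define F where "F = (\<lambda>(\<omega>, v). indicator (A \<inter> alive a n) \<omega> *
      ennreal (u (regime_step a1 (S n \<omega>) (llr v) (low_llr v))) :: ennreal)"
    have [measurable]: "S n \<in> borel_measurable (G n)" "A \<inter> alive a n \<in> sets (G n)" "low_llr \<in> borel_measurable BM"
      using measurable_S E low_llr_facts by auto
    have F: "F \<in> borel_measurable (G n \<Otimes>\<^sub>M BM)"
      unfolding F_def by measurable
    \<comment> \<open>Dropping the condition at time \<open>Suc n\<close> enlarges the integral and
      leaves an event known at time \<open>n\<close>.\<close>
    have "e (Suc n) \<le> (\<integral>\<^sup>+\<omega>. F (\<omega>, V (Suc n) \<omega>) \<partial>?Q)"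
      unfolding e_def F_def
      by (intro nn_integral_mono) (auto simp: ac_stat_Suc alive_Suc indicator_def)
    also have "\<dots> = (\<integral>\<^sup>+\<omega>. (\<integral>\<^sup>+v. F (\<omega>, v) \<partial>W1) \<partial>?Q)"
    proof -
      have "\<not> Suc n < \<nu>" using n \<nu> by (simp add: n0_def)
      then show ?thesis using nn_integral_indep[OF \<nu>' _ F, of "Suc n"] by simp
    qed
    finally have "emeasure ?Q (A \<inter> alive a n) + e (Suc n)
        \<le> (\<integral>\<^sup>+\<omega>. indicator (A \<inter> alive a n) \<omega> \<partial>?Q) + (\<integral>\<^sup>+\<omega>. (\<integral>\<^sup>+v. F (\<omega>, v) \<partial>W1) \<partial>?Q)"
      by (simp add: add_left_mono)
    also have "\<dots> = (\<integral>\<^sup>+\<omega>. indicator (A \<inter> alive a n) \<omega> + (\<integral>\<^sup>+v. F (\<omega>, v) \<partial>W1) \<partial>?Q)"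
    proof (rule nn_integral_add[symmetric])
      interpret W1: prob_space W1 by (rule prob_space_W)
      have "(\<lambda>\<omega>. \<integral>\<^sup>+v. F (\<omega>, v) \<partial>W1) \<in> borel_measurable (G n)"
        using F by (intro W1.borel_measurable_nn_integral_fst) (simp cong: measurable_cong_sets)
      then show "(\<lambda>\<omega>. \<integral>\<^sup>+v. F (\<omega>, v) \<partial>W1) \<in> borel_measurable ?Q"
        by (rule measurable_from_G[OF \<nu>'])
    qed measurable
    also have "\<dots> \<le> e n"
      unfolding e_def
    proof (rule nn_integral_mono)
      fix \<omega>
      show "indicator (A \<inter> alive a n) \<omega> + (\<integral>\<^sup>+v. F (\<omega>, v) \<partial>W1) \<le> indicator (A \<inter> alive a n) \<omega> * ennreal (u (S n \<omega>))"
      proof (cases "\<omega> \<in> A \<inter> alive a n")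
        case True
        then have "S n \<omega> < a" by (auto simp: alive_def)
        from drift[OF ac_stat_nonneg this] True show ?thesis
          by (simp add: F_def add.commute)
      qed (simp add: F_def)
    qed
    finally show ?thesis .
  qed
  have sum: "(\<Sum>i<k. emeasure ?Q (A \<inter> alive a (n0 + i))) + e (n0 + k) \<le> e n0" for k
  proof (induction k)
    case (Suc k)
    have "(\<Sum>i<Suc k. emeasure ?Q (A \<inter> alive a (n0 + i))) + e (n0 + Suc k)
        = (\<Sum>i<k. emeasure ?Q (A \<inter> alive a (n0 + i))) + (emeasure ?Q (A \<inter> alive a (n0 + k)) + e (Suc (n0 + k)))"
      by (simp add: add.assoc)
    also have "\<dots> \<le> (\<Sum>i<k. emeasure ?Q (A \<inter> alive a (n0 + i))) + e (n0 + k)"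
      by (intro add_left_mono step) simp
    finally show ?case using Suc by (rule order_trans)
  qed simp
  have "e n0 \<le> (\<integral>\<^sup>+\<omega>. ennreal C * indicator A \<omega> \<partial>?Q)"
    unfolding e_def
    by (intro nn_integral_mono) (auto simp: indicator_def intro!: ennreal_leI uC ac_stat_nonneg)
  also have "\<dots> = ennreal C * emeasure ?Q A" by (simp add: nn_integral_cmult)
  finally have en0: "e n0 \<le> ennreal C * emeasure ?Q A" .
  have "(\<integral>\<^sup>+\<omega>. indicator A \<omega> * ennreal_of_enat (T a \<omega> + 1 - enat \<nu>) \<partial>?Q)
      = (\<integral>\<^sup>+\<omega>. (\<Sum>i. indicator (A \<inter> alive a (n0 + i)) \<omega>) \<partial>?Q)"
  proof (rule nn_integral_cong)
    fix \<omega> assume "\<omega> \<in> space ?Q"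
    then have sp: "\<omega> \<in> space (P \<infinity>)" using space_P[OF \<nu>'] by simp
    have "enat (\<nu> + i) \<le> T a \<omega> \<longleftrightarrow> \<omega> \<in> alive a (n0 + i)" for i
      using ac_time_gt_iff[of a "n0 + i" \<omega>] a a1_pos \<nu> sp by (simp add: n0_def alive_def)
    then show "indicator A \<omega> * ennreal_of_enat (T a \<omega> + 1 - enat \<nu>) = (\<Sum>i. indicator (A \<inter> alive a (n0 + i)) \<omega>)"
      unfolding ennreal_of_enat_diff by (cases "\<omega> \<in> A") (auto simp: indicator_def of_bool_def)
  qed
  also have "\<dots> = (\<Sum>i. emeasure ?Q (A \<inter> alive a (n0 + i)))"
    by (subst nn_integral_suminf) auto
  also have "\<dots> \<le> e n0"
    unfolding suminf_eq_SUP
  proof (rule SUP_least)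
    fix k
    show "(\<Sum>i<k. emeasure ?Q (A \<inter> alive a (n0 + i))) \<le> e n0"
      using sum[of k] by (rule order_trans[rotated]) simp
  qed
  finally show ?thesis using en0 by (rule order_trans)
qed

text \<open>The Shiryaev--Roberts recursion driven by the increments of the statistic.\<close>

primrec R :: "nat \<Rightarrow> 'a \<Rightarrow> real" where
  "R 0 \<omega> = 0"
| "R (Suc n) \<omega> = (1 + R n \<omega>) * exp (if a1 \<le> S n \<omega> then llr (V (Suc n) \<omega>) else low_llr (V (Suc n) \<omega>))"

declare R.simps(2) [simp del]

lemma R_nonneg: "0 \<le> R n \<omega>"
  by (induction n) (auto simp: R.simps(2))

text \<open>The reset to \<open>a1\<close> only lowers the statistic, reflection at \<open>0\<close>
  is the maximum with \<open>1\<close>, and \<open>exp (S n \<omega>) \<le> 1 + R n \<omega>\<close>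
  is just what the recursion for \<open>R\<close> multiplies.\<close>

lemma exp_ac_stat_le: "exp (S n \<omega>) \<le> max 1 (R n \<omega>)"
proof (induction n)
  case (Suc n)
  define d where "d = (if a1 \<le> S n \<omega> then llr (V (Suc n) \<omega>) else low_llr (V (Suc n) \<omega>))"
  have "exp (S (Suc n) \<omega>) \<le> exp (max 0 (S n \<omega> + d))"
    by (simp add: ac_stat_Suc regime_step_def d_def)
  also have "\<dots> = max 1 (exp (S n \<omega>) * exp d)"
    by (simp add: max_def exp_add[symmetric])
  also have "\<dots> \<le> max 1 (R (Suc n) \<omega>)"
  proof -
    have "exp (S n \<omega>) \<le> 1 + R n \<omega>" using Suc R_nonneg[of n \<omega>] by simp
    then have "exp (S n \<omega>) * exp d \<le> (1 + R n \<omega>) * exp d" by simp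
    then show ?thesis by (simp add: R.simps(2) d_def[symmetric] max.coboundedI2)
  qed
  finally show ?case .
qed simp

lemma measurable_R: "R n \<in> borel_measurable (G n)"
proof (induction n)
  case (Suc n)
  have [measurable]: "R n \<in> borel_measurable (G (Suc n))" "S n \<in> borel_measurable (G (Suc n))"
    by (rule measurable_G_mono[OF _ Suc], simp, rule measurable_G_mono[OF _ measurable_S], simp)
  have V: "V (Suc n) \<in> measurable (G (Suc n)) BM" by (rule measurable_V_G) auto
  have [measurable]: "(\<lambda>\<omega>. llr (V (Suc n) \<omega>)) \<in> borel_measurable (G (Suc n))"
    "(\<lambda>\<omega>. low_llr (V (Suc n) \<omega>)) \<in> borel_measurable (G (Suc n))"
    using measurable_compose[OF V measurable_llr] measurable_compose[OF V low_llr_facts(1)] by simp_all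
  show ?case unfolding R.simps by measurable
qed simp

text \<open>Optional stopping as bookkeeping with nonnegative terms: the mean of \<open>R\<close> on
  surviving paths plus \<open>exp a\<close> times the stopped mass is at most the mean number of
  steps taken. An infinite mean time needs no proof.\<close>

lemma arl_ge:
  assumes a: "0 < a" shows "ennreal (exp a) \<le> arl P (T a)"
proof (cases "arl P (T a) = \<infinity>")
  case False
  let ?Q = "P \<infinity>"
  interpret prob_space ?Q by (rule prob) simp
  have [measurable]: "alive a n \<in> sets ?Q" for n by (rule alive_sets) simp
  have [measurable]: "R n \<in> borel_measurable ?Q" for n by (rule measurable_from_G[OF _ measurable_R]) simp
  define b where "b n = (\<integral>\<^sup>+\<omega>. indicator (alive a n) \<omega> * ennreal (R n \<omega>) \<partial>?Q)" for n
  have alive_mono: "alive a (Suc n) \<subseteq> alive a n" for n by (auto simp: alive_Suc)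
  have step: "b (Suc n) + ennreal (exp a) * emeasure ?Q (alive a n - alive a (Suc n)) \<le> emeasure ?Q (alive a n) + b n" for n
  proof -
    define F where "F = (\<lambda>(\<omega>, v). indicator (alive a n) \<omega> *
      ennreal ((1 + R n \<omega>) * exp (if a1 \<le> S n \<omega> then llr v else low_llr v)) :: ennreal)"
    have [measurable]: "S n \<in> borel_measurable (G n)" "R n \<in> borel_measurable (G n)" "alive a n \<in> sets (G n)"
      "low_llr \<in> borel_measurable BM"
      using measurable_S measurable_R alive_G low_llr_facts by auto
    have F: "F \<in> borel_measurable (G n \<Otimes>\<^sub>M BM)"
      unfolding F_def by measurable
    have "b (Suc n) + ennreal (exp a) * emeasure ?Q (alive a n - alive a (Suc n))
        = (\<integral>\<^sup>+\<omega>. indicator (alive a (Suc n)) \<omega> * ennreal (R (Suc n) \<omega>)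
          + ennreal (exp a) * indicator (alive a n - alive a (Suc n)) \<omega> \<partial>?Q)"
      unfolding b_def by (subst nn_integral_add) (auto simp: nn_integral_cmult)
    also have "\<dots> \<le> (\<integral>\<^sup>+\<omega>. F (\<omega>, V (Suc n) \<omega>) \<partial>?Q)"
    proof (rule nn_integral_mono)
      fix \<omega>
      consider "\<omega> \<notin> alive a n" | "\<omega> \<in> alive a (Suc n)" "\<omega> \<in> alive a n"
        | "\<omega> \<in> alive a n" "\<omega> \<notin> alive a (Suc n)" using alive_mono by blast
      then show "indicator (alive a (Suc n)) \<omega> * ennreal (R (Suc n) \<omega>)
          + ennreal (exp a) * indicator (alive a n - alive a (Suc n)) \<omega> \<le> F (\<omega>, V (Suc n) \<omega>)"
      proof cases
        case 3
        \<comment> \<open>At the alarm \<open>exp a > 1\<close>, so the maximum that dominates the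
          statistic is attained by \<open>R\<close>.\<close>
        then have "a \<le> S (Suc n) \<omega>" by (auto simp: alive_Suc)
        then have "exp a \<le> max 1 (R (Suc n) \<omega>)"
          using exp_ac_stat_le[of "Suc n" \<omega>] by (meson exp_le_cancel_iff order_trans)
        moreover have "1 < exp a" using a by simp
        ultimately have "exp a \<le> R (Suc n) \<omega>" by (simp add: max_def split: if_splits)
        then show ?thesis using 3 by (auto simp: F_def R.simps(2)[symmetric] intro!: ennreal_leI)
      qed (use alive_mono[of n] in \<open>auto simp: F_def R.simps(2) indicator_def\<close>)
    qed
    also have "\<dots> = (\<integral>\<^sup>+\<omega>. (\<integral>\<^sup>+v. F (\<omega>, v) \<partial>W0) \<partial>?Q)"
      using nn_integral_indep[OF _ _ F, of \<infinity> "Suc n"] by simp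
    also have "\<dots> = (\<integral>\<^sup>+\<omega>. indicator (alive a n) \<omega> + indicator (alive a n) \<omega> * ennreal (R n \<omega>) \<partial>?Q)"
    proof (rule nn_integral_cong)
      fix \<omega>
      have m: "(\<lambda>v. ennreal (exp (if a1 \<le> S n \<omega> then llr v else low_llr v))) \<in> borel_measurable W0"
        unfolding measurable_cong_sets[OF sets_W(1) refl] by measurable
      have "(\<integral>\<^sup>+v. F (\<omega>, v) \<partial>W0) = indicator (alive a n) \<omega> * ennreal (1 + R n \<omega>) *
          (\<integral>\<^sup>+v. ennreal (exp (if a1 \<le> S n \<omega> then llr v else low_llr v)) \<partial>W0)"
        unfolding F_def using R_nonneg[of n \<omega>] m
        by (subst nn_integral_cmult[symmetric]) (auto simp: ennreal_mult mult.assoc)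
      also have "(\<integral>\<^sup>+v. ennreal (exp (if a1 \<le> S n \<omega> then llr v else low_llr v)) \<partial>W0) = 1"
        using low_llr_facts(4) llr_exp_integral(1) by (cases "a1 \<le> S n \<omega>") simp_all
      finally show "(\<integral>\<^sup>+v. F (\<omega>, v) \<partial>W0) = indicator (alive a n) \<omega> + indicator (alive a n) \<omega> * ennreal (R n \<omega>)"
        using R_nonneg[of n \<omega>] by (simp add: ennreal_plus distrib_left)
    qed
    also have "\<dots> = emeasure ?Q (alive a n) + b n"
      unfolding b_def by (subst nn_integral_add) auto
    finally show ?thesis .
  qed
  have alive0: "alive a 0 = space ?Q" using a by (auto simp: alive_def)
  have sum: "b n + ennreal (exp a) * emeasure ?Q (space ?Q - alive a n) \<le> (\<Sum>k<n. emeasure ?Q (alive a k))" for n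
  proof (induction n)
    case 0
    show ?case by (simp add: b_def alive0)
  next
    case (Suc n)
    have sub: "alive a n \<subseteq> space ?Q" by (auto simp: alive_def)
    have "emeasure ?Q (space ?Q - alive a (Suc n)) = emeasure ?Q (space ?Q - alive a n) + emeasure ?Q (alive a n - alive a (Suc n))"
      using alive_mono[of n] sub by (subst plus_emeasure) (auto intro!: arg_cong[where f="emeasure ?Q"])
    then have "b (Suc n) + ennreal (exp a) * emeasure ?Q (space ?Q - alive a (Suc n))
        = (b (Suc n) + ennreal (exp a) * emeasure ?Q (alive a n - alive a (Suc n))) + ennreal (exp a) * emeasure ?Q (space ?Q - alive a n)"
      by (simp add: distrib_left add_ac)
    also have "\<dots> \<le> (emeasure ?Q (alive a n) + b n) + ennreal (exp a) * emeasure ?Q (space ?Q - alive a n)"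
      by (intro add_right_mono step)
    also have "\<dots> = (b n + ennreal (exp a) * emeasure ?Q (space ?Q - alive a n)) + emeasure ?Q (alive a n)"
      by (simp add: add_ac)
    also have "\<dots> \<le> (\<Sum>k<n. emeasure ?Q (alive a k)) + emeasure ?Q (alive a n)"
      by (intro add_right_mono Suc)
    finally show ?case by simp
  qed
  have "arl P (T a) = (\<integral>\<^sup>+\<omega>. (\<Sum>i. indicator (alive a i) \<omega>) \<partial>?Q)"
    unfolding arl_def
  proof (rule nn_integral_cong)
    fix \<omega> assume "\<omega> \<in> space ?Q"
    then show "ennreal_of_enat (T a \<omega>) = (\<Sum>i. indicator (alive a i) \<omega>)"
      unfolding ennreal_of_enat_eq_suminf ac_time_gt_iff[OF a]
      by (intro suminf_cong) (auto simp: alive_def indicator_def)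
  qed
  also have "\<dots> = (\<Sum>i. emeasure ?Q (alive a i))"
    by (subst nn_integral_suminf) auto
  finally have arl_eq: "arl P (T a) = (\<Sum>i. emeasure ?Q (alive a i))" .
  obtain x where x: "arl P (T a) = ennreal x" "0 \<le> x"
    using False by (cases "arl P (T a)") auto
  have partial: "(\<Sum>k<n. measure ?Q (alive a k)) \<le> x" for n
  proof -
    have "ennreal (\<Sum>k<n. measure ?Q (alive a k)) = (\<Sum>k<n. emeasure ?Q (alive a k))"
      by (simp add: emeasure_eq_measure sum_ennreal)
    also have "\<dots> \<le> ennreal x"
      unfolding x(1)[symmetric] arl_eq by (rule sum_le_suminf) auto
    finally show ?thesis using x(2) by simp
  qed
  have "exp a * (1 - measure ?Q (alive a n)) \<le> x" for n
  proof -
    have "measure ?Q (space ?Q - alive a n) = 1 - measure ?Q (alive a n)"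
      by (rule prob_compl) measurable
    then have "ennreal (exp a * (1 - measure ?Q (alive a n))) = ennreal (exp a) * emeasure ?Q (space ?Q - alive a n)"
      by (simp add: emeasure_eq_measure ennreal_mult)
    also have "\<dots> \<le> b n + ennreal (exp a) * emeasure ?Q (space ?Q - alive a n)" by simp
    also have "\<dots> \<le> ennreal (\<Sum>k<n. measure ?Q (alive a k))"
      using sum[of n] by (simp add: emeasure_eq_measure sum_ennreal)
    also have "\<dots> \<le> ennreal x" by (intro ennreal_leI partial)
    finally show ?thesis using x(2) by simp
  qed
  \<comment> \<open>A finite mean time makes the survival probabilities summable, so in the limit
    all mass is stopped.\<close>
  moreover have "(\<lambda>n. exp a * (1 - measure ?Q (alive a n))) \<longlonglongrightarrow> exp a * (1 - 0)"
  proof (intro tendsto_intros)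
    have "(\<Sum>k\<le>n. measure ?Q (alive a k)) \<le> x" for n
      using partial[of "Suc n"] by (simp only: lessThan_Suc_atMost)
    then have "summable (\<lambda>n. measure ?Q (alive a n))"
      by (intro bounded_imp_summable[where B=x]) auto
    then show "(\<lambda>n. measure ?Q (alive a n)) \<longlonglongrightarrow> 0" by (rule summable_LIMSEQ_zero)
  qed
  ultimately have "exp a \<le> x" by (intro LIMSEQ_le_const2[where X="\<lambda>n. exp a * (1 - measure ?Q (alive a n))"]) auto
  then show ?thesis unfolding x(1) by (rule ennreal_leI)
qed simp

section \<open>Adaptedness of the algorithm and its asymptotic delay\<close>

abbreviation \<Psi> :: "nat \<Rightarrow> nat \<Rightarrow> 'a \<Rightarrow> real \<Rightarrow> bool" where
  "\<Psi> \<equiv> ac_policy M f0 f1 P X \<psi>s a1 \<epsilon>1"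

text \<open>Policy and statistic depend on each other; induction on time breaks the circle. In the
  full regime the masked observation is the observation itself, and in the censored regime a missing
  one contributes a constant, so the transmitted data determine every increment.\<close>

lemma measurable_S_IA: "S k \<in> borel_measurable (IA \<Psi> k)"
proof (induction k)
  case (Suc k)
  have S[measurable]: "S k \<in> borel_measurable (IA \<Psi> (Suc k))"
    by (rule measurable_IA_mono[OF _ Suc]) simp
  define \<gamma> where "\<gamma> m = transmits X \<Psi> m (Suc k)" for m
  define y where "y m \<omega> = of_bool (\<gamma> m \<omega>) * X m (Suc k) \<omega>" for m \<omega>
  define K where "K m = ln (measure (N1 m) {x. \<not> \<psi>s m (\<epsilon>1 m) x} / measure (N0 m) {x. \<not> \<psi>s m (\<epsilon>1 m) x})" for m
  define r where "r m x = ln (f1 m x / f0 m x)" for m x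
  have ym: "Measurable.pred (IA \<Psi> (Suc k)) (\<gamma> m)" "(\<lambda>\<omega>. r m (y m \<omega>)) \<in> borel_measurable (IA \<Psi> (Suc k))"
    if m: "m \<in> {1..M}" for m
  proof -
    show "Measurable.pred (IA \<Psi> (Suc k)) (\<gamma> m)"
      unfolding \<gamma>_def by (rule measurable_transmits_IA) (use m in auto)
    have "y m \<in> borel_measurable (IA \<Psi> (Suc k))"
      unfolding y_def[abs_def] \<gamma>_def by (rule measurable_transmits_IA) (use m in auto)
    then show "(\<lambda>\<omega>. r m (y m \<omega>)) \<in> borel_measurable (IA \<Psi> (Suc k))"
      unfolding r_def using measurable_sensor_ratio[OF m] by (rule measurable_compose)
  qed
  have fullm[measurable]: "(\<lambda>\<omega>. \<Sum>m=1..M. r m (y m \<omega>)) \<in> borel_measurable (IA \<Psi> (Suc k))"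
    by (intro borel_measurable_sum ym)
  have lowm[measurable]: "(\<lambda>\<omega>. \<Sum>m=1..M. if \<gamma> m \<omega> then r m (y m \<omega>) else K m) \<in> borel_measurable (IA \<Psi> (Suc k))"
  proof (rule borel_measurable_sum)
    fix m assume m: "m \<in> {1..M}"
    note [measurable] = ym[OF m]
    show "(\<lambda>\<omega>. if \<gamma> m \<omega> then r m (y m \<omega>) else K m) \<in> borel_measurable (IA \<Psi> (Suc k))" by measurable
  qed
  have eq: "S (Suc k) = (\<lambda>\<omega>. regime_step a1 (S k \<omega>) (\<Sum>m=1..M. r m (y m \<omega>))
      (\<Sum>m=1..M. if \<gamma> m \<omega> then r m (y m \<omega>) else K m))"
  proof
    fix \<omega>
    show "S (Suc k) \<omega> = regime_step a1 (S k \<omega>) (\<Sum>m=1..M. r m (y m \<omega>))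
      (\<Sum>m=1..M. if \<gamma> m \<omega> then r m (y m \<omega>) else K m)"
    proof (cases "a1 \<le> S k \<omega>")
      case True
      have "y m \<omega> = V (Suc k) \<omega> m" if m: "m \<in> {1..M}" for m
        using m True full_strategy[OF m] by (simp add: y_def \<gamma>_def transmits_def ac_policy_def V_def)
      then have "(\<Sum>m=1..M. r m (y m \<omega>)) = llr (V (Suc k) \<omega>)"
        unfolding llr_def r_def by (intro sum.cong) auto
      then show ?thesis using True by (simp add: ac_stat_Suc regime_step_def)
    next
      case False
      have "(if \<gamma> m \<omega> then r m (y m \<omega>) else K m) = sensor_llr m (\<psi>s m (\<epsilon>1 m)) (V (Suc k) \<omega> m)" if m: "m \<in> {1..M}" for m
        using m False by (simp add: sensor_llr_eq[OF m low_strategy(1)[OF m]] y_def \<gamma>_def transmits_def ac_policy_def V_def r_def K_def)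
      then have "(\<Sum>m=1..M. if \<gamma> m \<omega> then r m (y m \<omega>) else K m) = low_llr (V (Suc k) \<omega>)"
        unfolding low_llr_def clr_def by (intro sum.cong) auto
      then show ?thesis using False by (simp add: ac_stat_Suc regime_step_def)
    qed
  qed
  show ?case unfolding eq by (rule measurable_regime_step[OF S fullm lowm])
qed simp

lemma censoring_policy_AC: "censoring_policy M P X \<Psi>"
  unfolding censoring_policy_def
proof (intro ballI allI impI)
  fix m k :: nat assume m: "m \<in> {1..M}" and k: "1 \<le> k"
  have [measurable]: "S (k - 1) \<in> borel_measurable (IA \<Psi> (k - 1))" by (rule measurable_S_IA)
  have [measurable]: "Measurable.pred borel (\<psi>s m (\<epsilon>1 m))"
    using low_strategy(1)[OF m] by (simp add: censoring_strategy_def)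
  \<comment> \<open>As the full strategy always transmits, the choice of regime becomes a
    disjunction.\<close>
  have "Measurable.pred (IA \<Psi> (k - 1) \<Otimes>\<^sub>M borel) (\<lambda>p. a1 \<le> S (k - 1) (fst p) \<or> \<psi>s m (\<epsilon>1 m) (snd p))"
    by measurable
  also have "(\<lambda>p. a1 \<le> S (k - 1) (fst p) \<or> \<psi>s m (\<epsilon>1 m) (snd p)) = (\<lambda>(\<omega>, x). \<Psi> m k \<omega> x)"
    using full_strategy[OF m] by (auto simp: ac_policy_def fun_eq_iff)
  finally show "Measurable.pred (IA \<Psi> (k - 1) \<Otimes>\<^sub>M borel) (\<lambda>(\<omega>, x). \<Psi> m k \<omega> x)" .
qed

lemma info_stopping_time_AC:
  assumes a: "0 < a" shows "info_stopping_time M P X \<Psi> (T a)"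
  unfolding info_stopping_time_def
proof
  fix k
  have m: "{\<omega> \<in> space (IA \<Psi> k). S j \<omega> < a} \<in> sets (IA \<Psi> k)" if "j \<in> {..k}" for j
    using that
    by (intro borel_measurable_less measurable_IA_mono[OF _ measurable_S_IA] borel_measurable_const) simp
  define B where "B \<omega> \<longleftrightarrow> (\<forall>j\<in>{..k}. S j \<omega> < a)" for \<omega>
  have [measurable]: "Measurable.pred (IA \<Psi> k) B"
    unfolding pred_def B_def by (rule sets.sets_Collect_finite_All[OF m finite_atMost])
  have "T a \<omega> \<le> enat k \<longleftrightarrow> \<not> B \<omega>" for \<omega>
  proof -
    have "T a \<omega> \<le> enat k \<longleftrightarrow> \<not> enat (Suc k) \<le> T a \<omega>" by (cases "T a \<omega>") auto
    then show ?thesis unfolding ac_time_gt_iff[OF a] B_def by auto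
  qed
  then have "(\<lambda>\<omega>. T a \<omega> \<le> enat k) = (\<lambda>\<omega>. \<not> B \<omega>)" by (intro ext)
  moreover have "Measurable.pred (IA \<Psi> k) (\<lambda>\<omega>. \<not> B \<omega>)" by measurable
  ultimately show "Measurable.pred (IA \<Psi> k) (\<lambda>\<omega>. T a \<omega> \<le> enat k)" by (simp only:)
qed

text \<open>The constant is fixed before the threshold \<open>a\<close>, so its share vanishes
  relative to \<open>a\<close>.\<close>

lemma lorden_upper_bound:
  assumes "1 < \<rho>"
  obtains C where "0 \<le> C"
    "\<And>a. a1 < a \<Longrightarrow> lorden_delay M P X (T a) \<Psi> \<le> ennreal (\<rho> * a / Isum + C)"
proof -
  interpret W1: prob_space W1 by (rule prob_space_W)
  note pot = W1.exists_hitting_potential[OF llr_mean(1) _ _ low_llr_facts(2,3) a1_pos assms, unfolded llr_mean(2)]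
  obtain C where C: "0 \<le> C" "\<And>a. a1 < a \<Longrightarrow> \<exists>u\<in>borel_measurable borel. (\<forall>s. 0 \<le> u s) \<and>
      (\<forall>s\<ge>0. u s \<le> \<rho> * a / Isum + C) \<and>
      (\<forall>s. 0 \<le> s \<longrightarrow> s < a \<longrightarrow> (\<integral>\<^sup>+v. ennreal (u (regime_step a1 s (llr v) (low_llr v))) \<partial>W1) + 1 \<le> ennreal (u s))"
    by (rule pot[OF llr_mean(3)]) (simp add: llr_exp_integral(2), blast)
  show thesis
  proof (rule that[OF C(1)])
    fix a assume a: "a1 < a"
    obtain u where u: "u \<in> borel_measurable borel" "\<And>s. 0 \<le> s \<Longrightarrow> u s \<le> \<rho> * a / Isum + C"
      "\<And>s. 0 \<le> s \<Longrightarrow> s < a \<Longrightarrow> (\<integral>\<^sup>+v. ennreal (u (regime_step a1 s (llr v) (low_llr v))) \<partial>W1) + 1 \<le> ennreal (u s)"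
      using C(2)[OF a] by blast
    have "0 < a" using a a1_pos by simp
    show "lorden_delay M P X (T a) \<Psi> \<le> ennreal (\<rho> * a / Isum + C)"
      using censoring_policy_AC info_stopping_time_AC[OF \<open>0 < a\<close>]
    proof (rule lorden_delay_leI)
      fix \<nu> :: nat and A assume \<nu>: "1 \<le> \<nu>" and A: "A \<in> sets (IA \<Psi> (\<nu> - 1))"
      show "(\<integral>\<^sup>+\<omega>. indicator A \<omega> * ennreal_of_enat (T a \<omega> + 1 - enat \<nu>) \<partial>P (enat \<nu>))
          \<le> ennreal (\<rho> * a / Isum + C) * emeasure (P (enat \<nu>)) A"
        using a \<nu> sets_IA_G[OF censoring_policy_AC A] u by (rule delay_bound)
    qed
  qed
qed

lemma ac_delay_le:
  assumes "1 < y"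
  shows "\<forall>\<^sub>F \<zeta> in at_top. lorden_delay M P X (T (ln \<zeta>)) \<Psi> \<le> ennreal (y * (ln \<zeta> / Isum))"
proof -
  \<comment> \<open>A factor strictly between \<open>1\<close> and \<open>y\<close>, leaving a
    multiple of \<open>ln \<zeta>\<close> to absorb the constant.\<close>
  define \<rho> where "\<rho> = (1 + y) / 2"
  have \<rho>: "1 < \<rho>" "\<rho> < y" using assms by (auto simp: \<rho>_def)
  obtain C where C: "\<And>a. a1 < a \<Longrightarrow> lorden_delay M P X (T a) \<Psi> \<le> ennreal (\<rho> * a / Isum + C)"
    using lorden_upper_bound[OF \<rho>(1)] by blast
  have "\<forall>\<^sub>F \<zeta> in at_top. C \<le> (y - \<rho>) / Isum * ln \<zeta>"
    using \<rho> llr_mean(3) by (intro eventually_le_mult_ln) simp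
  then have "\<forall>\<^sub>F \<zeta> in at_top. \<rho> * ln \<zeta> / Isum + C \<le> y * (ln \<zeta> / Isum)"
    by eventually_elim (simp add: diff_divide_distrib left_diff_distrib)
  moreover have "\<forall>\<^sub>F \<zeta> in at_top. a1 < ln \<zeta>" by real_asymp
  ultimately show ?thesis
    by eventually_elim (use C in \<open>blast intro: order_trans ennreal_leI\<close>)
qed

end

theorem theorem4:
  fixes M :: nat
    and f0 f1 :: "nat \<Rightarrow> real \<Rightarrow> real"
    and P :: "enat \<Rightarrow> 'a measure"
    and X :: "nat \<Rightarrow> nat \<Rightarrow> 'a \<Rightarrow> real"
    and \<psi>s :: "nat \<Rightarrow> real \<Rightarrow> real \<Rightarrow> bool"
    and \<epsilon> a1 :: real
    and \<epsilon>1 :: "nat \<Rightarrow> real"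
  defines "T \<equiv> \<lambda>\<zeta>. ac_time M f0 f1 P X \<psi>s a1 \<epsilon>1 (ereal (ln \<zeta>))"
    and "\<Psi> \<equiv> ac_policy M f0 f1 P X \<psi>s a1 \<epsilon>1"
  assumes "change_model M f0 f1 P X"
    and "\<And>m. m \<in> {1..M} \<Longrightarrow> 0 < kl_info (f1 m) (f0 m) \<and> kl_info (f1 m) (f0 m) < \<infinity>"
    and "\<And>m. m \<in> {1..M} \<Longrightarrow> 0 < kl_info (f0 m) (f1 m) \<and> kl_info (f0 m) (f1 m) < \<infinity>"
    and "optimal_censoring M f0 f1 P X \<psi>s"
    and "0 < \<epsilon>"
    and "0 < a1"
    and "\<epsilon>1 \<in> admissible_rates M f0 f1 P X \<psi>s \<epsilon> a1"
  shows "(\<forall>\<zeta>\<ge>1. a1 < ln \<zeta> \<longrightarrow>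
            ennreal \<zeta> \<le> arl P (T \<zeta>) \<and> comm_rate M P X (T \<zeta>) \<Psi> \<le> ereal \<epsilon>)
    \<and> ((\<lambda>\<zeta>. lorden_delay M P X (T \<zeta>) \<Psi> /
              (INF (T', \<Psi>')\<in>feasible M P X \<epsilon> \<zeta>. lorden_delay M P X T' \<Psi>')) \<longlongrightarrow> 1) at_top
    \<and> (\<exists>\<delta>\<in>o(\<lambda>_. 1). \<forall>\<^sub>F \<zeta> in at_top.
          lorden_delay M P X (T \<zeta>) \<Psi> =
            ennreal (ln \<zeta> / (\<Sum>m=1..M. real_of_ereal (kl_info (f1 m) (f0 m))) * (1 + \<delta> \<zeta>)))"
proof -
  interpret change_model M f0 f1 P X by fact
  interpret AC: ac_algorithm M f0 f1 P X \<psi>s a1 \<epsilon>1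
    using assms(4-9) by unfold_locales (auto simp: admissible_rates_def)
  have constraints: "ennreal \<zeta> \<le> arl P (T \<zeta>) \<and> comm_rate M P X (T \<zeta>) \<Psi> \<le> ereal \<epsilon>"
    if "1 \<le> \<zeta>" "a1 < ln \<zeta>" for \<zeta>
  proof
    have "0 < ln \<zeta>" using that assms(8) by linarith
    from AC.arl_ge[OF this] show "ennreal \<zeta> \<le> arl P (T \<zeta>)" using that by (simp add: T_def)
    show "comm_rate M P X (T \<zeta>) \<Psi> \<le> ereal \<epsilon>"
      using that assms(9) by (simp add: admissible_rates_def T_def \<Psi>_def)
  qed
  define I where "I = (\<Sum>m=1..M. real_of_ereal (kl_info (f1 m) (f0 m)))"
  have I: "0 < I" using AC.llr_mean(3) by (simp add: I_def AC.Isum_def)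
  define D where "D \<zeta> = lorden_delay M P X (T \<zeta>) \<Psi>" for \<zeta>
  define N where "N \<zeta> = (INF (T', \<Psi>')\<in>feasible M P X \<epsilon> \<zeta>. lorden_delay M P X T' \<Psi>')" for \<zeta>
  define g where "g \<zeta> = ln \<zeta> / I" for \<zeta>
  have g: "\<forall>\<^sub>F \<zeta> in at_top. 0 < g \<zeta>" unfolding g_def using I by real_asymp
  \<comment> \<open>The algorithm is itself feasible. With the lower bound for the optimum
    \<open>N\<close> and the upper bound for \<open>D\<close>, this squeezes both to
    \<open>g\<close>.\<close>
  have ND: "\<forall>\<^sub>F \<zeta> in at_top. N \<zeta> \<le> D \<zeta>"
  proof -
    have "\<forall>\<^sub>F \<zeta> in at_top. a1 < ln \<zeta>" by real_asymp
    then show ?thesis using eventually_ge_at_top[of 1]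
    proof eventually_elim
      case (elim \<zeta>)
      then have "0 < ln \<zeta>" using assms(8) by linarith
      with elim have "(T \<zeta>, \<Psi>) \<in> feasible M P X \<epsilon> \<zeta>"
        using constraints AC.censoring_policy_AC AC.info_stopping_time_AC[of "ln \<zeta>"]
        by (simp add: feasible_def T_def \<Psi>_def del: ln_gt_zero_iff)
      then show ?case unfolding N_def D_def by (rule INF_lower2) simp
    qed
  qed
  have lo: "\<forall>\<^sub>F \<zeta> in at_top. ennreal (y * g \<zeta>) \<le> N \<zeta>" if "y < 1" for y
    using AC.feasible_delay_ge[OF that, of \<epsilon>] unfolding N_def g_def I_def AC.Isum_def[symmetric]
    by eventually_elim (auto intro!: INF_greatest)
  have hi: "\<forall>\<^sub>F \<zeta> in at_top. D \<zeta> \<le> ennreal (y * g \<zeta>)" if "1 < y" for y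
    using AC.ac_delay_le[OF that] unfolding D_def T_def \<Psi>_def g_def I_def AC.Isum_def[symmetric] .
  have loD: "\<forall>\<^sub>F \<zeta> in at_top. ennreal (y * g \<zeta>) \<le> D \<zeta>" if "y < 1" for y
    using lo[OF that] ND by eventually_elim (rule order_trans)
  have hiN: "\<forall>\<^sub>F \<zeta> in at_top. N \<zeta> \<le> ennreal (y * g \<zeta>)" if "1 < y" for y
    using ND hi[OF that] by eventually_elim (rule order_trans)
  have limD: "((\<lambda>\<zeta>. enn2real (D \<zeta>) / g \<zeta>) \<longlongrightarrow> 1) at_top" "\<forall>\<^sub>F \<zeta> in at_top. D \<zeta> = ennreal (enn2real (D \<zeta>))"
    by (rule tendsto_enn2real_ratio[OF loD hi g]; assumption)+
  have limN: "((\<lambda>\<zeta>. enn2real (N \<zeta>) / g \<zeta>) \<longlongrightarrow> 1) at_top" "\<forall>\<^sub>F \<zeta> in at_top. N \<zeta> = ennreal (enn2real (N \<zeta>))"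
    by (rule tendsto_enn2real_ratio[OF lo hiN g]; assumption)+
  have "((\<lambda>\<zeta>. ennreal ((enn2real (D \<zeta>) / g \<zeta>) / (enn2real (N \<zeta>) / g \<zeta>))) \<longlongrightarrow> ennreal (1 / 1)) at_top"
    by (intro tendsto_ennrealI tendsto_divide limD limN) simp_all
  \<comment> \<open>Eventually both delays are finite and \<open>N\<close> is positive, so the
    extended quotient is a real one, in which \<open>g\<close> cancels.\<close>
  moreover have "\<forall>\<^sub>F \<zeta> in at_top. ennreal ((enn2real (D \<zeta>) / g \<zeta>) / (enn2real (N \<zeta>) / g \<zeta>)) = D \<zeta> / N \<zeta>"
    using limD(2) limN(2) order_tendstoD(1)[OF limN(1), of 0, simplified] g
  proof eventually_elim
    case (elim \<zeta>)
    then have "0 < enn2real (N \<zeta>)" by (simp add: zero_less_divide_iff)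
    then have "ennreal (enn2real (D \<zeta>)) / ennreal (enn2real (N \<zeta>)) = ennreal (enn2real (D \<zeta>) / enn2real (N \<zeta>))"
      by (intro divide_ennreal) auto
    then show ?case using elim by simp
  qed
  ultimately have "((\<lambda>\<zeta>. D \<zeta> / N \<zeta>) \<longlongrightarrow> ennreal (1 / 1)) at_top"
    by (rule Lim_transform_eventually)
  then have ratio: "((\<lambda>\<zeta>. D \<zeta> / N \<zeta>) \<longlongrightarrow> 1) at_top" by simp
  define \<delta> where "\<delta> \<zeta> = enn2real (D \<zeta>) / g \<zeta> - 1" for \<zeta>
  have "(\<delta> \<longlongrightarrow> 1 - 1) at_top" unfolding \<delta>_def by (intro tendsto_diff limD(1) tendsto_const)
  then have "\<delta> \<in> o(\<lambda>_. 1)" by (intro smalloI_tendsto) auto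
  moreover have "\<forall>\<^sub>F \<zeta> in at_top. D \<zeta> = ennreal (ln \<zeta> / I * (1 + \<delta> \<zeta>))"
    using limD(2) g
  proof eventually_elim
    case (elim \<zeta>)
    then have "ln \<zeta> / I * (1 + \<delta> \<zeta>) = enn2real (D \<zeta>)" by (simp add: \<delta>_def g_def[symmetric])
    with elim show ?case by simp
  qed
  ultimately show ?thesis
    using constraints ratio unfolding D_def N_def I_def by blast
qed

end
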